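(* If the linear system $X_{t+1}=AX_t+BU_t+W_t$ is mean square stable over the Gaussian relay network (i.e. under some given choice of encoder, relay and controller policies), then (under those policies) $$\log\left(|\det(A)|\right)\le \liminf_{T\to\infty}\frac1T\, I\left(\bar X_{[0,T-1]}\to R_{[0,T-1]}\right),$$ where $\{\bar X_t\}$ is the uncontrolled state process obtained by setting $U_t=0$, i.e. $\bar X_{t+1}=A\bar X_t+W_t$ with $\bar X_0=X_0$, and $$I\left(\bar X_{[0,T-1]}\to R_{[0,T-1]}\right)=\sum_{t=0}^{T-1} I\left(\bar X_{[0,t]};R_t\mid R_{[0,t-1]}\right)$$ is the directed information from the uncontrolled state process to the sequence of variables received by the controller.
   Context: Notation: $\mathbb N=\{0,1,2,\dots\}$, $X_{[0,t]}=(X_0,\dots,X_t)$, $\log$ is base 2, $h(\cdot)$ is differential entropy, $I(\cdot;\cdot\mid\cdot)$ is conditional mutual information. Plant: $X_{t+1}=AX_t+BU_t+W_t$, $t\in\mathbb N$, with state $X_t\in\mathbb R^n$, control $U_t\in\mathbb R^m$, plant noise $W_t\in\mathbb R^n$. The initial state $X_0$ is a random vector with $|h(X_0)|<\infty$ and a given covariance matrix $\Lambda_0$. $\{W_t\}$ is a zero-mean white (i.i.d.) Gaussian sequence with covariance $K_W$, independent of $X_0$. The pair $(A,B)$ is controllable and all eigenvalues $\lambda_i$ of $A$ satisfy $|\lambda_i|\ge 1$. Gaussian relay network: a sensor/encoder observes the state and transmits $S_{e,t}=f_t(X_{[0,t]},U_{[0,t-1]})\in\mathbb R$ into a network of relay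 nodes, with average power constraint $\lim_{T\to\infty}\frac1T\sum_{t=0}^{T-1}\mathbb E[S_{e,t}^2]\le P_S$. The relay nodes operate causally: each transmits a function of the signals it has received (its own received signals only), subject to an average transmit power constraint. All communication links are white Gaussian channels: a received signal is a linear combination of transmitted signals plus zero-mean white Gaussian noise; the channel noises are independent of $X_0$ and $\{W_t\}$. $R_t$ denotes the network output received at time $t$ by the remote decoder/controller, which applies $U_t=\pi_t(R_{[0,t]})$. The system is mean square stable if there is a constant $M<\infty$ with $\mathbb E[\|X_t\|^2]<M$ for all $t$. *)

theory Defs
  imports "HOL-Probability.Probability"
begin

section \<open>Linear systems\<close>

text \<open>
  Kalman rank condition: the controllability matrix \<open>[B, A B, \<dots>, A^(n-1) B]\<close> has rank \<open>n\<close>.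
  Powers of \<open>A\<close> are iterated with \<open>**\<close>, because \<open>A ^ k\<close> would be the componentwise power.
\<close>

definition controllable :: "real^'n^'n \<Rightarrow> real^'m^'n \<Rightarrow> bool" where
  "controllable A B \<longleftrightarrow>
     dim (\<Union>k<CARD('n). columns (((\<lambda>C. A ** C) ^^ k) B)) = CARD('n)"

definition eigenvalue :: "real^'n^'n \<Rightarrow> complex \<Rightarrow> bool" where
  "eigenvalue A \<mu> \<longleftrightarrow>
     (\<exists>v :: complex^'n. v \<noteq> 0 \<and> map_matrix complex_of_real A *v v = \<mu> *s v)"

primrec uncontrolled ::
    "real^'n^'n \<Rightarrow> ('w \<Rightarrow> real^'n) \<Rightarrow> (nat \<Rightarrow> 'w \<Rightarrow> real^'n) \<Rightarrow> nat \<Rightarrow> 'w \<Rightarrow> real^'n" where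
  "uncontrolled A X0 W 0 = X0"
| "uncontrolled A X0 W (Suc t) = (\<lambda>\<omega>. A *v uncontrolled A X0 W t \<omega> + W t \<omega>)"


section \<open>Random vectors and processes\<close>

definition has_covariance :: "'w measure \<Rightarrow> ('w \<Rightarrow> real^'n) \<Rightarrow> real^'n^'n \<Rightarrow> bool" where
  "has_covariance M X \<Lambda> \<longleftrightarrow>
     X \<in> borel_measurable M \<and> integrable M (\<lambda>\<omega>. (norm (X \<omega>))\<^sup>2) \<and>
     (\<forall>i j. \<Lambda> $ i $ j =
        (\<integral>\<omega>. (X \<omega> $ i - (\<integral>\<omega>'. X \<omega>' $ i \<partial>M)) * (X \<omega> $ j - (\<integral>\<omega>'. X \<omega>' $ j \<partial>M)) \<partial>M))"

text \<open>
  \<open>|h(X)| < \<infinity>\<close>: \<open>X\<close> has a Lebesgue density \<open>f\<close> for which \<open>f log f\<close> is integrable.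
\<close>

definition finite_diff_entropy :: "'w measure \<Rightarrow> ('w \<Rightarrow> real^'n) \<Rightarrow> bool" where
  "finite_diff_entropy M X \<longleftrightarrow> (\<exists>f. information_space.finite_entropy M 2 lborel X f)"

text \<open>
  Zero-mean Gaussian vector with covariance \<open>K\<close>: every linear functional \<open>v \<bullet> X\<close> is a
  centred Gaussian variable of variance \<open>v\<^sup>T K v\<close>.  The covariance may be singular, in which
  case some of the functionals vanish almost surely.
\<close>

definition gaussian_vector :: "'w measure \<Rightarrow> ('w \<Rightarrow> real^'n) \<Rightarrow> real^'n^'n \<Rightarrow> bool" where
  "gaussian_vector M X K \<longleftrightarrow>
     X \<in> borel_measurable M \<and> transpose K = K \<and>
     (\<forall>v. 0 \<le> v \<bullet> (K *v v) \<and>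
        (if v \<bullet> (K *v v) = 0 then AE \<omega> in M. v \<bullet> X \<omega> = 0
         else distributed M lborel (\<lambda>\<omega>. v \<bullet> X \<omega>) (normal_density 0 (sqrt (v \<bullet> (K *v v))))))"

definition white_gaussian :: "'w measure \<Rightarrow> (nat \<Rightarrow> 'w \<Rightarrow> real^'n) \<Rightarrow> real^'n^'n \<Rightarrow> bool" where
  "white_gaussian M W K \<longleftrightarrow>
     prob_space.indep_vars M (\<lambda>_. borel) W UNIV \<and> (\<forall>t. gaussian_vector M (W t) K)"

text \<open>
  The library's \<open>indep_var\<close> for two random variables, except that it requires both to have the
  same type of values.
\<close>

definition independent_rvs ::
    "'w measure \<Rightarrow> 'x measure \<Rightarrow> ('w \<Rightarrow> 'x) \<Rightarrow> 'y measure \<Rightarrow> ('w \<Rightarrow> 'y) \<Rightarrow> bool" where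
  "independent_rvs M MX X MY Y \<longleftrightarrow>
     X \<in> measurable M MX \<and> Y \<in> measurable M MY \<and>
     prob_space.indep_set M {X -` S \<inter> space M |S. S \<in> sets MX} {Y -` S \<inter> space M |S. S \<in> sets MY}"

definition mean_square_stable :: "'w measure \<Rightarrow> (nat \<Rightarrow> 'w \<Rightarrow> real^'n) \<Rightarrow> bool" where
  "mean_square_stable M X \<longleftrightarrow>
     (\<exists>C::real. \<forall>t. (\<integral>\<^sup>+\<omega>. ennreal ((norm (X t \<omega>))\<^sup>2) \<partial>M) < ennreal C)"

text \<open>
  Integrability is part of the constraint: a finite limit of the averages forces every
  \<open>E[S\<^sub>t\<^sup>2]\<close> to be finite, whereas the Bochner integral of a non-integrable function is \<open>0\<close>.
\<close>

definition avg_power_le :: "'w measure \<Rightarrow> (nat \<Rightarrow> 'w \<Rightarrow> real) \<Rightarrow> real \<Rightarrow> bool" where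
  "avg_power_le M S P \<longleftrightarrow>
     (\<forall>t. integrable M (\<lambda>\<omega>. (S t \<omega>)\<^sup>2)) \<and>
     (\<exists>L\<le>P. (\<lambda>T. 1 / real T * (\<Sum>t<T. \<integral>\<omega>. (S t \<omega>)\<^sup>2 \<partial>M)) \<longlonglongrightarrow> L)"

text \<open>
  The segment \<open>X\<^sub>I = (X\<^sub>s)\<^sub>s\<^sub>\<in>\<^sub>I\<close> of a process as one random variable with values in \<open>seg_space I\<close>;
  \<open>X\<^bsub>[0,t]\<^esub>\<close> is \<open>seg {..t} X\<close> and \<open>X\<^bsub>[0,t-1]\<^esub>\<close> is \<open>seg {..<t} X\<close>, which is trivial for \<open>t = 0\<close>.
\<close>

definition seg :: "nat set \<Rightarrow> (nat \<Rightarrow> 'w \<Rightarrow> 'b) \<Rightarrow> 'w \<Rightarrow> nat \<Rightarrow> 'b" where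
  "seg I X \<omega> = (\<lambda>s\<in>I. X s \<omega>)"

abbreviation seg_space :: "nat set \<Rightarrow> (nat \<Rightarrow> 'b::topological_space) measure" where
  "seg_space I \<equiv> PiM I (\<lambda>_. borel)"


section \<open>Directed information\<close>

text \<open>
  The library's \<open>conditional_mutual_information\<close> is real-valued and defined as
  \<open>I(X; (Y,Z)) - I(X; Z)\<close>, hence meaningful only if both terms are finite.  This is always the
  case for finite-valued \<open>X\<close>.  For arbitrary \<open>X\<close>, \<open>Y\<close> and \<open>Z\<close> the conditional mutual information,
  possibly \<open>\<infinity>\<close>, is by definition (Dobrushin, Wyner) the supremum of \<open>I(f(X); g(Y) | Z)\<close> over
  all finite measurable quantizers \<open>f\<close> and \<open>g\<close>.
\<close>

definition cond_mutual_info ::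
    "real \<Rightarrow> 'w measure \<Rightarrow> 'x measure \<Rightarrow> 'y measure \<Rightarrow> 'z measure \<Rightarrow>
     ('w \<Rightarrow> 'x) \<Rightarrow> ('w \<Rightarrow> 'y) \<Rightarrow> ('w \<Rightarrow> 'z) \<Rightarrow> ereal" where
  "cond_mutual_info b M MX MY MZ X Y Z =
     (SUP (f, g) \<in> {f :: 'x \<Rightarrow> nat. simple_function MX f} \<times> {g :: 'y \<Rightarrow> nat. simple_function MY g}.
        ereal (prob_space.conditional_mutual_information M b (count_space UNIV) (count_space UNIV) MZ
                 (\<lambda>\<omega>. f (X \<omega>)) (\<lambda>\<omega>. g (Y \<omega>)) Z))"

text \<open>\<open>I(X\<^bsub>[0,T-1]\<^esub> \<rightarrow> R\<^bsub>[0,T-1]\<^esub>)\<close>, in bits.\<close>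

definition directed_info ::
    "'w measure \<Rightarrow> (nat \<Rightarrow> 'w \<Rightarrow> 'x::topological_space) \<Rightarrow> (nat \<Rightarrow> 'w \<Rightarrow> 'y::topological_space) \<Rightarrow>
     nat \<Rightarrow> ereal" where
  "directed_info M X R T =
     (\<Sum>t<T. cond_mutual_info 2 M (seg_space {..t}) borel (seg_space {..<t})
                (seg {..t} X) (R t) (seg {..<t} R))"


section \<open>Causal operation of the relays\<close>

text \<open>
  At time \<open>t\<close> the relays in \<open>D t\<close> operate without delay, using what they received during \<open>[0,t]\<close>;
  all others only use what they received during \<open>[0,t-1]\<close>.
\<close>

definition relay_window :: "(nat \<Rightarrow> 'k set) \<Rightarrow> 'k \<Rightarrow> nat \<Rightarrow> nat set" where
  "relay_window D i t = (if i \<in> D t then {..t} else {..<t})"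

text \<open>
  Causality for delay-free operation: \<open>h t i j\<close> is the gain vector from relay \<open>j\<close> to relay \<open>i\<close>, and
  no delay-free relay may (directly or through others) hear its own current transmission, as the
  transmitted signals would otherwise be given only implicitly by an algebraic loop.  The
  condition is void if \<open>D t\<close> is empty.
\<close>

definition no_algebraic_loop :: "(nat \<Rightarrow> 'k set) \<Rightarrow> (nat \<Rightarrow> 'k \<Rightarrow> 'k \<Rightarrow> 'g::zero) \<Rightarrow> bool" where
  "no_algebraic_loop D h \<longleftrightarrow> (\<forall>t. acyclic {(j, i). j \<in> D t \<and> i \<in> D t \<and> h t i j \<noteq> 0})"

end

theory Submission
  imports Defs
begin

text \<open>
  Let \<open>S = R\<^bsub>[0,t-1]\<^esub>\<close> and let \<open>Xb\<close> be the uncontrolled state.  Each term of the directed information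
  is at least \<open>I(Xb\<^sub>t; R\<^sub>t | S) = h(Xb\<^sub>t | S) - h(Xb\<^sub>t | S, R\<^sub>t)\<close>.  The noise \<open>W\<^sub>t\<close> is independent of
  \<open>(Xb\<^sub>t, S, R\<^sub>t)\<close> and can only increase entropy, so
  \<open>h(Xb\<^bsub>t+1\<^esub> | S, R\<^sub>t) \<ge> h(A Xb\<^sub>t | S, R\<^sub>t) = log |det A| + h(Xb\<^sub>t | S, R\<^sub>t)\<close>.
  The sum over \<open>t < T\<close> telescopes to \<open>T log |det A| + h(X\<^sub>0) - h(Xb\<^sub>T | R\<^bsub>[0,T-1]\<^esub>)\<close>.  Since the controls
  are functions of \<open>R\<close>, the last entropy equals \<open>h(X\<^sub>T | R\<^bsub>[0,T-1]\<^esub>)\<close>, which is bounded by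
  comparison with a Gaussian density because \<open>E[|X\<^sub>T|\<^sup>2]\<close> is bounded.

  Conditional densities need not exist, so conditional entropies enter only through their
  variational bounds against test densities.  In this form the noise step is Fubini's theorem, and
  the step from \<open>S\<close> to \<open>(S, R\<^sub>t)\<close> reduces to finite quantizers by approximating a test density in
  \<open>L\<^sup>1\<close> by functions of \<open>(f x, g y, s)\<close> with \<open>f\<close> and \<open>g\<close> simple.
\<close>

section \<open>Variational bounds on relative entropy\<close>

text \<open>The information terms are suprema over finite quantizers, and each quantized term is a
  difference \<open>I(Q; (G, S)) - I(Q; S)\<close>. To use it, the first part must bound all test
  densities for \<open>(Q, (G, S))\<close>, while the second must be attained by an explicit density
  for \<open>(Q, S)\<close>. For finite-valued \<open>Q\<close> both are available.

  Lebesgue measure is infinite, so a test density is divided by a positive reference density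
  \<open>m\<close> of mass at most 1 before it is approximated. The reference drops out of the final
  bound. All it has to provide is an integrable logarithm along the state, which a Gaussian does
  once second moments are finite.

  The recursion propagates a single number, \<alpha> to \<alpha> + \<iota> - log |det A|, and never
  subtracts two entropies, so undefined differences cannot occur. The controls are compensated only
  at time \<open>T\<close>, by a Gaussian recentred by a function of the outputs.

  Causality enters once: \<open>W t\<close> must be independent of the outputs up to and including
  time \<open>t\<close>, although relays may act without delay. This is read off from measurability
  with respect to the sigma-algebra generated by all primitive variables except the plant noise from
  time \<open>t\<close> on.\<close>

text \<open>
  By the Gibbs variational principle this says that the relative entropy of the law of \<open>Z\<close> with
  respect to \<open>N\<close> is at most \<open>a\<close>; no density of the law has to exist.  For \<open>Z = (X, S)\<close> and \<open>N\<close> the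
  product of \<open>lborel\<close> with the law of \<open>S\<close> it is the bound \<open>- a \<le> h(X | S)\<close>.
\<close>

definition rel_entropy_le :: "'w measure \<Rightarrow> 'z measure \<Rightarrow> ('w \<Rightarrow> 'z) \<Rightarrow> real \<Rightarrow> bool" where
  "rel_entropy_le M N Z a \<longleftrightarrow>
     (\<forall>r\<in>borel_measurable N. (\<forall>z. 0 \<le> r z) \<longrightarrow> (\<integral>\<^sup>+z. ennreal (r z) \<partial>N) \<le> 1 \<longrightarrow>
        (AE \<omega> in M. 0 < r (Z \<omega>)) \<longrightarrow> integrable M (\<lambda>\<omega>. log 2 (r (Z \<omega>))) \<longrightarrow>
        (\<integral>\<omega>. log 2 (r (Z \<omega>)) \<partial>M) \<le> a)"

lemma rel_entropy_leD:
  fixes r :: "'z \<Rightarrow> real"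
  assumes "rel_entropy_le M N Z a" "r \<in> borel_measurable N" "\<And>z. 0 \<le> r z"
    "(\<integral>\<^sup>+z. ennreal (r z) \<partial>N) \<le> 1" "AE \<omega> in M. 0 < r (Z \<omega>)"
    "integrable M (\<lambda>\<omega>. log 2 (r (Z \<omega>)))"
  shows "(\<integral>\<omega>. log 2 (r (Z \<omega>)) \<partial>M) \<le> a"
  using assms unfolding rel_entropy_le_def by blast

text \<open>Normalizing a test function of mass at most \<open>c\<close> to mass at most 1 shifts
  its logarithm by \<open>log 2 c\<close>.\<close>

lemma (in prob_space) rel_entropy_leD_scaled:
  fixes r :: "'z \<Rightarrow> real"
  assumes Z: "rel_entropy_le M N Z a" and Zm[measurable]: "Z \<in> measurable M N"
    and r[measurable]: "r \<in> borel_measurable N" and r0: "\<And>z. 0 \<le> r z"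
    and c: "0 < c" "(\<integral>\<^sup>+z. ennreal (r z) \<partial>N) \<le> ennreal c"
    and pos: "AE \<omega> in M. 0 < r (Z \<omega>)" and int: "integrable M (\<lambda>\<omega>. log 2 (r (Z \<omega>)))"
  shows "(\<integral>\<omega>. log 2 (r (Z \<omega>)) \<partial>M) \<le> a + log 2 c"
proof -
  have ae: "AE \<omega> in M. log 2 (r (Z \<omega>)) - log 2 c = log 2 (r (Z \<omega>) / c)"
    using pos by eventually_elim (use c in \<open>simp add: log_divide\<close>)
  have eq: "(\<integral>\<omega>. log 2 (r (Z \<omega>)) - log 2 c \<partial>M) = (\<integral>\<omega>. log 2 (r (Z \<omega>) / c) \<partial>M)"
    by (rule integral_cong_AE[OF _ _ ae]) measurable
  have "integrable M (\<lambda>\<omega>. log 2 (r (Z \<omega>)) - log 2 c)"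
    using int by simp
  then have int': "integrable M (\<lambda>\<omega>. log 2 (r (Z \<omega>) / c))"
    by (rule integrable_cong_AE_imp) (use ae in \<open>auto elim: eventually_mono\<close>)
  have "(\<integral>\<^sup>+z. ennreal (r z / c) \<partial>N) = (\<integral>\<^sup>+z. ennreal (r z) \<partial>N) / ennreal c"
    using c r0 by (simp add: divide_ennreal[symmetric] nn_integral_divide)
  also have "\<dots> \<le> ennreal c / ennreal c"
    by (intro divide_right_mono_ennreal c)
  also have "\<dots> = 1" using c by (simp add: divide_ennreal)
  finally have "(\<integral>\<^sup>+z. ennreal (r z / c) \<partial>N) \<le> 1" .
  then have "(\<integral>\<omega>. log 2 (r (Z \<omega>) / c) \<partial>M) \<le> a"
    using c r0 pos int' by (intro rel_entropy_leD[OF Z]) auto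
  then show ?thesis
    using eq int by (simp add: prob_space)
qed

text \<open>Gibbs' inequality: with \<open>q = r / p\<close>, the mean of \<open>q\<close> under the
  law is at most the mass of \<open>r\<close>, and \<open>ln q \<le> q - 1\<close> makes the mean of
  \<open>log r - log p\<close> nonpositive. So among test densities \<open>p\<close> itself is
  optimal.\<close>

lemma (in prob_space) rel_entropy_le_density:
  fixes p :: "'z \<Rightarrow> real"
  assumes Z[measurable]: "Z \<in> measurable M N" and p[measurable]: "p \<in> borel_measurable N"
    and distr: "distr M N Z = density N p"
    and int_p: "integrable M (\<lambda>\<omega>. log 2 (p (Z \<omega>)))"
    and pos_p: "AE \<omega> in M. 0 < p (Z \<omega>)"
  shows "rel_entropy_le M N Z (\<integral>\<omega>. log 2 (p (Z \<omega>)) \<partial>M)"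
  unfolding rel_entropy_le_def
proof (intro ballI impI)
  fix r :: "'z \<Rightarrow> real"
  assume r[measurable]: "r \<in> borel_measurable N" and r0: "\<forall>z. 0 \<le> r z" 
    and r1: "(\<integral>\<^sup>+z. ennreal (r z) \<partial>N) \<le> 1"
    and pos_r: "AE \<omega> in M. 0 < r (Z \<omega>)" and int_r: "integrable M (\<lambda>\<omega>. log 2 (r (Z \<omega>)))"
  define q where "q z = (if 0 < p z then r z / p z else 0)" for z
  have [measurable]: "q \<in> borel_measurable N"
    unfolding q_def by measurable
  have q0: "0 \<le> q z" for z using r0 by (simp add: q_def)
  have "(\<integral>\<^sup>+\<omega>. ennreal (q (Z \<omega>)) \<partial>M) = (\<integral>\<^sup>+z. ennreal (q z) \<partial>distr M N Z)"
    by (simp add: nn_integral_distr)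
  also have "\<dots> = (\<integral>\<^sup>+z. ennreal (p z) * ennreal (q z) \<partial>N)"
    unfolding distr by (simp add: nn_integral_density)
  also have "\<dots> \<le> (\<integral>\<^sup>+z. ennreal (r z) \<partial>N)"
    by (intro nn_integral_mono) (use r0 in \<open>auto simp: q_def ennreal_mult'[symmetric] ennreal_neg\<close>)
  also note r1
  finally have q1: "(\<integral>\<^sup>+\<omega>. ennreal (q (Z \<omega>)) \<partial>M) \<le> 1" .
  then have int_q: "integrable M (\<lambda>\<omega>. q (Z \<omega>))"
    using q0 by (intro integrableI_bounded) (auto simp: order_le_less_trans)
  have "ennreal (\<integral>\<omega>. q (Z \<omega>) \<partial>M) \<le> 1"
    using q1 int_q q0 by (subst nn_integral_eq_integral[symmetric]) auto
  then have q1': "(\<integral>\<omega>. q (Z \<omega>) \<partial>M) \<le> 1" by simp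
  have "(\<integral>\<omega>. log 2 (r (Z \<omega>)) \<partial>M) - (\<integral>\<omega>. log 2 (p (Z \<omega>)) \<partial>M) =
      (\<integral>\<omega>. log 2 (r (Z \<omega>)) - log 2 (p (Z \<omega>)) \<partial>M)"
    using int_r int_p by simp
  also have "\<dots> \<le> (\<integral>\<omega>. (q (Z \<omega>) - 1) / ln 2 \<partial>M)"
  proof (rule integral_mono_AE)
    show "AE \<omega> in M. log 2 (r (Z \<omega>)) - log 2 (p (Z \<omega>)) \<le> (q (Z \<omega>) - 1) / ln 2"
      using pos_p pos_r
    proof eventually_elim
      case (elim \<omega>)
      then have "log 2 (r (Z \<omega>)) - log 2 (p (Z \<omega>)) = ln (q (Z \<omega>)) / ln 2"
        by (simp add: q_def log_def ln_div diff_divide_distrib)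
      also have "\<dots> \<le> (q (Z \<omega>) - 1) / ln 2"
        using elim by (intro divide_right_mono ln_le_minus_one) (auto simp: q_def)
      finally show ?case .
    qed
  qed (use int_q int_r int_p in auto)
  also have "\<dots> = ((\<integral>\<omega>. q (Z \<omega>) \<partial>M) - 1) / ln 2"
    using int_q by (simp add: prob_space)
  also have "\<dots> \<le> 0" using q1' by (simp add: divide_le_0_iff)
  finally show "(\<integral>\<omega>. log 2 (r (Z \<omega>)) \<partial>M) \<le> (\<integral>\<omega>. log 2 (p (Z \<omega>)) \<partial>M)" by simp
qed

text \<open>A test density for the image is pulled back to \<open>(x, s)\<close>. By
  \<open>scale\<close>, where \<open>c\<close> plays the role of a Jacobian, the pullback has mass
  at most \<open>1 / c\<close>, and this improves the bound by \<open>log 2 c\<close>. The map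
  \<open>h\<close> merely rewrites the observation.\<close>

lemma (in prob_space) rel_entropy_le_transform:
  assumes X[measurable]: "X \<in> measurable M N0" and S[measurable]: "S \<in> measurable M PS"
    and T[measurable]: "T \<in> measurable (N0 \<Otimes>\<^sub>M PS) N1" and h[measurable]: "h \<in> measurable PS PS'"
    and N0: "sigma_finite_measure N0" and N1: "sigma_finite_measure N1"
    and c: "0 < c"
    and scale: "\<And>s g. s \<in> space PS \<Longrightarrow> g \<in> borel_measurable N1 \<Longrightarrow>
      ennreal c * (\<integral>\<^sup>+x. g (T (x, s)) \<partial>N0) = (\<integral>\<^sup>+y. g y \<partial>N1)"
    and le: "rel_entropy_le M (N0 \<Otimes>\<^sub>M distr M PS S) (\<lambda>\<omega>. (X \<omega>, S \<omega>)) a"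
  shows "rel_entropy_le M (N1 \<Otimes>\<^sub>M distr M PS' (\<lambda>\<omega>. h (S \<omega>))) (\<lambda>\<omega>. (T (X \<omega>, S \<omega>), h (S \<omega>))) (a - log 2 c)"
  unfolding rel_entropy_le_def
proof (intro ballI impI)
  let ?DS = "distr M PS S" and ?DS' = "distr M PS' (\<lambda>\<omega>. h (S \<omega>))"
  interpret DS: prob_space ?DS by (rule prob_space_distr) fact
  interpret DS': prob_space ?DS' by (rule prob_space_distr) measurable
  interpret A: pair_sigma_finite N0 ?DS
    using N0 by (simp add: pair_sigma_finite_def DS.sigma_finite_measure_axioms)
  interpret B: pair_sigma_finite N1 ?DS'
    using N1 by (simp add: pair_sigma_finite_def DS'.sigma_finite_measure_axioms)
  fix r :: "_ \<Rightarrow> real"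
  assume "r \<in> borel_measurable (N1 \<Otimes>\<^sub>M ?DS')" and r0: "\<forall>z. 0 \<le> r z" 
    and r1: "(\<integral>\<^sup>+z. ennreal (r z) \<partial>(N1 \<Otimes>\<^sub>M ?DS')) \<le> 1"
    and pos_r: "AE \<omega> in M. 0 < r (T (X \<omega>, S \<omega>), h (S \<omega>))"
    and int_r: "integrable M (\<lambda>\<omega>. log 2 (r (T (X \<omega>, S \<omega>), h (S \<omega>))))"
  then have r[measurable]: "r \<in> borel_measurable (N1 \<Otimes>\<^sub>M PS')" by simp
  define q where "q = (\<lambda>(x, s). r (T (x, s), h s))"
  have q[measurable]: "q \<in> borel_measurable (N0 \<Otimes>\<^sub>M PS)"
    unfolding q_def by measurable
  have "ennreal c * (\<integral>\<^sup>+z. ennreal (q z) \<partial>(N0 \<Otimes>\<^sub>M ?DS)) =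
      ennreal c * (\<integral>\<^sup>+s. \<integral>\<^sup>+x. ennreal (q (x, s)) \<partial>N0 \<partial>?DS)"
    by (subst A.nn_integral_snd) auto
  also have "\<dots> = (\<integral>\<^sup>+s. ennreal c * (\<integral>\<^sup>+x. ennreal (q (x, s)) \<partial>N0) \<partial>?DS)"
    by (subst nn_integral_cmult) auto
  also have "\<dots> = (\<integral>\<^sup>+s. (\<integral>\<^sup>+y. ennreal (r (y, h s)) \<partial>N1) \<partial>?DS)"
    by (intro nn_integral_cong) (simp add: q_def scale[of _ "\<lambda>y. ennreal (r (y, h _))"])
  also have "\<dots> = (\<integral>\<^sup>+s. (\<integral>\<^sup>+y. ennreal (r (y, s)) \<partial>N1) \<partial>?DS')"
    by (simp add: nn_integral_distr)
  also have "\<dots> \<le> 1" using r1 by (subst B.nn_integral_snd) auto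
  finally have "ennreal c * (\<integral>\<^sup>+z. ennreal (q z) \<partial>(N0 \<Otimes>\<^sub>M ?DS)) \<le> 1" .
  then have q1: "(\<integral>\<^sup>+z. ennreal (q z) \<partial>(N0 \<Otimes>\<^sub>M ?DS)) \<le> ennreal (1 / c)"
    using c by (cases "\<integral>\<^sup>+z. ennreal (q z) \<partial>(N0 \<Otimes>\<^sub>M ?DS)")
      (auto simp: ennreal_mult'[symmetric] ennreal_mult_top field_simps top_unique)
  have "(\<integral>\<omega>. log 2 (q (X \<omega>, S \<omega>)) \<partial>M) \<le> a + log 2 (1 / c)"
    by (rule rel_entropy_leD_scaled[OF le]) (use r0 pos_r int_r c q1 in \<open>auto simp: q_def\<close>)
  then show "(\<integral>\<omega>. log 2 (r (T (X \<omega>, S \<omega>), h (S \<omega>))) \<partial>M) \<le> a - log 2 c"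
    using c by (simp add: q_def log_divide)
qed

text \<open>Independent noise cannot decrease conditional entropy: the same test density is
  admissible for every frozen value \<open>w\<close>, and Fubini averages the bounds. Positivity and
  integrability along the path pass to almost every section.\<close>

lemma (in prob_space) rel_entropy_le_mixture:
  assumes W[measurable]: "W \<in> measurable M PW" and V[measurable]: "V \<in> measurable M PV"
    and T[measurable]: "T \<in> measurable (PW \<Otimes>\<^sub>M PV) N"
    and indep: "distr M (PW \<Otimes>\<^sub>M PV) (\<lambda>\<omega>. (W \<omega>, V \<omega>)) = distr M PW W \<Otimes>\<^sub>M distr M PV V"
    and le: "\<And>w. w \<in> space PW \<Longrightarrow> rel_entropy_le M N (\<lambda>\<omega>. T (w, V \<omega>)) a"
  shows "rel_entropy_le M N (\<lambda>\<omega>. T (W \<omega>, V \<omega>)) a"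
  unfolding rel_entropy_le_def
proof (intro ballI impI)
  let ?W = "distr M PW W" and ?V = "distr M PV V"
  interpret W: prob_space ?W by (rule prob_space_distr) fact
  interpret V: prob_space ?V by (rule prob_space_distr) fact
  interpret pair_prob_space ?W ?V ..
  fix r :: "_ \<Rightarrow> real"
  assume r[measurable]: "r \<in> borel_measurable N" and r0: "\<forall>z. 0 \<le> r z" 
    and r1: "(\<integral>\<^sup>+z. ennreal (r z) \<partial>N) \<le> 1"
    and pos_r: "AE \<omega> in M. 0 < r (T (W \<omega>, V \<omega>))"
    and int_r: "integrable M (\<lambda>\<omega>. log 2 (r (T (W \<omega>, V \<omega>))))"
  have int: "integrable (?W \<Otimes>\<^sub>M ?V) (\<lambda>z. log 2 (r (T z)))"
    using int_r unfolding indep[symmetric] by (subst integrable_distr_eq) auto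
  have "AE z in ?W \<Otimes>\<^sub>M ?V. 0 < r (T z)"
    using pos_r unfolding indep[symmetric] by (subst AE_distr_iff) auto
  then have "AE w in ?W. AE v in ?V. 0 < r (T (w, v))"
    by (rule AE_pair)
  moreover have "AE w in ?W. integrable ?V (\<lambda>v. log 2 (r (T (w, v))))"
    by (rule AE_integrable_fst'[OF int])
  moreover have "AE w in ?W. w \<in> space PW" using AE_space[of ?W] by simp
  ultimately have ae: "AE w in ?W. (\<integral>v. log 2 (r (T (w, v))) \<partial>?V) \<le> a"
  proof eventually_elim
    case (elim w)
    have [measurable]: "(\<lambda>v. T (w, v)) \<in> measurable PV N" using elim by measurable
    have "(\<integral>\<omega>. log 2 (r (T (w, V \<omega>))) \<partial>M) \<le> a"
      by (rule rel_entropy_leD[OF le[OF elim(3)]])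
        (use elim r0 r1 in \<open>auto simp: AE_distr_iff integrable_distr_eq\<close>)
    then show ?case using elim by (simp add: integral_distr)
  qed
  have "(\<integral>\<omega>. log 2 (r (T (W \<omega>, V \<omega>))) \<partial>M) = (\<integral>z. log 2 (r (T z)) \<partial>(?W \<Otimes>\<^sub>M ?V))"
    unfolding indep[symmetric] by (subst integral_distr) auto
  also have "\<dots> = (\<integral>w. (\<integral>v. log 2 (r (T (w, v))) \<partial>?V) \<partial>?W)"
    by (rule integral_fst'[OF int, symmetric])
  also have "\<dots> \<le> (\<integral>w. a \<partial>?W)"
    by (rule integral_mono_AE[OF integrable_fst'[OF int] _ ae]) simp
  also have "\<dots> = a" using W.prob_space by simp
  finally show "(\<integral>\<omega>. log 2 (r (T (W \<omega>, V \<omega>))) \<partial>M) \<le> a" .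
qed


section \<open>Approximation by quantized functions\<close>

text \<open>Density in L1(\<nu>) of functions that see \<open>x\<close> only through a finite
  partition. The component \<open>z\<close> stays unquantized, so that the statement can be applied
  to one variable after the other.\<close>

definition simple_approximable ::
    "('x \<times> 'z) measure \<Rightarrow> 'x measure \<Rightarrow> 'z measure \<Rightarrow> ('x \<times> 'z \<Rightarrow> real) \<Rightarrow> bool" where
  "simple_approximable \<nu> PX PZ \<phi> \<longleftrightarrow> \<phi> \<in> borel_measurable (PX \<Otimes>\<^sub>M PZ) \<and>
     (\<forall>\<epsilon>>0. \<exists>(f :: 'x \<Rightarrow> nat) \<psi>. simple_function PX f \<and>
        \<psi> \<in> borel_measurable (count_space UNIV \<Otimes>\<^sub>M PZ) \<and>
        (\<integral>\<^sup>+(x, z). ennreal \<bar>\<phi> (x, z) - \<psi> (f x, z)\<bar> \<partial>\<nu>) < ennreal \<epsilon>)"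

lemma simple_approximableE:
  assumes "simple_approximable \<nu> PX PZ \<phi>" "0 < \<epsilon>"
  obtains f :: "'x \<Rightarrow> nat" and \<psi> where "simple_function PX f"
    "\<psi> \<in> borel_measurable (count_space UNIV \<Otimes>\<^sub>M PZ)" "f \<in> measurable PX (count_space UNIV)"
    "(\<integral>\<^sup>+(x, z). ennreal \<bar>\<phi> (x, z) - \<psi> (f x, z)\<bar> \<partial>\<nu>) < ennreal \<epsilon>"
proof -
  from assms obtain f :: "'x \<Rightarrow> nat" and \<psi> where "simple_function PX f"
    "\<psi> \<in> borel_measurable (count_space UNIV \<Otimes>\<^sub>M PZ)"
    "(\<integral>\<^sup>+(x, z). ennreal \<bar>\<phi> (x, z) - \<psi> (f x, z)\<bar> \<partial>\<nu>) < ennreal \<epsilon>"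
    unfolding simple_approximable_def by blast
  then show ?thesis by (intro that measurable_simple_function)
qed

lemma simple_approximable_closure:
  fixes \<phi> :: "'x \<times> 'z \<Rightarrow> real"
  assumes [measurable_cong]: "sets \<nu> = sets (PX \<Otimes>\<^sub>M PZ)"
    and \<phi>[measurable]: "\<phi> \<in> borel_measurable (PX \<Otimes>\<^sub>M PZ)"
    and ex: "\<And>\<epsilon>. 0 < \<epsilon> \<Longrightarrow> \<exists>\<phi>'. simple_approximable \<nu> PX PZ \<phi>' \<and>
      (\<integral>\<^sup>+z. ennreal \<bar>\<phi> z - \<phi>' z\<bar> \<partial>\<nu>) < ennreal \<epsilon>"
  shows "simple_approximable \<nu> PX PZ \<phi>"
  unfolding simple_approximable_def
proof (intro conjI allI impI)
  fix \<epsilon> :: real assume \<epsilon>: "0 < \<epsilon>"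
  obtain \<phi>' where \<phi>': "simple_approximable \<nu> PX PZ \<phi>'"
    and less: "(\<integral>\<^sup>+z. ennreal \<bar>\<phi> z - \<phi>' z\<bar> \<partial>\<nu>) < ennreal (\<epsilon>/2)"
    using ex[of "\<epsilon>/2"] \<epsilon> by auto
  from \<phi>' have [measurable]: "\<phi>' \<in> borel_measurable (PX \<Otimes>\<^sub>M PZ)"
    by (simp add: simple_approximable_def)
  from \<phi>' obtain f :: "'x \<Rightarrow> nat" and \<psi> where f: "simple_function PX f"
    and [measurable]: "\<psi> \<in> borel_measurable (count_space UNIV \<Otimes>\<^sub>M PZ)" "f \<in> measurable PX (count_space UNIV)"
    and less': "(\<integral>\<^sup>+(x, z). ennreal \<bar>\<phi>' (x, z) - \<psi> (f x, z)\<bar> \<partial>\<nu>) < ennreal (\<epsilon>/2)"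
    by (rule simple_approximableE[of _ _ _ _ "\<epsilon>/2"]) (use \<epsilon> in auto)
  have "(\<integral>\<^sup>+(x, z). ennreal \<bar>\<phi> (x, z) - \<psi> (f x, z)\<bar> \<partial>\<nu>) \<le>
      (\<integral>\<^sup>+(x, z). ennreal \<bar>\<phi> (x, z) - \<phi>' (x, z)\<bar> + ennreal \<bar>\<phi>' (x, z) - \<psi> (f x, z)\<bar> \<partial>\<nu>)"
    by (intro nn_integral_mono) (auto simp flip: ennreal_plus)
  also have "\<dots> = (\<integral>\<^sup>+(x, z). ennreal \<bar>\<phi> (x, z) - \<phi>' (x, z)\<bar> \<partial>\<nu>) +
      (\<integral>\<^sup>+(x, z). ennreal \<bar>\<phi>' (x, z) - \<psi> (f x, z)\<bar> \<partial>\<nu>)"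
    by (subst nn_integral_add[symmetric]) (auto simp: split_beta')
  also have "\<dots> < ennreal (\<epsilon>/2) + ennreal (\<epsilon>/2)"
    using less less' by (intro add_strict_mono) (auto simp: split_beta')
  also have "\<dots> = ennreal \<epsilon>" using \<epsilon> by (simp flip: ennreal_plus)
  finally show "\<exists>(f :: 'x \<Rightarrow> nat) \<psi>. simple_function PX f \<and>
        \<psi> \<in> borel_measurable (count_space UNIV \<Otimes>\<^sub>M PZ) \<and>
        (\<integral>\<^sup>+(x, z). ennreal \<bar>\<phi> (x, z) - \<psi> (f x, z)\<bar> \<partial>\<nu>) < ennreal \<epsilon>"
    using f by (intro exI[of _ f] exI[of _ \<psi>] conjI) simp_all
qed fact

lemma simple_approximable_lim:
  fixes \<phi> :: "'x \<times> 'z \<Rightarrow> real"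
  assumes \<nu>[measurable_cong]: "sets \<nu> = sets (PX \<Otimes>\<^sub>M PZ)"
    and s: "\<And>i. simple_approximable \<nu> PX PZ (s i)"
    and lim: "\<And>z. z \<in> space \<nu> \<Longrightarrow> (\<lambda>i. s i z) \<longlonglongrightarrow> \<phi> z"
    and bound: "\<And>i z. z \<in> space \<nu> \<Longrightarrow> \<bar>s i z\<bar> \<le> w z" and w: "integrable \<nu> w"
  shows "simple_approximable \<nu> PX PZ \<phi>"
proof (rule simple_approximable_closure[OF \<nu>])
  have s_m[measurable]: "s i \<in> borel_measurable (PX \<Otimes>\<^sub>M PZ)" for i
    using s[of i] by (simp add: simple_approximable_def)
  have "\<phi> \<in> borel_measurable \<nu>"
    by (rule borel_measurable_LIMSEQ_metric[OF _ lim]) measurable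
  then show [measurable]: "\<phi> \<in> borel_measurable (PX \<Otimes>\<^sub>M PZ)"
    using \<nu> by (simp cong: measurable_cong_sets)
  have *: "(\<lambda>i. \<integral>\<^sup>+z. ennreal (norm (\<phi> z - s i z)) \<partial>\<nu>) \<longlonglongrightarrow> 0"
  proof (rule nn_integral_dominated_convergence_norm)
    show "(\<integral>\<^sup>+z. ennreal \<bar>w z\<bar> \<partial>\<nu>) < \<infinity>"
      using w by (simp add: integrable_iff_bounded)
    show "AE z in \<nu>. norm (s i z) \<le> \<bar>w z\<bar>" for i
      using order_trans[OF bound abs_ge_self] by (intro AE_I2) simp
  qed (use lim w in auto)
  show "\<exists>\<phi>'. simple_approximable \<nu> PX PZ \<phi>' \<and> (\<integral>\<^sup>+z. ennreal \<bar>\<phi> z - \<phi>' z\<bar> \<partial>\<nu>) < ennreal \<epsilon>"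
    if "0 < \<epsilon>" for \<epsilon>
    using order_tendstoD(2)[OF *, of "ennreal \<epsilon>"] s that
    by (auto dest!: eventually_happens)
qed

lemma simple_approximable_add:
  fixes \<phi>1 \<phi>2 :: "'x \<times> 'z \<Rightarrow> real"
  assumes [measurable_cong]: "sets \<nu> = sets (PX \<Otimes>\<^sub>M PZ)"
    and "simple_approximable \<nu> PX PZ \<phi>1" "simple_approximable \<nu> PX PZ \<phi>2"
  shows "simple_approximable \<nu> PX PZ (\<lambda>z. \<phi>1 z + \<phi>2 z)"
  unfolding simple_approximable_def
proof (intro conjI allI impI)
  have [measurable]: "\<phi>1 \<in> borel_measurable (PX \<Otimes>\<^sub>M PZ)" "\<phi>2 \<in> borel_measurable (PX \<Otimes>\<^sub>M PZ)"
    using assms by (auto simp add: simple_approximable_def)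
  then show "(\<lambda>z. \<phi>1 z + \<phi>2 z) \<in> borel_measurable (PX \<Otimes>\<^sub>M PZ)" by measurable
  fix \<epsilon> :: real assume \<epsilon>: "0 < \<epsilon>"
  obtain f :: "'x \<Rightarrow> nat" and \<psi> where f: "simple_function PX f"
    and \<psi>[measurable]: "\<psi> \<in> borel_measurable (count_space UNIV \<Otimes>\<^sub>M PZ)" "f \<in> measurable PX (count_space UNIV)"
    and less: "(\<integral>\<^sup>+(x, z). ennreal \<bar>\<phi>1 (x, z) - \<psi> (f x, z)\<bar> \<partial>\<nu>) < ennreal (\<epsilon>/2)"
    by (rule simple_approximableE[OF assms(2), of "\<epsilon>/2"]) (use \<epsilon> in auto)
  obtain f' :: "'x \<Rightarrow> nat" and \<psi>' where f': "simple_function PX f'"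
    and \<psi>'[measurable]: "\<psi>' \<in> borel_measurable (count_space UNIV \<Otimes>\<^sub>M PZ)" "f' \<in> measurable PX (count_space UNIV)"
    and less': "(\<integral>\<^sup>+(x, z). ennreal \<bar>\<phi>2 (x, z) - \<psi>' (f' x, z)\<bar> \<partial>\<nu>) < ennreal (\<epsilon>/2)"
    by (rule simple_approximableE[OF assms(3), of "\<epsilon>/2"]) (use \<epsilon> in auto)
  \<comment> \<open>The common refinement of the two partitions: \<open>prod_encode\<close> packs
    both cell numbers into one natural number.\<close>
  define F where "F x = prod_encode (f x, f' x)" for x
  define \<Psi> where "\<Psi> = (\<lambda>(k, z). \<psi> (fst (prod_decode k), z) + \<psi>' (snd (prod_decode k), z))"
  have F: "simple_function PX F"
    unfolding F_def by (rule simple_function_compose2[OF f f'])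
  have m: "(\<lambda>k. fst (prod_decode k)) \<in> measurable (count_space UNIV) (count_space UNIV)"
    "(\<lambda>k. snd (prod_decode k)) \<in> measurable (count_space UNIV) (count_space UNIV)" by auto
  note m[measurable]
  have \<Psi>: "\<Psi> \<in> borel_measurable (count_space UNIV \<Otimes>\<^sub>M PZ)"
    unfolding \<Psi>_def by measurable
  have "(\<integral>\<^sup>+(x, z). ennreal \<bar>\<phi>1 (x, z) + \<phi>2 (x, z) - \<Psi> (F x, z)\<bar> \<partial>\<nu>) \<le>
      (\<integral>\<^sup>+(x, z). ennreal \<bar>\<phi>1 (x, z) - \<psi> (f x, z)\<bar> + ennreal \<bar>\<phi>2 (x, z) - \<psi>' (f' x, z)\<bar> \<partial>\<nu>)"
    by (intro nn_integral_mono) (auto simp: \<Psi>_def F_def simp flip: ennreal_plus)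
  also have "\<dots> = (\<integral>\<^sup>+(x, z). ennreal \<bar>\<phi>1 (x, z) - \<psi> (f x, z)\<bar> \<partial>\<nu>) +
      (\<integral>\<^sup>+(x, z). ennreal \<bar>\<phi>2 (x, z) - \<psi>' (f' x, z)\<bar> \<partial>\<nu>)"
    by (subst nn_integral_add[symmetric]) (auto simp: split_beta')
  also have "\<dots> < ennreal (\<epsilon>/2) + ennreal (\<epsilon>/2)"
    using less less' by (intro add_strict_mono) auto
  also have "\<dots> = ennreal \<epsilon>" using \<epsilon> by (simp flip: ennreal_plus)
  finally show "\<exists>(f :: 'x \<Rightarrow> nat) \<psi>. simple_function PX f \<and>
        \<psi> \<in> borel_measurable (count_space UNIV \<Otimes>\<^sub>M PZ) \<and>
        (\<integral>\<^sup>+(x, z). ennreal \<bar>\<phi>1 (x, z) + \<phi>2 (x, z) - \<psi> (f x, z)\<bar> \<partial>\<nu>) < ennreal \<epsilon>"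
    using F \<Psi> by (intro exI[of _ F] exI[of _ \<Psi>] conjI)
qed

lemma simple_approximable_step:
  fixes f :: "'x \<Rightarrow> nat"
  assumes f: "simple_function PX f" and [measurable]: "\<psi> \<in> borel_measurable (count_space UNIV \<Otimes>\<^sub>M PZ)"
  shows "simple_approximable \<nu> PX PZ (\<lambda>(x, z). \<psi> (f x, z))"
proof -
  have [measurable]: "f \<in> measurable PX (count_space UNIV)"
    using f by (rule measurable_simple_function)
  have "(\<integral>\<^sup>+(x, z). ennreal \<bar>(\<lambda>(x, z). \<psi> (f x, z)) (x, z) - \<psi> (f x, z)\<bar> \<partial>\<nu>) = 0"
    by (simp add: split_beta')
  then show ?thesis
    unfolding simple_approximable_def using f assms(2) by (intro conjI allI impI exI[of _ f] exI[of _ \<psi>]) simp_all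
qed

lemma simple_approximable_const:
  "simple_approximable \<nu> PX PZ (\<lambda>_. c)"
  using simple_approximable_step[of PX "\<lambda>_. 0" "\<lambda>_. c" PZ \<nu>] by (simp add: split_beta')

lemma simple_approximable_cmult:
  fixes \<phi> :: "'x \<times> 'z \<Rightarrow> real"
  assumes [measurable_cong]: "sets \<nu> = sets (PX \<Otimes>\<^sub>M PZ)"
    and \<phi>: "simple_approximable \<nu> PX PZ \<phi>"
  shows "simple_approximable \<nu> PX PZ (\<lambda>z. c * \<phi> z)"
  unfolding simple_approximable_def
proof (intro conjI allI impI)
  have [measurable]: "\<phi> \<in> borel_measurable (PX \<Otimes>\<^sub>M PZ)"
    using assms by (auto simp add: simple_approximable_def)
  then show "(\<lambda>z. c * \<phi> z) \<in> borel_measurable (PX \<Otimes>\<^sub>M PZ)" by measurable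
  fix \<epsilon> :: real assume \<epsilon>: "0 < \<epsilon>"
  obtain f :: "'x \<Rightarrow> nat" and \<psi> where f: "simple_function PX f"
    and \<psi>[measurable]: "\<psi> \<in> borel_measurable (count_space UNIV \<Otimes>\<^sub>M PZ)" "f \<in> measurable PX (count_space UNIV)"
    and less: "(\<integral>\<^sup>+(x, z). ennreal \<bar>\<phi> (x, z) - \<psi> (f x, z)\<bar> \<partial>\<nu>) < ennreal (\<epsilon> / (\<bar>c\<bar> + 1))"
    by (rule simple_approximableE[OF \<phi>, of "\<epsilon> / (\<bar>c\<bar> + 1)"]) (use \<epsilon> in auto)
  have abs: "ennreal \<bar>c * \<phi> (x, z) - c * \<psi> (f x, z)\<bar> = ennreal \<bar>c\<bar> * ennreal \<bar>\<phi> (x, z) - \<psi> (f x, z)\<bar>" for x z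
    by (simp only: right_diff_distrib[symmetric] abs_mult ennreal_mult' abs_ge_zero)
  have "(\<integral>\<^sup>+(x, z). ennreal \<bar>c * \<phi> (x, z) - c * \<psi> (f x, z)\<bar> \<partial>\<nu>) =
      ennreal \<bar>c\<bar> * (\<integral>\<^sup>+(x, z). ennreal \<bar>\<phi> (x, z) - \<psi> (f x, z)\<bar> \<partial>\<nu>)"
    unfolding abs split_beta' by (subst nn_integral_cmult[symmetric]) simp_all
  also have "\<dots> \<le> ennreal \<bar>c\<bar> * ennreal (\<epsilon> / (\<bar>c\<bar> + 1))"
    using less by (intro mult_left_mono) auto
  also have "\<dots> = ennreal (\<bar>c\<bar> * (\<epsilon> / (\<bar>c\<bar> + 1)))"
    using \<epsilon> by (intro ennreal_mult[symmetric]) auto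
  also have "\<dots> < ennreal \<epsilon>"
    using \<epsilon> by (intro ennreal_lessI) (auto simp: field_simps)
  finally show "\<exists>(f :: 'x \<Rightarrow> nat) \<psi>. simple_function PX f \<and>
        \<psi> \<in> borel_measurable (count_space UNIV \<Otimes>\<^sub>M PZ) \<and>
        (\<integral>\<^sup>+(x, z). ennreal \<bar>c * \<phi> (x, z) - \<psi> (f x, z)\<bar> \<partial>\<nu>) < ennreal \<epsilon>"
    using f by (intro exI[of _ f] exI[of _ "\<lambda>z. c * \<psi> z"] conjI) simp_all
qed

text \<open>Dynkin's argument from rectangles, on which the indicator of \<open>A\<close> is itself
  a quantizer. Complements use linearity and disjoint unions use dominated convergence, with the
  constant 1 integrable because \<nu> is finite.\<close>

lemma simple_approximable_indicator:
  assumes fin: "finite_measure \<nu>" and \<nu>[measurable_cong]: "sets \<nu> = sets (PX \<Otimes>\<^sub>M PZ)"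
    and E: "E \<in> sets (PX \<Otimes>\<^sub>M PZ)"
  shows "simple_approximable \<nu> PX PZ (indicator E)"
  using Int_stable_pair_measure_generator pair_measure_closed E
  unfolding sets_pair_measure
proof (induct rule: sigma_sets_induct_disjoint)
  case (basic C)
  then obtain A B where [measurable]: "A \<in> sets PX" "B \<in> sets PZ" and C: "C = A \<times> B" by auto
  have f: "simple_function PX (indicator A :: _ \<Rightarrow> nat)" by simp
  have [measurable]: "(\<lambda>k. real k) \<in> borel_measurable (count_space UNIV)" by simp
  have "simple_approximable \<nu> PX PZ (\<lambda>(x, z). (\<lambda>(k, z). real k * indicator B z) (indicator A x, z))"
    by (rule simple_approximable_step[OF f]) simp
  also have "(\<lambda>(x, z). (\<lambda>(k, z). real k * indicator B z) (indicator A x, z)) = indicator C"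
    by (auto simp: C indicator_def fun_eq_iff)
  finally show ?case .
next
  case empty
  show ?case using simple_approximable_const[of \<nu> PX PZ 0] by (simp add: indicator_def)
next
  case (compl A)
  have A: "A \<in> sets (PX \<Otimes>\<^sub>M PZ)" using compl by (simp add: sets_pair_measure)
  from simple_approximable_add[OF \<nu> simple_approximable_const[of \<nu> PX PZ 1] simple_approximable_cmult[OF \<nu> compl(2), of "-1"]]
  have *: "simple_approximable \<nu> PX PZ (\<lambda>z. 1 - indicator A z)" by (simp add: split_beta')
  have space: "space \<nu> = space PX \<times> space PZ"
    using sets_eq_imp_space_eq[OF \<nu>] by (simp add: space_pair_measure)
  \<comment> \<open>The function \<open>1 - indicator A\<close> and the indicator of the complement
    agree only on the space of \<nu>. The limit rule, applied to a constant sequence, bridges this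
    difference.\<close>
  show ?case
    by (rule simple_approximable_lim[OF \<nu> *, where w="\<lambda>_. 1"])
      (use finite_measure.integrable_const[OF fin] in \<open>simp_all add: indicator_def space\<close>)
next
  case (union A)
  have sum: "simple_approximable \<nu> PX PZ (\<lambda>z. \<Sum>i<n. indicator (A i) z)" for n
  proof (induction n)
    case 0
    show ?case using simple_approximable_const[of \<nu> PX PZ 0] by simp
  next
    case (Suc n)
    show ?case using simple_approximable_add[OF \<nu> Suc union(3)[of n]] by (simp add: add.commute)
  qed
  have eq: "(\<Sum>i<n. indicator (A i) z) = (indicator (\<Union>i<n. A i) z :: real)" for n z
    using union(1) by (subst indicator_UN_disjoint) (auto simp: disjoint_family_on_def)
  show ?case
  proof (rule simple_approximable_lim[OF \<nu> sum, where w="\<lambda>_. 1"])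
    show "(\<lambda>n. \<Sum>i<n. indicator (A i) z) \<longlonglongrightarrow> (indicator (\<Union>i. A i) z :: real)" for z
      unfolding eq by (rule LIMSEQ_indicator_UN)
  qed (use finite_measure.integrable_const[OF fin] in \<open>simp_all only: eq, simp_all add: indicator_def\<close>)
qed

lemma simple_approximable_integrable:
  assumes fin: "finite_measure \<nu>" and \<nu>: "sets \<nu> = sets (PX \<Otimes>\<^sub>M PZ)"
    and \<phi>: "integrable \<nu> \<phi>"
  shows "simple_approximable \<nu> PX PZ \<phi>"
  using \<phi>
proof induction
  case (base A c)
  have "simple_approximable \<nu> PX PZ (indicator A)"
    using base \<nu> by (intro simple_approximable_indicator[OF fin]) auto
  from simple_approximable_cmult[OF \<nu> this, of c] show ?case by (simp add: mult.commute)
next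
  case (add f g)
  show ?case by (rule simple_approximable_add[OF \<nu>]) fact+
next
  case (lim f s)
  show ?case
    by (rule simple_approximable_lim[OF \<nu>, of s _ "\<lambda>z. 2 * \<bar>f z\<bar>"]) (use lim in auto)
qed

text \<open>Quantizes \<open>x\<close> with \<open>(y, s)\<close> kept, then \<open>y\<close> with
  \<open>(f x, s)\<close> kept; each stage costs half of \<epsilon>.\<close>

lemma simple_approximation_pair:
  fixes \<phi> :: "'x \<times> 'y \<times> 's \<Rightarrow> real"
  assumes fin: "finite_measure \<nu>" and \<nu>[measurable_cong]: "sets \<nu> = sets (PX \<Otimes>\<^sub>M (PY \<Otimes>\<^sub>M PS))"
    and \<phi>: "integrable \<nu> \<phi>" and \<epsilon>: "0 < \<epsilon>"
  obtains f :: "'x \<Rightarrow> nat" and g :: "'y \<Rightarrow> nat" and \<psi> where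
    "simple_function PX f" "simple_function PY g"
    "\<psi> \<in> borel_measurable (count_space UNIV \<Otimes>\<^sub>M (count_space UNIV \<Otimes>\<^sub>M PS))"
    "(\<integral>\<^sup>+(x, y, s). ennreal \<bar>\<phi> (x, y, s) - \<psi> (f x, g y, s)\<bar> \<partial>\<nu>) < ennreal \<epsilon>"
proof -
  interpret \<nu>: finite_measure \<nu> by fact
  have [measurable]: "\<phi> \<in> borel_measurable (PX \<Otimes>\<^sub>M (PY \<Otimes>\<^sub>M PS))"
    using borel_measurable_integrable[OF \<phi>] \<nu> by (simp cong: measurable_cong_sets)
  obtain f :: "'x \<Rightarrow> nat" and \<psi> where f: "simple_function PX f"
    and [measurable]: "\<psi> \<in> borel_measurable (count_space UNIV \<Otimes>\<^sub>M (PY \<Otimes>\<^sub>M PS))" "f \<in> measurable PX (count_space UNIV)"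
    and less: "(\<integral>\<^sup>+(x, z). ennreal \<bar>\<phi> (x, z) - \<psi> (f x, z)\<bar> \<partial>\<nu>) < ennreal (\<epsilon>/2)"
    by (rule simple_approximableE[OF simple_approximable_integrable[OF fin \<nu> \<phi>], of "\<epsilon>/2"]) (use \<epsilon> in auto)
  \<comment> \<open>The variable \<open>y\<close> moves to the front and the finite-valued
    \<open>f x\<close> joins the part left alone, so the one-variable result applies again to the
    image measure.\<close>
  let ?T = "\<lambda>(x, y, s). (y, f x, s)" and ?N = "PY \<Otimes>\<^sub>M (count_space UNIV \<Otimes>\<^sub>M PS)"
  have T[measurable]: "?T \<in> measurable \<nu> ?N" by measurable
  let ?\<nu> = "distr \<nu> ?N ?T"
  have fin': "finite_measure ?\<nu>" by (rule \<nu>.finite_measure_distr) fact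
  \<comment> \<open>Written as \<phi> minus its L1 error, the quantized function is seen to be
    integrable, which the second stage requires.\<close>
  have "integrable \<nu> (\<lambda>z. \<phi> z - (\<phi> z - \<psi> (f (fst z), snd z)))"
  proof (rule Bochner_Integration.integrable_diff[OF \<phi>])
    show "integrable \<nu> (\<lambda>z. \<phi> z - \<psi> (f (fst z), snd z))"
      using less by (intro integrableI_bounded) (auto simp: split_beta' intro: order_less_trans)
  qed
  then have int: "integrable ?\<nu> (\<lambda>(y, k, s). \<psi> (k, y, s))"
    by (subst integrable_distr_eq) (auto simp: split_beta')
  obtain g :: "'y \<Rightarrow> nat" and \<psi>' where g: "simple_function PY g"
    and [measurable]: "\<psi>' \<in> borel_measurable (count_space UNIV \<Otimes>\<^sub>M (count_space UNIV \<Otimes>\<^sub>M PS))" "g \<in> measurable PY (count_space UNIV)"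
    and less': "(\<integral>\<^sup>+(y, z). ennreal \<bar>(\<lambda>(y, k, s). \<psi> (k, y, s)) (y, z) - \<psi>' (g y, z)\<bar> \<partial>?\<nu>) < ennreal (\<epsilon>/2)"
    by (rule simple_approximableE[OF simple_approximable_integrable[OF fin' _ int], of PY "count_space UNIV \<Otimes>\<^sub>M PS" "\<epsilon>/2"])
      (use \<epsilon> in auto)
  have "(\<integral>\<^sup>+(x, y, s). ennreal \<bar>\<phi> (x, y, s) - \<psi>' (g y, f x, s)\<bar> \<partial>\<nu>) \<le>
      (\<integral>\<^sup>+(x, y, s). ennreal \<bar>\<phi> (x, y, s) - \<psi> (f x, y, s)\<bar> + ennreal \<bar>\<psi> (f x, y, s) - \<psi>' (g y, f x, s)\<bar> \<partial>\<nu>)"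
    by (intro nn_integral_mono) (auto simp flip: ennreal_plus)
  also have "\<dots> = (\<integral>\<^sup>+(x, y, s). ennreal \<bar>\<phi> (x, y, s) - \<psi> (f x, y, s)\<bar> \<partial>\<nu>) +
      (\<integral>\<^sup>+(x, y, s). ennreal \<bar>\<psi> (f x, y, s) - \<psi>' (g y, f x, s)\<bar> \<partial>\<nu>)"
    by (subst nn_integral_add[symmetric]) (auto simp: split_beta')
  also have "\<dots> < ennreal (\<epsilon>/2) + ennreal (\<epsilon>/2)"
    using less less' by (intro add_strict_mono) (auto simp: split_beta' nn_integral_distr)
  also have "\<dots> = ennreal \<epsilon>" using \<epsilon> by (simp flip: ennreal_plus)
  finally have "(\<integral>\<^sup>+(x, y, s). ennreal \<bar>\<phi> (x, y, s) - (\<lambda>(k, j, s). \<psi>' (j, k, s)) (f x, g y, s)\<bar> \<partial>\<nu>) < ennreal \<epsilon>"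
    by simp
  with f g show ?thesis by (intro that[of f g "\<lambda>(k, j, s). \<psi>' (j, k, s)"]) measurable
qed


section \<open>Mutual information and quantized observations\<close>

text \<open>Makes the integrand of a relative entropy bounded when the density is: the lower bound
  comes from \<open>ln (1 / x) \<le> 1 / x - 1\<close> times \<open>x\<close>, the upper one from
  \<open>ln x \<le> x - 1\<close>. Only finiteness of the bound matters later.\<close>

lemma abs_mult_ln_le:
  fixes x :: real
  assumes "0 \<le> x" "x \<le> C"
  shows "\<bar>x * ln x\<bar> \<le> 1 + C\<^sup>2"
proof (cases "x = 0")
  case False
  then have x: "0 < x" using assms by simp
  have "- ln x \<le> 1 / x - 1" using ln_le_minus_one[of "1 / x"] x by (simp add: ln_div)
  then have "x * (- ln x) \<le> x * (1 / x - 1)" using x by (intro mult_left_mono) auto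
  then have 1: "- (x * ln x) \<le> 1" using x by (simp add: right_diff_distrib)
  have "x * ln x \<le> x * x" using ln_le_minus_one[of x] x by (intro mult_left_mono) auto
  also have "\<dots> \<le> C\<^sup>2" using assms by (simp add: power2_eq_square mult_mono)
  finally have 2: "x * ln x \<le> C\<^sup>2" .
  have "0 \<le> C\<^sup>2" by simp
  then show ?thesis using 1 2 by linarith
qed simp

text \<open>On the set where \<open>D\<close> exceeds \<open>C\<close>, the excess plus
  \<open>C\<close> times the mass is at most \<open>C\<close> times the mass. This mass is finite,
  so it cancels and the excess vanishes.\<close>

lemma AE_density_le:
  fixes D :: "'a \<Rightarrow> real"
  assumes "finite_measure N" and D[measurable]: "D \<in> borel_measurable N" and C: "0 \<le> C"
    and le: "\<And>E. E \<in> sets N \<Longrightarrow> emeasure (density N D) E \<le> ennreal C * emeasure N E"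
  shows "AE z in N. D z \<le> C"
proof -
  interpret finite_measure N by fact
  define A where "A = {z \<in> space N. C < D z}"
  have [measurable]: "A \<in> sets N" unfolding A_def by measurable
  have "(\<integral>\<^sup>+z. ennreal (D z - C) * indicator A z \<partial>N) + ennreal C * emeasure N A =
      (\<integral>\<^sup>+z. ennreal (D z - C) * indicator A z + ennreal C * indicator A z \<partial>N)"
    by (subst nn_integral_add) (auto simp: nn_integral_cmult)
  also have "\<dots> = (\<integral>\<^sup>+z. ennreal (D z) * indicator A z \<partial>N)"
    using C by (intro nn_integral_cong) (auto simp: A_def indicator_def simp flip: ennreal_plus)
  also have "\<dots> = emeasure (density N D) A"
    by (simp add: emeasure_density)
  also have "\<dots> \<le> ennreal C * emeasure N A" using le[of A] by simp
  finally have "ennreal C * emeasure N A + (\<integral>\<^sup>+z. ennreal (D z - C) * indicator A z \<partial>N) \<le> ennreal C * emeasure N A + 0"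
    by (simp add: add.commute)
  moreover have "ennreal C * emeasure N A \<noteq> \<infinity>"
    by (simp add: ennreal_mult_eq_top_iff)
  ultimately have "(\<integral>\<^sup>+z. ennreal (D z - C) * indicator A z \<partial>N) = 0"
    unfolding ennreal_add_left_cancel_le by simp
  then have "AE z in N. ennreal (D z - C) * indicator A z = 0"
    by (subst (asm) nn_integral_0_iff_AE) auto
  then show ?thesis
    using AE_space by eventually_elim (auto simp: A_def indicator_def ennreal_eq_0_iff split: if_splits)
qed

text \<open>A finite-valued \<open>Q\<close> forces the joint law below a constant multiple of the
  product of the marginals, so the density is bounded and its logarithm integrable. Hence the
  library's real-valued mutual information is a genuine relative entropy. It is delivered in two
  forms, as the value attained at \<open>d\<close> and as a bound for all test densities.\<close>

lemma (in prob_space) finite_mutual_information: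
  fixes Q :: "'a \<Rightarrow> nat" and S :: "'a \<Rightarrow> 's"
  assumes Q[measurable]: "Q \<in> measurable M (count_space UNIV)" and fin: "finite (Q ` space M)"
    and S[measurable]: "S \<in> measurable M P"
  defines "N \<equiv> distr M (count_space UNIV) Q \<Otimes>\<^sub>M distr M P S"
  obtains d :: "nat \<times> 's \<Rightarrow> real" where
    "d \<in> borel_measurable (count_space UNIV \<Otimes>\<^sub>M P)" "\<And>z. 0 \<le> d z"
    "(\<integral>\<^sup>+z. ennreal (d z) \<partial>N) \<le> 1" "AE \<omega> in M. 0 < d (Q \<omega>, S \<omega>)"
    "integrable M (\<lambda>\<omega>. log 2 (d (Q \<omega>, S \<omega>)))"
    "mutual_information 2 (count_space UNIV) P Q S = (\<integral>\<omega>. log 2 (d (Q \<omega>, S \<omega>)) \<partial>M)"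
    "rel_entropy_le M N (\<lambda>\<omega>. (Q \<omega>, S \<omega>)) (mutual_information 2 (count_space UNIV) P Q S)"
proof -
  let ?P = "count_space UNIV \<Otimes>\<^sub>M P" and ?DQ = "distr M (count_space UNIV) Q" and ?DS = "distr M P S"
  let ?Z = "\<lambda>\<omega>. (Q \<omega>, S \<omega>)"
  define L where "L = distr M ?P ?Z"
  interpret L: prob_space L unfolding L_def by (rule prob_space_distr) measurable
  interpret DQ: prob_space ?DQ by (rule prob_space_distr) fact
  interpret DS: prob_space ?DS by (rule prob_space_distr) fact
  interpret pair: pair_prob_space ?DQ ?DS ..
  interpret N: prob_space N unfolding N_def by (rule pair.P.prob_space_axioms)
  have setsN[measurable_cong]: "sets N = sets ?P" unfolding N_def by (intro sets_pair_measure_cong) simp_all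
  have setsL[measurable_cong]: "sets L = sets ?P" unfolding L_def by simp
  define K where "K = {k \<in> Q ` space M. prob (Q -` {k} \<inter> space M) > 0}"
  \<comment> \<open>From P(Q = k, S in the section of E at k) at most P(S in that section), and the
    latter times P(Q = k) is the product mass of one slice of \<open>E\<close>. Cells of probability
    0 are left out of \<open>K\<close> and contribute nothing.\<close>
  define C where "C = (\<Sum>k\<in>K. 1 / prob (Q -` {k} \<inter> space M))"
  have finK: "finite K" using fin by (simp add: K_def)
  have C0: "0 \<le> C" unfolding C_def by (intro sum_nonneg) simp
  have le: "emeasure L E \<le> ennreal C * emeasure N E" if E[measurable]: "E \<in> sets ?P" for E
  proof -
    have sec[measurable]: "Pair k -` E \<in> sets P" for k by (rule sets_Pair1) fact
    have cell: "emeasure M {\<omega>\<in>space M. Q \<omega> = k \<and> (k, S \<omega>) \<in> E} \<le>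
      (if k \<in> K then ennreal (1 / prob (Q -` {k} \<inter> space M)) * emeasure N E else 0)"
      if k: "k \<in> Q ` space M" for k
    proof (cases "k \<in> K")
      case True
      let ?p = "prob (Q -` {k} \<inter> space M)"
      have p: "0 < ?p" using True by (simp add: K_def)
      have "ennreal ?p * emeasure ?DS (Pair k -` E) = emeasure ?DQ {k} * emeasure ?DS (Pair k -` E)"
        by (simp add: emeasure_distr emeasure_eq_measure)
      also have "\<dots> = emeasure N ({k} \<times> Pair k -` E)"
        unfolding N_def by (rule DS.emeasure_pair_measure_Times[symmetric]) auto
      also have "\<dots> \<le> emeasure N E" by (rule emeasure_mono) auto
      finally have *: "ennreal ?p * emeasure ?DS (Pair k -` E) \<le> emeasure N E" .
      have "emeasure M {\<omega>\<in>space M. Q \<omega> = k \<and> (k, S \<omega>) \<in> E} \<le> emeasure ?DS (Pair k -` E)"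
        by (subst emeasure_distr) (auto intro!: emeasure_mono)
      also have "\<dots> = ennreal (1 / ?p) * (ennreal ?p * emeasure ?DS (Pair k -` E))"
        using p by (simp add: mult.assoc[symmetric] flip: ennreal_mult')
      also have "\<dots> \<le> ennreal (1 / ?p) * emeasure N E" using * by (rule mult_left_mono) simp
      finally show ?thesis using True by simp
    next
      case False
      then have "prob (Q -` {k} \<inter> space M) = 0"
        using k measure_nonneg[of M "Q -` {k} \<inter> space M"] unfolding K_def by auto
      then have "emeasure M (Q -` {k} \<inter> space M) = 0" by (simp add: emeasure_eq_measure)
      moreover have "emeasure M {\<omega>\<in>space M. Q \<omega> = k \<and> (k, S \<omega>) \<in> E} \<le> emeasure M (Q -` {k} \<inter> space M)"
        by (intro emeasure_mono) auto
      ultimately show ?thesis using False by simp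
    qed
    have m: "{\<omega>\<in>space M. Q \<omega> = k \<and> (k, S \<omega>) \<in> E} \<in> sets M" for k
    proof -
      have "{\<omega>\<in>space M. Q \<omega> = k \<and> (k, S \<omega>) \<in> E} = (Q -` {k} \<inter> space M) \<inter> (S -` (Pair k -` E) \<inter> space M)"
        by auto
      then show ?thesis by simp
    qed
    have "emeasure L E = emeasure M (\<Union>k\<in>Q ` space M. {\<omega>\<in>space M. Q \<omega> = k \<and> (k, S \<omega>) \<in> E})"
      unfolding L_def by (subst emeasure_distr) (auto intro!: arg_cong[where f="emeasure M"])
    also have "\<dots> \<le> (\<Sum>k\<in>Q ` space M. emeasure M {\<omega>\<in>space M. Q \<omega> = k \<and> (k, S \<omega>) \<in> E})"
      by (rule emeasure_subadditive_finite[OF fin]) (use m in auto)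
    also have "\<dots> \<le> (\<Sum>k\<in>Q ` space M. if k \<in> K then ennreal (1 / prob (Q -` {k} \<inter> space M)) * emeasure N E else 0)"
      by (intro sum_mono cell)
    also have "\<dots> = (\<Sum>k\<in>K. ennreal (1 / prob (Q -` {k} \<inter> space M)) * emeasure N E)"
      using fin by (subst sum.If_cases) (auto simp: K_def intro!: sum.cong)
    also have "\<dots> = ennreal C * emeasure N E"
      unfolding C_def by (simp only: sum_distrib_right[symmetric]) (simp add: sum_ennreal)
    finally show ?thesis .
  qed
  have ac: "absolutely_continuous N L"
    unfolding absolutely_continuous_def
  proof
    fix E assume "E \<in> null_sets N"
    then show "E \<in> null_sets L" using le[of E] setsN setsL by (auto simp: null_sets_def)
  qed
  have fm: "finite_measure L" by unfold_locales
  from N.real_RN_deriv[OF fm ac] setsN setsL obtain D where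
    D[measurable]: "D \<in> borel_measurable N" and RN: "AE z in N. RN_deriv N L z = ennreal (D z)"
    and pos: "AE z in L. 0 < D z" and D0: "\<And>z. 0 \<le> D z" by auto
  have [measurable]: "D \<in> borel_measurable ?P" using D setsN by (simp cong: measurable_cong_sets)
  have dens: "L = density N D"
  proof -
    have "L = density N (RN_deriv N L)"
      using ac setsN setsL by (intro N.density_RN_deriv[symmetric]) auto
    also have "\<dots> = density N D" using RN by (intro density_cong) auto
    finally show ?thesis .
  qed
  have "AE z in N. D z \<le> C"
    by (rule AE_density_le) (use le C0 dens setsN in \<open>auto intro: N.finite_measure_axioms\<close>)
  \<comment> \<open>Integrability of \<open>log D\<close> under the joint law is integrability of
    \<open>D * ln D\<close> under the product \<open>N\<close>; there boundedness suffices.\<close>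
  then have "integrable N (\<lambda>z. D z * ln (D z))"
    using abs_mult_ln_le D0 by (intro N.integrable_const_bound[where B="1 + C\<^sup>2"]) auto
  then have intL: "integrable L (\<lambda>z. log 2 (D z))"
    unfolding dens by (subst integrable_real_density) (auto simp: log_def D0)
  have int: "integrable M (\<lambda>\<omega>. log 2 (D (Q \<omega>, S \<omega>)))"
    using intL unfolding L_def by (subst (asm) integrable_distr_eq) auto
  have "mutual_information 2 (count_space UNIV) P Q S = (\<integral>z. log 2 (enn2real (RN_deriv N L z)) \<partial>L)"
    unfolding mutual_information_def KL_divergence_def entropy_density_def L_def N_def by (simp add: comp_def)
  also have "\<dots> = (\<integral>z. log 2 (D z) \<partial>L)"
  proof (rule integral_cong_AE)
    have "AE z in L. RN_deriv N L z = ennreal (D z)"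
      by (rule absolutely_continuous_AE[OF _ ac RN]) (simp add: setsN setsL)
    then show "AE z in L. log 2 (enn2real (RN_deriv N L z)) = log 2 (D z)"
      by eventually_elim (simp add: D0)
    have "(\<lambda>z. log 2 (enn2real (RN_deriv N L z))) \<in> borel_measurable N" by measurable
    then show "(\<lambda>z. log 2 (enn2real (RN_deriv N L z))) \<in> borel_measurable L"
      using setsN setsL by (simp cong: measurable_cong_sets)
  qed measurable
  also have "\<dots> = (\<integral>\<omega>. log 2 (D (Q \<omega>, S \<omega>)) \<partial>M)"
    unfolding L_def by (subst integral_distr) auto
  finally have mi: "mutual_information 2 (count_space UNIV) P Q S = (\<integral>\<omega>. log 2 (D (Q \<omega>, S \<omega>)) \<partial>M)" .
  have posM: "AE \<omega> in M. 0 < D (Q \<omega>, S \<omega>)"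
    using pos unfolding L_def by (subst (asm) AE_distr_iff) auto
  have D1: "(\<integral>\<^sup>+z. ennreal (D z) \<partial>N) \<le> 1"
  proof -
    have "(\<integral>\<^sup>+z. ennreal (D z) \<partial>N) = emeasure (density N D) (space N)"
      by (subst emeasure_density) (auto intro!: nn_integral_cong)
    also have "\<dots> = 1"
      using L.emeasure_space_1 sets_eq_imp_space_eq[OF setsN] sets_eq_imp_space_eq[OF setsL]
      by (simp add: dens[symmetric])
    finally show ?thesis by simp
  qed
  have dist: "distr M N ?Z = density N D"
    unfolding dens[symmetric] L_def by (rule distr_cong) (simp_all add: setsN)
  have "rel_entropy_le M N ?Z (\<integral>\<omega>. log 2 (D (Q \<omega>, S \<omega>)) \<partial>M)"
    by (rule rel_entropy_le_density[OF _ D dist int posM]) (simp add: setsN cong: measurable_cong_sets)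
  then show ?thesis
    using that[of D] D0 D1 posM int mi by simp
qed

section \<open>From quantized to arbitrary test densities\<close>

lemma nn_integral_finite_range:
  fixes f :: "'b \<Rightarrow> nat"
  assumes f[measurable]: "f \<in> measurable N (count_space UNIV)" and F: "finite F" "f ` space N \<subseteq> F"
    and w[measurable]: "w \<in> borel_measurable N"
  shows "(\<integral>\<^sup>+x. w x * h (f x) \<partial>N) = (\<Sum>k\<in>F. (\<integral>\<^sup>+x. w x * indicator {k} (f x) \<partial>N) * h k)"
proof -
  have [measurable]: "(\<lambda>x. indicator {k} (f x) :: ennreal) \<in> borel_measurable N" for k
    by (rule measurable_compose[OF f]) simp
  have "(\<integral>\<^sup>+x. w x * h (f x) \<partial>N) = (\<integral>\<^sup>+x. (\<Sum>k\<in>F. w x * indicator {k} (f x) * h k) \<partial>N)"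
  proof (rule nn_integral_cong)
    fix x assume "x \<in> space N"
    then have "f x \<in> F" using F by auto
    then show "w x * h (f x) = (\<Sum>k\<in>F. w x * indicator {k} (f x) * h k)"
      using F by (subst sum.remove[of F "f x"]) (auto simp: indicator_def intro!: sum.neutral)
  qed
  also have "\<dots> = (\<Sum>k\<in>F. (\<integral>\<^sup>+x. w x * indicator {k} (f x) \<partial>N) * h k)"
    by (subst nn_integral_sum) (auto simp: nn_integral_multc)
  finally show ?thesis .
qed

lemma (in prob_space) integrable_finite_range:
  fixes f :: "'a \<Rightarrow> nat" and h :: "nat \<Rightarrow> real"
  assumes [measurable]: "f \<in> measurable M (count_space UNIV)" and F: "finite F" "f ` space M \<subseteq> F"
  shows "integrable M (\<lambda>x. h (f x))"
proof (rule integrable_const_bound[where B="\<Sum>k\<in>F. \<bar>h k\<bar>"])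
  show "AE x in M. norm (h (f x)) \<le> (\<Sum>k\<in>F. \<bar>h k\<bar>)"
    using F by (intro AE_I2) (auto intro!: member_le_sum)
qed measurable

text \<open>
  The comparison with the quantized variables needs a density that is constant, up to the factor
  \<open>m\<close>, on the cells of \<open>f\<close>.  Enlarging the mass of every cell by \<open>\<delta>\<close> makes it harmless that some
  cells may have mass \<open>0\<close>; the masses cancel between the two mutual informations.
\<close>

lemma (in prob_space) rel_entropy_le_quantized:
  fixes f :: "'x \<Rightarrow> nat" and g :: "'y \<Rightarrow> nat" and \<psi> :: "nat \<times> nat \<times> 's \<Rightarrow> real" and m :: "'x \<Rightarrow> real"
  assumes X[measurable]: "X \<in> measurable M N0" and Y[measurable]: "Y \<in> measurable M MY"
    and S[measurable]: "S \<in> measurable M PS" and N0: "sigma_finite_measure N0"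
    and m[measurable]: "m \<in> borel_measurable N0" and m_pos: "\<And>x. 0 < m x"
    and m1: "(\<integral>\<^sup>+x. ennreal (m x) \<partial>N0) \<le> 1"
    and m_int: "integrable M (\<lambda>\<omega>. log 2 (m (X \<omega>)))"
    and le: "rel_entropy_le M (N0 \<Otimes>\<^sub>M distr M PS S) (\<lambda>\<omega>. (X \<omega>, S \<omega>)) \<alpha>"
    and f: "simple_function N0 f" and g: "simple_function MY g"
    and cmi: "conditional_mutual_information 2 (count_space UNIV) (count_space UNIV) PS
      (\<lambda>\<omega>. f (X \<omega>)) (\<lambda>\<omega>. g (Y \<omega>)) S \<le> \<iota>"
    and \<psi>[measurable]: "\<psi> \<in> borel_measurable (count_space UNIV \<Otimes>\<^sub>M (count_space UNIV \<Otimes>\<^sub>M PS))"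
    and c: "0 < c" and \<psi>_bounds: "\<And>z. c \<le> \<psi> z" "\<And>z. \<psi> z \<le> C"
    and \<eta>: "0 < \<eta>" "(\<integral>\<^sup>+(x, y, s). ennreal (m x * \<psi> (f x, g y, s))
      \<partial>(N0 \<Otimes>\<^sub>M distr M (MY \<Otimes>\<^sub>M PS) (\<lambda>\<omega>. (Y \<omega>, S \<omega>)))) \<le> ennreal \<eta>"
  shows "(\<integral>\<omega>. log 2 (\<psi> (f (X \<omega>), g (Y \<omega>), S \<omega>)) \<partial>M) + (\<integral>\<omega>. log 2 (m (X \<omega>)) \<partial>M) \<le> \<alpha> + \<iota> + log 2 \<eta>"
proof -
  define Q where "Q \<omega> = f (X \<omega>)" for \<omega>
  define G where "G \<omega> = g (Y \<omega>)" for \<omega>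
  define F where "F = f ` space N0"
  have fm[measurable]: "f \<in> measurable N0 (count_space UNIV)" using f by (rule measurable_simple_function)
  have [measurable]: "g \<in> measurable MY (count_space UNIV)" using g by (rule measurable_simple_function)
  have Q[measurable]: "Q \<in> measurable M (count_space UNIV)" unfolding Q_def by measurable
  have G[measurable]: "G \<in> measurable M (count_space UNIV)" unfolding G_def by measurable
  have F: "finite F" "f ` space N0 \<subseteq> F" using f by (auto simp: F_def simple_function_def)
  have QF: "Q ` space M \<subseteq> F" using measurable_space[OF X] by (auto simp: Q_def F_def)
  then have finQ: "finite (Q ` space M)" using F(1) by (rule finite_subset)
  let ?DQ = "distr M (count_space UNIV) Q"
  let ?PGS = "count_space UNIV \<Otimes>\<^sub>M PS" and ?GS = "\<lambda>\<omega>. (G \<omega>, S \<omega>)"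
  let ?DGS = "distr M ?PGS ?GS" and ?DS = "distr M PS S"
  let ?PYS = "MY \<Otimes>\<^sub>M PS" and ?DYS = "distr M (MY \<Otimes>\<^sub>M PS) (\<lambda>\<omega>. (Y \<omega>, S \<omega>))"
  interpret DQ: prob_space ?DQ by (rule prob_space_distr) fact
  interpret DS: prob_space ?DS by (rule prob_space_distr) fact
  interpret DGS: prob_space ?DGS by (rule prob_space_distr) measurable
  interpret DYS: prob_space ?DYS by (rule prob_space_distr) measurable
  interpret A: pair_sigma_finite N0 ?DS
    using N0 by (simp add: pair_sigma_finite_def DS.sigma_finite_measure_axioms)
  interpret B: pair_sigma_finite N0 ?DYS
    using N0 by (simp add: pair_sigma_finite_def DYS.sigma_finite_measure_axioms)
  interpret QS: pair_prob_space ?DQ ?DS ..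
  interpret QGS: pair_prob_space ?DQ ?DGS ..
  \<comment> \<open>The masses of the cell \<open>f = k\<close> under the law of \<open>X\<close>
    (\<open>p\<close>) and under the density \<open>m\<close> (\<open>mu\<close>).\<close>
  define p where "p k = prob (Q -` {k} \<inter> space M)" for k
  define mu where "mu k = enn2real (\<integral>\<^sup>+x. ennreal (m x) * indicator {k} (f x) \<partial>N0)" for k
  have C0: "0 < C" using c order_trans[OF \<psi>_bounds] by (meson less_le_trans)
  have \<psi>_pos: "0 < \<psi> z" for z using c \<psi>_bounds(1)[of z] by simp
  have mu_nonneg: "0 \<le> mu k" for k by (simp add: mu_def)
  have mu: "(\<integral>\<^sup>+x. ennreal (m x) * indicator {k} (f x) \<partial>N0) = ennreal (mu k)" for k
  proof -
    have "(\<integral>\<^sup>+x. ennreal (m x) * indicator {k} (f x) \<partial>N0) \<le> (\<integral>\<^sup>+x. ennreal (m x) \<partial>N0)"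
      by (intro nn_integral_mono) (auto simp: indicator_def)
    also note m1
    finally show ?thesis unfolding mu_def by (intro ennreal_enn2real[symmetric]) (auto simp: order_le_less_trans)
  qed
  have p: "(\<integral>\<^sup>+\<omega>. 1 * indicator {k} (Q \<omega>) \<partial>M) = ennreal (p k)" for k
  proof -
    have "(\<integral>\<^sup>+\<omega>. 1 * indicator {k} (Q \<omega>) \<partial>M) = (\<integral>\<^sup>+\<omega>. indicator (Q -` {k} \<inter> space M) \<omega> \<partial>M)"
      by (intro nn_integral_cong) (auto simp: indicator_def)
    then show ?thesis by (simp add: p_def emeasure_eq_measure)
  qed
  have p_nonneg: "0 \<le> p k" for k by (simp add: p_def)
  have int_DQ: "(\<integral>\<^sup>+k. h k \<partial>?DQ) = (\<Sum>k\<in>F. ennreal (p k) * h k)" for h :: "nat \<Rightarrow> ennreal"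
    using nn_integral_finite_range[OF Q F(1) QF, of "\<lambda>_. 1" h] by (simp add: nn_integral_distr p[simplified])
  have p_pos: "AE \<omega> in M. 0 < p (Q \<omega>)"
  proof -
    have "AE \<omega> in M. \<not> (Q \<omega> = k \<and> p k = 0)" for k
    proof (cases "p k = 0")
      case True
      then have "Q -` {k} \<inter> space M \<in> null_sets M" by (auto simp: p_def null_sets_def emeasure_eq_measure)
      then show ?thesis by (rule AE_I'[where N="Q -` {k} \<inter> space M"]) auto
    qed simp
    then have "AE \<omega> in M. \<forall>k\<in>F. \<not> (Q \<omega> = k \<and> p k = 0)"
      unfolding AE_finite_all[OF F(1)] by blast
    then show ?thesis
      using AE_space by eventually_elim (use QF p_nonneg in \<open>auto simp: less_le\<close>)
  qed
  have int_Q: "integrable M (\<lambda>\<omega>. h (Q \<omega>))" for h :: "nat \<Rightarrow> real"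
    by (rule integrable_finite_range[OF Q F(1) QF])
  \<comment> \<open>The two mutual informations are needed in opposite directions:
    \<open>I(Q; S)\<close> is attained at \<open>d\<close>, whereas \<open>I(Q; (G, S))\<close>
    enters as the upper bound \<open>J1\<close> for test densities.\<close>
  obtain d where [measurable]: "d \<in> borel_measurable (count_space UNIV \<Otimes>\<^sub>M PS)" and d0: "\<And>z. 0 \<le> d z"
    and d1: "(\<integral>\<^sup>+z. ennreal (d z) \<partial>(?DQ \<Otimes>\<^sub>M ?DS)) \<le> 1" and d_pos: "AE \<omega> in M. 0 < d (Q \<omega>, S \<omega>)"
    and d_int: "integrable M (\<lambda>\<omega>. log 2 (d (Q \<omega>, S \<omega>)))"
    and J2: "mutual_information 2 (count_space UNIV) PS Q S = (\<integral>\<omega>. log 2 (d (Q \<omega>, S \<omega>)) \<partial>M)"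
    by (rule finite_mutual_information[OF Q finQ S]) (rule that)
  define J1 where "J1 = mutual_information 2 (count_space UNIV) ?PGS Q ?GS"
  have J1: "rel_entropy_le M (?DQ \<Otimes>\<^sub>M ?DGS) (\<lambda>\<omega>. (Q \<omega>, ?GS \<omega>)) J1"
    unfolding J1_def by (rule finite_mutual_information[OF Q finQ, of ?GS ?PGS]) auto
  have J12: "J1 - (\<integral>\<omega>. log 2 (d (Q \<omega>, S \<omega>)) \<partial>M) \<le> \<iota>"
    using cmi J2 unfolding conditional_mutual_information_def J1_def Q_def G_def by simp
  have \<psi>_int: "integrable M (\<lambda>\<omega>. log 2 (\<psi> (Q \<omega>, G \<omega>, S \<omega>)))"
  proof (rule integrable_const_bound[where B="\<bar>log 2 c\<bar> + \<bar>log 2 C\<bar>"])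
    have "log 2 c \<le> log 2 (\<psi> z) \<and> log 2 (\<psi> z) \<le> log 2 C" for z
      using c C0 \<psi>_pos \<psi>_bounds by simp
    then show "AE \<omega> in M. norm (log 2 (\<psi> (Q \<omega>, G \<omega>, S \<omega>))) \<le> \<bar>log 2 c\<bar> + \<bar>log 2 C\<bar>"
      by (intro AE_I2) (smt (verit) real_norm_def)
  qed measurable
  define E where "E = (\<integral>\<omega>. log 2 (\<psi> (Q \<omega>, G \<omega>, S \<omega>)) \<partial>M) + (\<integral>\<omega>. log 2 (m (X \<omega>)) \<partial>M)"
  have bound: "E \<le> \<alpha> + \<iota> + log 2 (\<eta> + card F * \<delta> * C)" if \<delta>: "0 < \<delta>" for \<delta> :: real
  proof -
    let ?mu = "\<lambda>k. mu k + \<delta>"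
    have mu_pos: "0 < ?mu k" for k using mu_nonneg[of k] \<delta> by simp
    \<comment> \<open>Changes the weight of a cell from \<open>p k\<close> to
      \<open>mu k + \<delta>\<close>: integrating out \<open>k\<close> against the law of
      \<open>Q\<close> turns \<open>\<psi>\<close> into its integral against \<open>m\<close>, up to
      the error \<open>card F * \<delta> * C\<close>.\<close>
    define \<rho> where "\<rho> = (\<lambda>(k, z). if 0 < p k then \<psi> (k, z) * ?mu k / p k else 0)"
    have [measurable]: "\<rho> \<in> borel_measurable (count_space UNIV \<Otimes>\<^sub>M ?PGS)"
      unfolding \<rho>_def by measurable
    have \<rho>0: "0 \<le> \<rho> z" for z
      using less_imp_le[OF \<psi>_pos] less_imp_le[OF mu_pos] by (auto simp: \<rho>_def split: prod.split)
    have inner: "(\<integral>\<^sup>+k. ennreal (\<rho> (k, z)) \<partial>?DQ) \<le> (\<integral>\<^sup>+x. ennreal (m x * \<psi> (f x, z)) \<partial>N0) + ennreal (card F * \<delta> * C)"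
      for z
    proof -
      have "(\<integral>\<^sup>+k. ennreal (\<rho> (k, z)) \<partial>?DQ) = (\<Sum>k\<in>F. ennreal (p k * \<rho> (k, z)))"
        by (simp add: int_DQ ennreal_mult' p_nonneg)
      also have "\<dots> \<le> (\<Sum>k\<in>F. ennreal (mu k * \<psi> (k, z)) + ennreal (\<delta> * C))"
      proof (rule sum_mono)
        fix k
        have "p k * \<rho> (k, z) \<le> ?mu k * \<psi> (k, z)"
          using p_nonneg[of k] \<psi>_pos[of "(k, z)"] mu_pos[of k] by (auto simp: \<rho>_def)
        also have "\<dots> \<le> mu k * \<psi> (k, z) + \<delta> * C"
          using \<psi>_bounds(2) \<delta> by (simp add: distrib_right)
        finally show "ennreal (p k * \<rho> (k, z)) \<le> ennreal (mu k * \<psi> (k, z)) + ennreal (\<delta> * C)"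
          using mu_nonneg[of k] \<psi>_pos[of "(k, z)"] \<delta> C0 by (simp flip: ennreal_plus)
      qed
      also have "\<dots> = (\<Sum>k\<in>F. ennreal (mu k) * ennreal (\<psi> (k, z))) + ennreal (card F * \<delta> * C)"
        using \<delta> C0 by (simp add: sum.distrib ennreal_mult' mu_nonneg ennreal_of_nat_eq_real_of_nat mult.assoc flip: ennreal_mult')
      also have "(\<Sum>k\<in>F. ennreal (mu k) * ennreal (\<psi> (k, z))) = (\<integral>\<^sup>+x. ennreal (m x) * ennreal (\<psi> (f x, z)) \<partial>N0)"
        by (subst nn_integral_finite_range[OF fm F]) (auto simp: mu)
      finally show ?thesis by (simp add: ennreal_mult' less_imp_le[OF m_pos])
    qed
    have "(\<integral>\<^sup>+z. ennreal (\<rho> z) \<partial>(?DQ \<Otimes>\<^sub>M ?DGS)) = (\<integral>\<^sup>+z. \<integral>\<^sup>+k. ennreal (\<rho> (k, z)) \<partial>?DQ \<partial>?DGS)"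
      by (subst QGS.nn_integral_snd) auto
    also have "\<dots> \<le> (\<integral>\<^sup>+z. (\<integral>\<^sup>+x. ennreal (m x * \<psi> (f x, z)) \<partial>N0) + ennreal (card F * \<delta> * C) \<partial>?DGS)"
      by (intro nn_integral_mono inner)
    also have "\<dots> = (\<integral>\<^sup>+z. (\<integral>\<^sup>+x. ennreal (m x * \<psi> (f x, z)) \<partial>N0) \<partial>?DGS) + ennreal (card F * \<delta> * C)"
    proof -
      interpret N0: sigma_finite_measure N0 by fact
      have "(\<lambda>z. \<integral>\<^sup>+x. ennreal (m x * \<psi> (f x, z)) \<partial>N0) \<in> borel_measurable ?PGS"
        by measurable
      then show ?thesis using DGS.emeasure_space_1 by (subst nn_integral_add) auto
    qed
    also have "(\<integral>\<^sup>+z. (\<integral>\<^sup>+x. ennreal (m x * \<psi> (f x, z)) \<partial>N0) \<partial>?DGS) =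
        (\<integral>\<^sup>+z. (\<integral>\<^sup>+x. ennreal (m x * \<psi> (f x, g (fst z), snd z)) \<partial>N0) \<partial>?DYS)"
    proof -
      interpret N0: sigma_finite_measure N0 by fact
      have "(\<lambda>z. \<integral>\<^sup>+x. ennreal (m x * \<psi> (f x, z)) \<partial>N0) \<in> borel_measurable ?PGS"
        "(\<lambda>z. \<integral>\<^sup>+x. ennreal (m x * \<psi> (f x, g (fst z), snd z)) \<partial>N0) \<in> borel_measurable ?PYS"
        by measurable
      then show ?thesis by (simp add: nn_integral_distr G_def)
    qed
    also have "\<dots> = (\<integral>\<^sup>+(x, y, s). ennreal (m x * \<psi> (f x, g y, s)) \<partial>(N0 \<Otimes>\<^sub>M ?DYS))"
      by (subst B.nn_integral_snd[symmetric]) (auto simp: split_beta')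
    also have "\<dots> + ennreal (card F * \<delta> * C) \<le> ennreal (\<eta> + card F * \<delta> * C)"
      using \<eta> \<delta> C0 by (simp add: ennreal_plus)
    finally have \<rho>1: "(\<integral>\<^sup>+z. ennreal (\<rho> z) \<partial>(?DQ \<Otimes>\<^sub>M ?DGS)) \<le> ennreal (\<eta> + card F * \<delta> * C)"
      by simp
    have log_\<rho>: "AE \<omega> in M. log 2 (\<rho> (Q \<omega>, ?GS \<omega>)) =
        log 2 (\<psi> (Q \<omega>, G \<omega>, S \<omega>)) + (log 2 (?mu (Q \<omega>)) - log 2 (p (Q \<omega>)))"
      using p_pos by eventually_elim (use \<psi>_pos mu_pos in \<open>simp add: \<rho>_def log_mult log_divide less_imp_neq[symmetric]\<close>)
    have int_sum: "integrable M (\<lambda>\<omega>. log 2 (\<psi> (Q \<omega>, G \<omega>, S \<omega>)) + (log 2 (?mu (Q \<omega>)) - log 2 (p (Q \<omega>))))"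
      using \<psi>_int int_Q by (intro Bochner_Integration.integrable_add) auto
    have int_\<rho>: "integrable M (\<lambda>\<omega>. log 2 (\<rho> (Q \<omega>, ?GS \<omega>)))"
      by (rule integrable_cong_AE_imp[OF int_sum]) (use log_\<rho> in \<open>auto elim: eventually_mono\<close>)
    have "(\<integral>\<omega>. log 2 (\<rho> (Q \<omega>, ?GS \<omega>)) \<partial>M) \<le> J1 + log 2 (\<eta> + card F * \<delta> * C)"
    proof (rule rel_entropy_leD_scaled[OF J1 _ _ \<rho>0 _ \<rho>1 _ int_\<rho>])
      show "0 < \<eta> + real (card F) * \<delta> * C" using \<eta> \<delta> C0 by (intro add_pos_nonneg) auto
      show "AE \<omega> in M. 0 < \<rho> (Q \<omega>, ?GS \<omega>)"
        using p_pos by eventually_elim (use \<psi>_pos mu_pos in \<open>simp add: \<rho>_def\<close>)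
    qed auto
    also have "(\<integral>\<omega>. log 2 (\<rho> (Q \<omega>, ?GS \<omega>)) \<partial>M) =
        (\<integral>\<omega>. log 2 (\<psi> (Q \<omega>, G \<omega>, S \<omega>)) + (log 2 (?mu (Q \<omega>)) - log 2 (p (Q \<omega>))) \<partial>M)"
      by (rule integral_cong_AE[OF _ _ log_\<rho>]) measurable
    also have "\<dots> = (\<integral>\<omega>. log 2 (\<psi> (Q \<omega>, G \<omega>, S \<omega>)) \<partial>M) +
        ((\<integral>\<omega>. log 2 (?mu (Q \<omega>)) \<partial>M) - (\<integral>\<omega>. log 2 (p (Q \<omega>)) \<partial>M))"
      using \<psi>_int int_Q[of "\<lambda>k. log 2 (?mu k)"] int_Q[of "\<lambda>k. log 2 (p k)"] by simp
    finally have 1: "(\<integral>\<omega>. log 2 (\<psi> (Q \<omega>, G \<omega>, S \<omega>)) \<partial>M) +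
        ((\<integral>\<omega>. log 2 (?mu (Q \<omega>)) \<partial>M) - (\<integral>\<omega>. log 2 (p (Q \<omega>)) \<partial>M)) \<le> J1 + log 2 (\<eta> + card F * \<delta> * C)" .
    \<comment> \<open>Lifts \<open>d\<close> from cells back to points: within a cell the mass is
      spread according to \<open>m\<close>, and the total does not grow because
      \<open>mu k / (mu k + \<delta>) \<le> 1\<close>. This is the test density for the hypothesis
      on \<open>(X, S)\<close>.\<close>
    define r where "r = (\<lambda>(x, s). m x * (d (f x, s) * (p (f x) / ?mu (f x))))"
    have [measurable]: "r \<in> borel_measurable (N0 \<Otimes>\<^sub>M PS)"
      unfolding r_def by measurable
    have r0: "0 \<le> r z" for z
      using d0 p_nonneg less_imp_le[OF m_pos] less_imp_le[OF mu_pos] by (auto simp: r_def split: prod.split)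
    have inner': "(\<integral>\<^sup>+x. ennreal (r (x, s)) \<partial>N0) \<le> (\<integral>\<^sup>+k. ennreal (d (k, s)) \<partial>?DQ)" for s
    proof -
      have "(\<integral>\<^sup>+x. ennreal (r (x, s)) \<partial>N0) =
          (\<integral>\<^sup>+x. ennreal (m x) * ennreal (d (f x, s) * (p (f x) / ?mu (f x))) \<partial>N0)"
        unfolding r_def by (simp only: prod.case ennreal_mult'[OF less_imp_le[OF m_pos]])
      also have "\<dots> = (\<Sum>k\<in>F. ennreal (mu k) * ennreal (d (k, s) * (p k / ?mu k)))"
        by (subst nn_integral_finite_range[OF fm F, where h="\<lambda>k. ennreal (d (k, s) * (p k / ?mu k))"]) (auto simp: mu)
      also have "\<dots> \<le> (\<Sum>k\<in>F. ennreal (p k) * ennreal (d (k, s)))"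
      proof (rule sum_mono)
        fix k
        have "mu k * (d (k, s) * (p k / ?mu k)) = (mu k / ?mu k) * (p k * d (k, s))" by simp
        also have "\<dots> \<le> 1 * (p k * d (k, s))"
          using mu_pos[of k] \<delta> p_nonneg d0 by (intro mult_right_mono) auto
        finally show "ennreal (mu k) * ennreal (d (k, s) * (p k / ?mu k)) \<le> ennreal (p k) * ennreal (d (k, s))"
          using mu_nonneg p_nonneg by (simp add: ennreal_leI flip: ennreal_mult')
      qed
      also have "\<dots> = (\<integral>\<^sup>+k. ennreal (d (k, s)) \<partial>?DQ)" by (simp add: int_DQ)
      finally show ?thesis .
    qed
    have "(\<integral>\<^sup>+z. ennreal (r z) \<partial>(N0 \<Otimes>\<^sub>M ?DS)) = (\<integral>\<^sup>+s. \<integral>\<^sup>+x. ennreal (r (x, s)) \<partial>N0 \<partial>?DS)"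
      by (subst A.nn_integral_snd) auto
    also have "\<dots> \<le> (\<integral>\<^sup>+s. \<integral>\<^sup>+k. ennreal (d (k, s)) \<partial>?DQ \<partial>?DS)"
      by (intro nn_integral_mono inner')
    also have "\<dots> \<le> 1"
      using d1 by (subst QS.nn_integral_snd) auto
    finally have r1: "(\<integral>\<^sup>+z. ennreal (r z) \<partial>(N0 \<Otimes>\<^sub>M ?DS)) \<le> 1" .
    have log_r: "AE \<omega> in M. log 2 (r (X \<omega>, S \<omega>)) =
        log 2 (m (X \<omega>)) + (log 2 (d (Q \<omega>, S \<omega>)) + (log 2 (p (Q \<omega>)) - log 2 (?mu (Q \<omega>))))"
      using p_pos d_pos by eventually_elim
        (use m_pos mu_pos in \<open>simp add: r_def Q_def log_mult log_divide less_imp_neq[symmetric]\<close>)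
    have int_sum': "integrable M (\<lambda>\<omega>. log 2 (m (X \<omega>)) + (log 2 (d (Q \<omega>, S \<omega>)) + (log 2 (p (Q \<omega>)) - log 2 (?mu (Q \<omega>)))))"
      using m_int d_int int_Q by (intro Bochner_Integration.integrable_add) auto
    have int_r: "integrable M (\<lambda>\<omega>. log 2 (r (X \<omega>, S \<omega>)))"
      by (rule integrable_cong_AE_imp[OF int_sum']) (use log_r in \<open>auto elim: eventually_mono\<close>)
    have "(\<integral>\<omega>. log 2 (r (X \<omega>, S \<omega>)) \<partial>M) \<le> \<alpha>"
    proof (rule rel_entropy_leD[OF le _ r0 r1 _ int_r])
      show "AE \<omega> in M. 0 < r (X \<omega>, S \<omega>)"
        using p_pos d_pos by eventually_elim (use m_pos mu_pos in \<open>simp add: r_def Q_def\<close>)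
    qed simp
    also have "(\<integral>\<omega>. log 2 (r (X \<omega>, S \<omega>)) \<partial>M) =
        (\<integral>\<omega>. log 2 (m (X \<omega>)) + (log 2 (d (Q \<omega>, S \<omega>)) + (log 2 (p (Q \<omega>)) - log 2 (?mu (Q \<omega>)))) \<partial>M)"
      by (rule integral_cong_AE[OF _ _ log_r]) measurable
    also have "\<dots> = (\<integral>\<omega>. log 2 (m (X \<omega>)) \<partial>M) + ((\<integral>\<omega>. log 2 (d (Q \<omega>, S \<omega>)) \<partial>M) +
        ((\<integral>\<omega>. log 2 (p (Q \<omega>)) \<partial>M) - (\<integral>\<omega>. log 2 (?mu (Q \<omega>)) \<partial>M)))"
      using m_int d_int int_Q[of "\<lambda>k. log 2 (?mu k)"] int_Q[of "\<lambda>k. log 2 (p k)"] by simp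
    \<comment> \<open>In the sum of the two bounds the expected logarithms of the cell weights
      cancel, and \<open>J1\<close> minus the value attained at \<open>d\<close> is at most
      \<iota>.\<close>
    finally show ?thesis using 1 J12 unfolding E_def by linarith
  qed
  have "((\<lambda>\<delta>::real. \<eta> + card F * \<delta> * C) \<longlongrightarrow> \<eta> + real (card F) * 0 * C) (at_right 0)"
    by (intro tendsto_intros)
  from tendsto_add[OF tendsto_const tendsto_log[OF tendsto_const this, of 2]]
  have "((\<lambda>\<delta>::real. \<alpha> + \<iota> + log 2 (\<eta> + card F * \<delta> * C)) \<longlongrightarrow> \<alpha> + \<iota> + log 2 (\<eta> + real (card F) * 0 * C)) (at_right 0)"
    using \<eta> by simp
  then have "E \<le> \<alpha> + \<iota> + log 2 (\<eta> + real (card F) * 0 * C)"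
    by (rule tendsto_lowerbound) (auto intro: bound eventually_mono[OF eventually_at_right_less])
  then show ?thesis by (simp add: E_def Q_def G_def)
qed

text \<open>Here \<phi> is a density relative to \<open>m\<close>. It is replaced by a quantized
  \<psi> that is close in L1 for two measures at once: the law of \<open>(X, Y, S)\<close>, which
  controls the expected logarithm, and \<open>m\<close> times the product measure, which controls
  the mass. The bounds \<open>c\<close> and \<open>C\<close> make the logarithm Lipschitz.\<close>

lemma (in prob_space) rel_entropy_le_bounded_density:
  fixes \<phi> :: "'x \<times> 'y \<times> 's \<Rightarrow> real" and m :: "'x \<Rightarrow> real"
  assumes X[measurable]: "X \<in> measurable M N0" and Y[measurable]: "Y \<in> measurable M MY"
    and S[measurable]: "S \<in> measurable M PS" and N0: "sigma_finite_measure N0"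
    and m[measurable]: "m \<in> borel_measurable N0" and m_pos: "\<And>x. 0 < m x"
    and m1: "(\<integral>\<^sup>+x. ennreal (m x) \<partial>N0) \<le> 1"
    and m_int: "integrable M (\<lambda>\<omega>. log 2 (m (X \<omega>)))"
    and le: "rel_entropy_le M (N0 \<Otimes>\<^sub>M distr M PS S) (\<lambda>\<omega>. (X \<omega>, S \<omega>)) \<alpha>"
    and cmi: "\<And>(f :: 'x \<Rightarrow> nat) (g :: 'y \<Rightarrow> nat). simple_function N0 f \<Longrightarrow> simple_function MY g \<Longrightarrow>
      conditional_mutual_information 2 (count_space UNIV) (count_space UNIV) PS
        (\<lambda>\<omega>. f (X \<omega>)) (\<lambda>\<omega>. g (Y \<omega>)) S \<le> \<iota>"
    and \<phi>[measurable]: "\<phi> \<in> borel_measurable (N0 \<Otimes>\<^sub>M (MY \<Otimes>\<^sub>M PS))"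
    and c: "0 < c" and \<phi>_bounds: "\<And>z. c \<le> \<phi> z" "\<And>z. \<phi> z \<le> C"
    and \<eta>: "0 < \<eta>" "(\<integral>\<^sup>+z. ennreal (m (fst z) * \<phi> z)
      \<partial>(N0 \<Otimes>\<^sub>M distr M (MY \<Otimes>\<^sub>M PS) (\<lambda>\<omega>. (Y \<omega>, S \<omega>)))) \<le> ennreal \<eta>"
  shows "(\<integral>\<omega>. log 2 (\<phi> (X \<omega>, Y \<omega>, S \<omega>)) \<partial>M) + (\<integral>\<omega>. log 2 (m (X \<omega>)) \<partial>M) \<le> \<alpha> + \<iota> + log 2 \<eta>"
proof -
  let ?PYS = "MY \<Otimes>\<^sub>M PS" and ?DYS = "distr M (MY \<Otimes>\<^sub>M PS) (\<lambda>\<omega>. (Y \<omega>, S \<omega>))"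
  let ?P = "N0 \<Otimes>\<^sub>M (MY \<Otimes>\<^sub>M PS)"
  interpret DYS: prob_space ?DYS by (rule prob_space_distr) measurable
  interpret B: pair_sigma_finite N0 ?DYS
    using N0 by (simp add: pair_sigma_finite_def DYS.sigma_finite_measure_axioms)
  have setsB[measurable_cong]: "sets (N0 \<Otimes>\<^sub>M ?DYS) = sets ?P"
    by (intro sets_pair_measure_cong) simp_all
  have ne: "space ?P \<noteq> {}"
  proof -
    obtain \<omega> where "\<omega> \<in> space M" using not_empty by auto
    then have "(X \<omega>, Y \<omega>, S \<omega>) \<in> space ?P"
      using measurable_space[OF X] measurable_space[OF Y] measurable_space[OF S] by (auto simp: space_pair_measure)
    then show ?thesis by auto
  qed
  define \<nu>1 where "\<nu>1 = distr M ?P (\<lambda>\<omega>. (X \<omega>, Y \<omega>, S \<omega>))"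
  define \<nu>2 where "\<nu>2 = density (N0 \<Otimes>\<^sub>M ?DYS) (\<lambda>z. ennreal (m (fst z)))"
  have \<nu>1: "\<nu>1 \<in> space (subprob_algebra ?P)"
  proof -
    have "prob_space \<nu>1" unfolding \<nu>1_def by (rule prob_space_distr) measurable
    then have "subprob_space \<nu>1" by (rule prob_space_imp_subprob_space)
    moreover have "sets \<nu>1 = sets ?P" by (simp add: \<nu>1_def)
    ultimately show ?thesis by (simp add: space_subprob_algebra)
  qed
  have \<nu>2: "\<nu>2 \<in> space (subprob_algebra ?P)"
  proof -
    have sp: "space \<nu>2 = space ?P" using sets_eq_imp_space_eq[OF setsB] by (simp add: \<nu>2_def)
    have "emeasure \<nu>2 (space \<nu>2) = (\<integral>\<^sup>+z. ennreal (m (fst z)) \<partial>(N0 \<Otimes>\<^sub>M ?DYS))"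
      unfolding \<nu>2_def by (subst emeasure_density)
        (auto simp: sets_eq_imp_space_eq[OF setsB] intro!: nn_integral_cong)
    also have "\<dots> = (\<integral>\<^sup>+z. \<integral>\<^sup>+x. ennreal (m x) \<partial>N0 \<partial>?DYS)"
      by (subst B.nn_integral_snd[symmetric]) auto
    also have "\<dots> = (\<integral>\<^sup>+x. ennreal (m x) \<partial>N0)" using DYS.emeasure_space_1 by simp
    also note m1
    finally have "subprob_space \<nu>2"
      by (intro subprob_spaceI) (use ne sp in auto)
    then show ?thesis using setsB by (auto simp: space_subprob_algebra \<nu>2_def)
  qed
  \<comment> \<open>A fair coin chooses between the two measures. Their average is finite, and an
    error below \<epsilon> for it is an error of at most 2 \<epsilon> for each of them.\<close>
  define K where "K b = (if b then \<nu>1 else \<nu>2)" for b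
  have K: "K \<in> measurable (measure_pmf (bernoulli_pmf (1/2))) (subprob_algebra ?P)"
    using \<nu>1 \<nu>2 by (auto simp: K_def)
  define \<nu> where "\<nu> = measure_pmf (bernoulli_pmf (1/2)) \<bind> K"
  have sets_\<nu>: "sets \<nu> = sets ?P"
    unfolding \<nu>_def by (rule sets_bind) (use \<nu>1 \<nu>2 in \<open>auto simp: K_def space_subprob_algebra\<close>)
  have fin: "finite_measure \<nu>"
    unfolding \<nu>_def by (intro subprob_space.axioms(1) subprob_space_bind[OF _ K] prob_space_imp_subprob_space measure_pmf.prob_space_axioms)
  have int_\<nu>: "(\<integral>\<^sup>+z. h z \<partial>\<nu>) = (\<integral>\<^sup>+z. h z \<partial>\<nu>1) * ennreal (1/2) + (\<integral>\<^sup>+z. h z \<partial>\<nu>2) * ennreal (1/2)"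
    if "h \<in> borel_measurable ?P" for h
    unfolding \<nu>_def by (subst nn_integral_bind[OF that K]) (simp add: K_def)
  have half: "a \<le> ennreal (2 * \<epsilon>)" "b \<le> ennreal (2 * \<epsilon>)"
    if "a * ennreal (1/2) + b * ennreal (1/2) < ennreal \<epsilon>" "0 < \<epsilon>" for a b :: ennreal and \<epsilon> :: real
  proof -
    have *: "x \<le> ennreal (2 * \<epsilon>)" if "x * ennreal (1/2) < ennreal \<epsilon>" for x :: ennreal
    proof -
      have h: "ennreal (1/2) * ennreal 2 = 1"
        by (subst ennreal_mult[symmetric]) auto
      have "x = x * (ennreal (1/2) * ennreal 2)" unfolding h by simp
      also have "\<dots> = x * ennreal (1/2) * ennreal 2" by (simp only: mult.assoc)
      also have "\<dots> \<le> ennreal \<epsilon> * ennreal 2" using that by (intro mult_right_mono) auto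
      also have "\<dots> = ennreal (2 * \<epsilon>)" using \<open>0 < \<epsilon>\<close> by (subst ennreal_mult[symmetric]) (auto simp: mult.commute)
      finally show ?thesis .
    qed
    show "a \<le> ennreal (2 * \<epsilon>)" "b \<le> ennreal (2 * \<epsilon>)"
      using that(1) by (auto intro!: * intro: order_le_less_trans[rotated])
  qed
  have C0: "0 < C" using c order_trans[OF \<phi>_bounds] by (meson less_le_trans)
  have \<phi>_pos: "0 < \<phi> z" for z using c \<phi>_bounds(1)[of z] by simp
  have \<phi>_int: "integrable \<nu> \<phi>"
  proof (rule finite_measure.integrable_const_bound[OF fin, where B=C])
    show "\<phi> \<in> borel_measurable \<nu>" using \<phi> sets_\<nu> by (simp cong: measurable_cong_sets)
    show "AE z in \<nu>. norm (\<phi> z) \<le> C" using \<phi>_pos \<phi>_bounds by (auto simp: abs_of_pos)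
  qed
  have log_int: "integrable M (\<lambda>\<omega>. log 2 (h \<omega>))"
    if [measurable]: "h \<in> borel_measurable M" and "\<And>\<omega>. c \<le> h \<omega>" "\<And>\<omega>. h \<omega> \<le> C" for h
  proof (rule integrable_const_bound[where B="\<bar>log 2 c\<bar> + \<bar>log 2 C\<bar>"])
    have "log 2 c \<le> log 2 (h \<omega>) \<and> log 2 (h \<omega>) \<le> log 2 C" for \<omega>
      using c C0 that(2,3)[of \<omega>] by simp
    then show "AE \<omega> in M. norm (log 2 (h \<omega>)) \<le> \<bar>log 2 c\<bar> + \<bar>log 2 C\<bar>"
      by (intro AE_I2) (smt (verit) real_norm_def)
  qed measurable
  define E where "E = (\<integral>\<omega>. log 2 (\<phi> (X \<omega>, Y \<omega>, S \<omega>)) \<partial>M) + (\<integral>\<omega>. log 2 (m (X \<omega>)) \<partial>M)"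
  have bound: "E \<le> \<alpha> + \<iota> + (log 2 (\<eta> + 2 * \<epsilon>) + 2 * \<epsilon> / (c * ln 2))" if \<epsilon>: "0 < \<epsilon>" for \<epsilon>
  proof -
    obtain f :: "'x \<Rightarrow> nat" and g :: "'y \<Rightarrow> nat" and \<psi>' where
      f: "simple_function N0 f" and g: "simple_function MY g" and
      \<psi>'[measurable]: "\<psi>' \<in> borel_measurable (count_space UNIV \<Otimes>\<^sub>M (count_space UNIV \<Otimes>\<^sub>M PS))" and
      less: "(\<integral>\<^sup>+(x, y, s). ennreal \<bar>\<phi> (x, y, s) - \<psi>' (f x, g y, s)\<bar> \<partial>\<nu>) < ennreal \<epsilon>"
      by (rule simple_approximation_pair[OF fin sets_\<nu> \<phi>_int \<epsilon>])
    have [measurable]: "f \<in> measurable N0 (count_space UNIV)" "g \<in> measurable MY (count_space UNIV)"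
      using f g by (auto intro: measurable_simple_function)
    \<comment> \<open>Clipping to \<open>[c, C]\<close> cannot increase the distance to \<phi>,
      whose values already lie there.\<close>
    define \<psi> where "\<psi> z = max c (min C (\<psi>' z))" for z
    have [measurable]: "\<psi> \<in> borel_measurable (count_space UNIV \<Otimes>\<^sub>M (count_space UNIV \<Otimes>\<^sub>M PS))"
      unfolding \<psi>_def by measurable
    have cC: "c \<le> C" by (rule order_trans[OF \<phi>_bounds])
    have \<psi>_bounds: "c \<le> \<psi> z" "\<psi> z \<le> C" for z using cC by (auto simp: \<psi>_def)
    have \<psi>_pos: "0 < \<psi> z" for z using c \<psi>_bounds(1)[of z] by simp
    define T where "T = (\<lambda>(x, y, s). (f x, g y, s :: 's))"
    have [measurable]: "T \<in> measurable ?P (count_space UNIV \<Otimes>\<^sub>M (count_space UNIV \<Otimes>\<^sub>M PS))"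
      unfolding T_def by measurable
    have "(\<integral>\<^sup>+z. ennreal \<bar>\<phi> z - \<psi> (T z)\<bar> \<partial>\<nu>) \<le> (\<integral>\<^sup>+(x, y, s). ennreal \<bar>\<phi> (x, y, s) - \<psi>' (f x, g y, s)\<bar> \<partial>\<nu>)"
    proof (intro nn_integral_mono)
      fix z
      show "ennreal \<bar>\<phi> z - \<psi> (T z)\<bar> \<le> (case z of (x, y, s) \<Rightarrow> ennreal \<bar>\<phi> (x, y, s) - \<psi>' (f x, g y, s)\<bar>)"
        using \<phi>_bounds[of z] cC by (cases z) (auto simp: T_def \<psi>_def max_def min_def intro!: ennreal_leI)
    qed
    also note less
    finally have "(\<integral>\<^sup>+z. ennreal \<bar>\<phi> z - \<psi> (T z)\<bar> \<partial>\<nu>) < ennreal \<epsilon>" .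
    then have err: "(\<integral>\<^sup>+z. ennreal \<bar>\<phi> z - \<psi> (T z)\<bar> \<partial>\<nu>1) \<le> ennreal (2 * \<epsilon>)"
      "(\<integral>\<^sup>+z. ennreal \<bar>\<phi> z - \<psi> (T z)\<bar> \<partial>\<nu>2) \<le> ennreal (2 * \<epsilon>)"
      using half[OF _ \<epsilon>] by (simp_all add: int_\<nu>)
    have "(\<integral>\<^sup>+(x, y, s). ennreal (m x * \<psi> (f x, g y, s)) \<partial>(N0 \<Otimes>\<^sub>M ?DYS)) =
        (\<integral>\<^sup>+z. ennreal (m (fst z)) * ennreal (\<psi> (T z)) \<partial>(N0 \<Otimes>\<^sub>M ?DYS))"
      by (intro nn_integral_cong) (auto simp: T_def ennreal_mult' less_imp_le[OF m_pos])
    also have "\<dots> = (\<integral>\<^sup>+z. ennreal (\<psi> (T z)) \<partial>\<nu>2)"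
      unfolding \<nu>2_def by (subst nn_integral_density) auto
    also have "\<dots> \<le> (\<integral>\<^sup>+z. ennreal (\<phi> z) + ennreal \<bar>\<phi> z - \<psi> (T z)\<bar> \<partial>\<nu>2)"
      by (intro nn_integral_mono) (use less_imp_le[OF \<phi>_pos] in \<open>auto simp flip: ennreal_plus intro!: ennreal_leI\<close>)
    also have "\<dots> = (\<integral>\<^sup>+z. ennreal (\<phi> z) \<partial>\<nu>2) + (\<integral>\<^sup>+z. ennreal \<bar>\<phi> z - \<psi> (T z)\<bar> \<partial>\<nu>2)"
      by (rule nn_integral_add) (auto simp: \<nu>2_def)
    also have "(\<integral>\<^sup>+z. ennreal (\<phi> z) \<partial>\<nu>2) = (\<integral>\<^sup>+z. ennreal (m (fst z) * \<phi> z) \<partial>(N0 \<Otimes>\<^sub>M ?DYS))"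
      unfolding \<nu>2_def by (subst nn_integral_density) (auto simp: ennreal_mult' less_imp_le[OF m_pos])
    also have "\<dots> + (\<integral>\<^sup>+z. ennreal \<bar>\<phi> z - \<psi> (T z)\<bar> \<partial>\<nu>2) \<le> ennreal \<eta> + ennreal (2 * \<epsilon>)"
      by (intro add_mono \<eta> err)
    also have "\<dots> = ennreal (\<eta> + 2 * \<epsilon>)" using \<eta> \<epsilon> by (simp add: ennreal_plus)
    finally have mass: "(\<integral>\<^sup>+(x, y, s). ennreal (m x * \<psi> (f x, g y, s)) \<partial>(N0 \<Otimes>\<^sub>M ?DYS)) \<le> ennreal (\<eta> + 2 * \<epsilon>)" .
    have 1: "(\<integral>\<omega>. log 2 (\<psi> (f (X \<omega>), g (Y \<omega>), S \<omega>)) \<partial>M) + (\<integral>\<omega>. log 2 (m (X \<omega>)) \<partial>M) \<le> \<alpha> + \<iota> + log 2 (\<eta> + 2 * \<epsilon>)"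
      by (rule rel_entropy_le_quantized[OF X Y S N0 m m_pos m1 m_int le f g cmi[OF f g] _ c \<psi>_bounds _ mass])
        (use \<eta> \<epsilon> in auto)
    let ?e = "\<lambda>\<omega>. \<bar>\<phi> (X \<omega>, Y \<omega>, S \<omega>) - \<psi> (f (X \<omega>), g (Y \<omega>), S \<omega>)\<bar>"
    have errM: "(\<integral>\<^sup>+\<omega>. ennreal (?e \<omega>) \<partial>M) \<le> ennreal (2 * \<epsilon>)"
      using err(1) unfolding \<nu>1_def by (subst (asm) nn_integral_distr) (auto simp: T_def)
    have e_int: "integrable M ?e"
      using errM by (intro integrableI_bounded) (auto intro: order_le_less_trans)
    have e_le: "(\<integral>\<omega>. ?e \<omega> \<partial>M) \<le> 2 * \<epsilon>"
      using errM \<epsilon> by (subst (asm) nn_integral_eq_integral[OF e_int]) auto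
    have int\<phi>: "integrable M (\<lambda>\<omega>. log 2 (\<phi> (X \<omega>, Y \<omega>, S \<omega>)))"
      by (rule log_int) (use \<phi>_bounds in auto)
    have int\<psi>: "integrable M (\<lambda>\<omega>. log 2 (\<psi> (f (X \<omega>), g (Y \<omega>), S \<omega>)))"
      by (rule log_int) (use \<psi>_bounds in auto)
    have "(\<integral>\<omega>. log 2 (\<phi> (X \<omega>, Y \<omega>, S \<omega>)) \<partial>M) - (\<integral>\<omega>. log 2 (\<psi> (f (X \<omega>), g (Y \<omega>), S \<omega>)) \<partial>M) =
        (\<integral>\<omega>. log 2 (\<phi> (X \<omega>, Y \<omega>, S \<omega>)) - log 2 (\<psi> (f (X \<omega>), g (Y \<omega>), S \<omega>)) \<partial>M)"
      using int\<phi> int\<psi> by simp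
    also have "\<dots> \<le> (\<integral>\<omega>. ?e \<omega> / (c * ln 2) \<partial>M)"
    proof (rule integral_mono)
      fix \<omega>
      let ?a = "\<phi> (X \<omega>, Y \<omega>, S \<omega>)" and ?b = "\<psi> (f (X \<omega>), g (Y \<omega>), S \<omega>)"
      \<comment> \<open>The slope of the logarithm on \<open>[c, C]\<close> is at most
        \<open>1 / c\<close>; with base 2 this produces the error
        \<open>2 * \<epsilon> / (c * ln 2)\<close>.\<close>
      have "ln ?a - ln ?b \<le> (?a - ?b) / ?b"
        using ln_diff_le[of ?a ?b] \<phi>_pos \<psi>_pos by simp
      also have "\<dots> \<le> ?e \<omega> / ?b" using \<psi>_pos by (intro divide_right_mono) (auto intro: less_imp_le)
      also have "\<dots> \<le> ?e \<omega> / c" using \<psi>_bounds(1) c by (intro divide_left_mono) (auto intro!: mult_pos_pos \<psi>_pos)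
      finally show "log 2 ?a - log 2 ?b \<le> ?e \<omega> / (c * ln 2)"
        by (simp add: log_def diff_divide_distrib[symmetric] divide_right_mono flip: divide_divide_eq_left)
    qed (use int\<phi> int\<psi> e_int in auto)
    also have "\<dots> = (\<integral>\<omega>. ?e \<omega> \<partial>M) / (c * ln 2)" by simp
    also have "\<dots> \<le> 2 * \<epsilon> / (c * ln 2)" using e_le c by (intro divide_right_mono) auto
    finally show ?thesis using 1 unfolding E_def by linarith
  qed
  have t: "((\<lambda>\<epsilon>::real. \<eta> + 2 * \<epsilon>) \<longlongrightarrow> \<eta> + 2 * 0) (at_right 0)"
    "((\<lambda>\<epsilon>::real. 2 * \<epsilon> / (c * ln 2)) \<longlongrightarrow> 2 * 0 / (c * ln 2)) (at_right 0)"
    using c by (intro tendsto_intros; simp)+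
  have "((\<lambda>\<epsilon>::real. \<alpha> + \<iota> + (log 2 (\<eta> + 2 * \<epsilon>) + 2 * \<epsilon> / (c * ln 2))) \<longlongrightarrow>
      \<alpha> + \<iota> + (log 2 (\<eta> + 2 * 0) + 2 * 0 / (c * ln 2))) (at_right 0)"
    using tendsto_add[OF tendsto_const[of "\<alpha> + \<iota>"] tendsto_add[OF tendsto_log[OF tendsto_const[of 2] t(1)] t(2)]] \<eta>
    by simp
  then have "E \<le> \<alpha> + \<iota> + (log 2 (\<eta> + 2 * 0) + 2 * 0 / (c * ln 2))"
    by (rule tendsto_lowerbound) (auto intro: bound eventually_mono[OF eventually_at_right_less])
  then show ?thesis by (simp add: E_def)
qed

text \<open>Observing \<open>Y\<close> in addition to \<open>S\<close> raises the relative entropy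
  of \<open>X\<close> by at most the conditional mutual information. A general test density
  \<open>r\<close> is reached by truncating \<open>r / m\<close>; the expected logarithm of
  \<open>m\<close> appears on both sides and cancels.\<close>

lemma (in prob_space) rel_entropy_le_observe:
  fixes m :: "'x \<Rightarrow> real"
  assumes X[measurable]: "X \<in> measurable M N0" and Y[measurable]: "Y \<in> measurable M MY"
    and S[measurable]: "S \<in> measurable M PS" and N0: "sigma_finite_measure N0"
    and m[measurable]: "m \<in> borel_measurable N0" and m_pos: "\<And>x. 0 < m x"
    and m1: "(\<integral>\<^sup>+x. ennreal (m x) \<partial>N0) \<le> 1"
    and m_int: "integrable M (\<lambda>\<omega>. log 2 (m (X \<omega>)))"
    and le: "rel_entropy_le M (N0 \<Otimes>\<^sub>M distr M PS S) (\<lambda>\<omega>. (X \<omega>, S \<omega>)) \<alpha>"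
    and cmi: "\<And>(f :: 'x \<Rightarrow> nat) (g :: 'y \<Rightarrow> nat). simple_function N0 f \<Longrightarrow> simple_function MY g \<Longrightarrow>
      conditional_mutual_information 2 (count_space UNIV) (count_space UNIV) PS
        (\<lambda>\<omega>. f (X \<omega>)) (\<lambda>\<omega>. g (Y \<omega>)) S \<le> \<iota>"
  shows "rel_entropy_le M (N0 \<Otimes>\<^sub>M distr M (MY \<Otimes>\<^sub>M PS) (\<lambda>\<omega>. (Y \<omega>, S \<omega>))) (\<lambda>\<omega>. (X \<omega>, Y \<omega>, S \<omega>)) (\<alpha> + \<iota>)"
  unfolding rel_entropy_le_def
proof (intro ballI impI)
  let ?DYS = "distr M (MY \<Otimes>\<^sub>M PS) (\<lambda>\<omega>. (Y \<omega>, S \<omega>))"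
  interpret DYS: prob_space ?DYS by (rule prob_space_distr) measurable
  interpret B: pair_sigma_finite N0 ?DYS
    using N0 by (simp add: pair_sigma_finite_def DYS.sigma_finite_measure_axioms)
  have setsB[measurable_cong]: "sets (N0 \<Otimes>\<^sub>M ?DYS) = sets (N0 \<Otimes>\<^sub>M (MY \<Otimes>\<^sub>M PS))"
    by (intro sets_pair_measure_cong) simp_all
  fix r :: "_ \<Rightarrow> real"
  assume "r \<in> borel_measurable (N0 \<Otimes>\<^sub>M ?DYS)" and r0: "\<forall>z. 0 \<le> r z" 
    and r1: "(\<integral>\<^sup>+z. ennreal (r z) \<partial>(N0 \<Otimes>\<^sub>M ?DYS)) \<le> 1"
    and r_pos: "AE \<omega> in M. 0 < r (X \<omega>, Y \<omega>, S \<omega>)"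
    and r_int: "integrable M (\<lambda>\<omega>. log 2 (r (X \<omega>, Y \<omega>, S \<omega>)))"
  then have r[measurable]: "r \<in> borel_measurable (N0 \<Otimes>\<^sub>M (MY \<Otimes>\<^sub>M PS))"
    using setsB by (simp cong: measurable_cong_sets)
  define \<phi> where "\<phi> z = r z / m (fst z)" for z
  \<comment> \<open>Since \<open>K i\<close> is at least 1, the window \<open>[1 / K i, K i]\<close>
    contains 1, so truncation moves the logarithm towards 0 and
    \<open>\<bar>log 2 \<phi>\<bar>\<close> dominates all truncations.\<close>
  define K where "K i = real (Suc i)" for i
  define \<Phi> where "\<Phi> i z = max (1 / K i) (min (K i) (\<phi> z))" for i z
  have [measurable]: "\<phi> \<in> borel_measurable (N0 \<Otimes>\<^sub>M (MY \<Otimes>\<^sub>M PS))"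
    unfolding \<phi>_def by measurable
  have \<Phi>_meas[measurable]: "\<Phi> i \<in> borel_measurable (N0 \<Otimes>\<^sub>M (MY \<Otimes>\<^sub>M PS))" for i
    unfolding \<Phi>_def by measurable
  have K1: "1 \<le> K i" for i by (simp add: K_def)
  then have K0: "0 < K i" for i by (rule less_le_trans[OF zero_less_one])
  have KK: "1 / K i \<le> K i" for i using K1[of i] K0[of i] by (simp add: divide_le_eq mult_ge1_I)
  have bound: "(\<integral>\<omega>. log 2 (\<Phi> i (X \<omega>, Y \<omega>, S \<omega>)) \<partial>M) \<le> \<alpha> + \<iota> - (\<integral>\<omega>. log 2 (m (X \<omega>)) \<partial>M) + log 2 (1 + 1 / K i)" for i
  proof -
    have "(\<integral>\<^sup>+z. ennreal (m (fst z) * \<Phi> i z) \<partial>(N0 \<Otimes>\<^sub>M ?DYS)) \<le>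
        (\<integral>\<^sup>+z. ennreal (r z) + ennreal (m (fst z)) * ennreal (1 / K i) \<partial>(N0 \<Otimes>\<^sub>M ?DYS))"
    proof (intro nn_integral_mono)
      fix z
      have "0 \<le> \<phi> z" using r0[rule_format, of z] m_pos[of "fst z"] by (simp add: \<phi>_def)
      \<comment> \<open>Cutting from above only lowers the function, and lifting to the floor adds
        at most \<open>1 / K i\<close>. As \<open>m\<close> has mass at most 1, the total mass stays
        below \<open>1 + 1 / K i\<close>.\<close>
      then have "\<Phi> i z \<le> \<phi> z + 1 / K i"
        using K0[of i] by (simp add: \<Phi>_def min.coboundedI2)
      then have "m (fst z) * \<Phi> i z \<le> m (fst z) * (\<phi> z + 1 / K i)"
        using m_pos[of "fst z"] by (intro mult_left_mono) (auto simp: less_imp_le)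
      also have "\<dots> = r z + m (fst z) * (1 / K i)"
        using m_pos[of "fst z"] by (simp add: \<phi>_def distrib_left)
      finally show "ennreal (m (fst z) * \<Phi> i z) \<le> ennreal (r z) + ennreal (m (fst z)) * ennreal (1 / K i)"
        using r0[rule_format, of z] m_pos[of "fst z"] K0[of i]
        by (simp add: ennreal_leI less_imp_le flip: ennreal_mult ennreal_plus)
    qed
    also have "\<dots> = (\<integral>\<^sup>+z. ennreal (r z) \<partial>(N0 \<Otimes>\<^sub>M ?DYS)) + (\<integral>\<^sup>+z. ennreal (m (fst z)) \<partial>(N0 \<Otimes>\<^sub>M ?DYS)) * ennreal (1 / K i)"
      by (simp add: nn_integral_add nn_integral_multc)
    also have "(\<integral>\<^sup>+z. ennreal (m (fst z)) \<partial>(N0 \<Otimes>\<^sub>M ?DYS)) = (\<integral>\<^sup>+x. ennreal (m x) \<partial>N0)"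
      using DYS.emeasure_space_1 by (subst B.nn_integral_snd[symmetric]) auto
    also have "(\<integral>\<^sup>+z. ennreal (r z) \<partial>(N0 \<Otimes>\<^sub>M ?DYS)) + (\<integral>\<^sup>+x. ennreal (m x) \<partial>N0) * ennreal (1 / K i) \<le> 1 + 1 * ennreal (1 / K i)"
      by (intro add_mono mult_right_mono r1 m1) simp
    also have "\<dots> = ennreal (1 + 1 / K i)" using K0[of i] by (subst ennreal_plus) auto
    finally have mass: "(\<integral>\<^sup>+z. ennreal (m (fst z) * \<Phi> i z) \<partial>(N0 \<Otimes>\<^sub>M ?DYS)) \<le> ennreal (1 + 1 / K i)" .
    have b: "1 / K i \<le> \<Phi> i z" "\<Phi> i z \<le> K i" for z using KK[of i] by (auto simp: \<Phi>_def)
    have pos: "0 < 1 / K i" "0 < 1 + 1 / K i" using K0[of i] by (auto intro: add_pos_pos)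
    from rel_entropy_le_bounded_density[OF X Y S N0 m m_pos m1 m_int le cmi \<Phi>_meas pos(1) b pos(2) mass]
    show ?thesis by simp
  qed
  have \<phi>_log: "AE \<omega> in M. log 2 (\<phi> (X \<omega>, Y \<omega>, S \<omega>)) = log 2 (r (X \<omega>, Y \<omega>, S \<omega>)) - log 2 (m (X \<omega>))"
    using r_pos by eventually_elim (simp add: \<phi>_def log_divide m_pos less_imp_neq[OF m_pos, symmetric])
  have int_diff: "integrable M (\<lambda>\<omega>. log 2 (r (X \<omega>, Y \<omega>, S \<omega>)) - log 2 (m (X \<omega>)))"
    using r_int m_int by simp
  have \<phi>_int: "integrable M (\<lambda>\<omega>. log 2 (\<phi> (X \<omega>, Y \<omega>, S \<omega>)))"
    by (rule integrable_cong_AE_imp[OF int_diff]) (use \<phi>_log in \<open>auto elim: eventually_mono\<close>)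
  have "(\<lambda>i. \<integral>\<omega>. log 2 (\<Phi> i (X \<omega>, Y \<omega>, S \<omega>)) \<partial>M) \<longlonglongrightarrow> (\<integral>\<omega>. log 2 (\<phi> (X \<omega>, Y \<omega>, S \<omega>)) \<partial>M)"
  proof (rule integral_dominated_convergence[where w="\<lambda>\<omega>. \<bar>log 2 (\<phi> (X \<omega>, Y \<omega>, S \<omega>))\<bar>"])
    show "integrable M (\<lambda>\<omega>. \<bar>log 2 (\<phi> (X \<omega>, Y \<omega>, S \<omega>))\<bar>)" using \<phi>_int by simp
    show "AE \<omega> in M. norm (log 2 (\<Phi> i (X \<omega>, Y \<omega>, S \<omega>))) \<le> \<bar>log 2 (\<phi> (X \<omega>, Y \<omega>, S \<omega>))\<bar>" for i
      using r_pos
    proof eventually_elim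
      case (elim \<omega>)
      then have p: "0 < \<phi> (X \<omega>, Y \<omega>, S \<omega>)" (is "0 < ?p") using m_pos by (simp add: \<phi>_def)
      have l: "log 2 (1 / K i) \<le> 0" "0 \<le> log 2 (K i)" using K1[of i] K0[of i] by (auto simp: log_divide)
      consider "\<Phi> i (X \<omega>, Y \<omega>, S \<omega>) = ?p" | "\<Phi> i (X \<omega>, Y \<omega>, S \<omega>) = K i" "K i \<le> ?p"
        | "\<Phi> i (X \<omega>, Y \<omega>, S \<omega>) = 1 / K i" "?p \<le> 1 / K i"
        using KK[of i] unfolding \<Phi>_def
        by (cases "?p \<le> 1 / K i"; cases "K i \<le> ?p") (auto simp: max_def min_def)
      then show ?case
      proof cases
        case 2
        then have "log 2 (K i) \<le> log 2 ?p" using K0[of i] p by simp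
        then show ?thesis using l 2(1) by simp
      next
        case 3
        then have "log 2 ?p \<le> log 2 (1 / K i)" using K0[of i] p by (subst log_le_cancel_iff) auto
        then show ?thesis using l unfolding 3(1) by simp
      qed simp
    qed
    show "AE \<omega> in M. (\<lambda>i. log 2 (\<Phi> i (X \<omega>, Y \<omega>, S \<omega>))) \<longlonglongrightarrow> log 2 (\<phi> (X \<omega>, Y \<omega>, S \<omega>))"
      using r_pos
    proof eventually_elim
      case (elim \<omega>)
      then have p: "0 < \<phi> (X \<omega>, Y \<omega>, S \<omega>)" (is "0 < ?p") using m_pos by (simp add: \<phi>_def)
      obtain n where n: "max ?p (1 / ?p) \<le> real n" using real_arch_simple by blast
      have "\<Phi> i (X \<omega>, Y \<omega>, S \<omega>) = ?p" if "n \<le> i" for i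
      proof -
        have "real n \<le> K i" using that by (simp add: K_def)
        then have "?p \<le> K i" "1 / ?p \<le> K i" using n by auto
        moreover from this(2) have "1 / K i \<le> ?p" using p K0[of i] by (simp add: field_simps)
        ultimately show ?thesis by (simp add: \<Phi>_def)
      qed
      then have "\<forall>\<^sub>F i in sequentially. log 2 (\<Phi> i (X \<omega>, Y \<omega>, S \<omega>)) = log 2 ?p"
        by (intro eventually_sequentiallyI[of n]) simp
      then show ?case by (rule tendsto_eventually)
    qed
  qed auto
  moreover have "(\<lambda>i. \<alpha> + \<iota> - (\<integral>\<omega>. log 2 (m (X \<omega>)) \<partial>M) + log 2 (1 + 1 / K i)) \<longlonglongrightarrow>
      \<alpha> + \<iota> - (\<integral>\<omega>. log 2 (m (X \<omega>)) \<partial>M) + log 2 (1 + 0)"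
  proof -
    have "(\<lambda>i. 1 / K i) \<longlonglongrightarrow> 0"
      using LIMSEQ_inverse_real_of_nat by (simp add: K_def inverse_eq_divide)
    from tendsto_add[OF tendsto_const tendsto_log[OF tendsto_const[of 2] tendsto_add[OF tendsto_const[of 1] this]]]
    show ?thesis by simp
  qed
  ultimately have "(\<integral>\<omega>. log 2 (\<phi> (X \<omega>, Y \<omega>, S \<omega>)) \<partial>M) \<le> \<alpha> + \<iota> - (\<integral>\<omega>. log 2 (m (X \<omega>)) \<partial>M) + log 2 (1 + 0)"
    by (rule LIMSEQ_le) (use bound in auto)
  moreover have "(\<integral>\<omega>. log 2 (\<phi> (X \<omega>, Y \<omega>, S \<omega>)) \<partial>M) =
      (\<integral>\<omega>. log 2 (r (X \<omega>, Y \<omega>, S \<omega>)) - log 2 (m (X \<omega>)) \<partial>M)"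
    by (rule integral_cong_AE[OF _ _ \<phi>_log]) measurable
  ultimately show "(\<integral>\<omega>. log 2 (r (X \<omega>, Y \<omega>, S \<omega>)) \<partial>M) \<le> \<alpha> + \<iota>"
    using r_int m_int by simp
qed


section \<open>Linear change of variables and Gaussian densities\<close>

text \<open>For fixed other coordinates the shear translates the coordinate along \<open>e\<close>
  by a constant, since \<open>e'\<close> is among the others. Fubini reduces the claim to
  translation invariance on the line.\<close>

lemma nn_integral_lborel_shear:
  fixes g :: "'a::euclidean_space \<Rightarrow> ennreal"
  assumes [measurable]: "g \<in> borel_measurable borel" and e: "e \<in> Basis" "e' \<in> Basis" "e \<noteq> e'"
  shows "(\<integral>\<^sup>+x. g (x + (x \<bullet> e') *\<^sub>R e) \<partial>lborel) = (\<integral>\<^sup>+x. g x \<partial>lborel)"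
proof -
  interpret product_sigma_finite "\<lambda>_. lborel :: real measure" by standard
  let ?B = "Basis - {e}"
  define F where "F f = (\<Sum>b\<in>Basis. f b *\<^sub>R b)" for f :: "'a \<Rightarrow> real"
  have B: "Basis = insert e ?B" "finite ?B" "e \<notin> ?B" using e by auto
  have F_m[measurable]: "F \<in> measurable (\<Pi>\<^sub>M b\<in>Basis. lborel) borel"
    unfolding F_def by measurable
  have F_e': "F f \<bullet> e' = f e'" for f
    unfolding F_def using e by (simp add: inner_sum_left inner_Basis if_distrib cong: if_cong)
  have F_upd: "F (f(e := y)) = y *\<^sub>R e + (\<Sum>b\<in>?B. f b *\<^sub>R b)" for f y
  proof -
    have "F (f(e := y)) = (\<Sum>b\<in>insert e ?B. (f(e := y)) b *\<^sub>R b)"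
      unfolding F_def using B(1) by simp
    also have "\<dots> = y *\<^sub>R e + (\<Sum>b\<in>?B. (f(e := y)) b *\<^sub>R b)" by (subst sum.insert) auto
    also have "(\<Sum>b\<in>?B. (f(e := y)) b *\<^sub>R b) = (\<Sum>b\<in>?B. f b *\<^sub>R b)" by (intro sum.cong) auto
    finally show ?thesis .
  qed
  have split: "(\<integral>\<^sup>+f. h (F f) \<partial>(\<Pi>\<^sub>M b\<in>Basis. lborel)) =
      (\<integral>\<^sup>+f. \<integral>\<^sup>+y. h (F (f(e := y))) \<partial>lborel \<partial>(\<Pi>\<^sub>M b\<in>?B. lborel))"
    if [measurable]: "h \<in> borel_measurable borel" for h :: "'a \<Rightarrow> ennreal"
  proof -
    have "(\<lambda>f. h (F f)) \<in> borel_measurable (\<Pi>\<^sub>M b\<in>insert e ?B. lborel)"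
      unfolding B(1)[symmetric] by measurable
    from product_nn_integral_insert[OF B(2,3) this] show ?thesis
      unfolding B(1)[symmetric] .
  qed
  have lb: "(\<integral>\<^sup>+x. h x \<partial>lborel) = (\<integral>\<^sup>+f. h (F f) \<partial>(\<Pi>\<^sub>M b\<in>Basis. lborel))"
    if [measurable]: "h \<in> borel_measurable borel" for h :: "'a \<Rightarrow> ennreal"
    unfolding F_def by (subst lborel_def) (simp add: nn_integral_distr lborel_eq_real)
  have "(\<integral>\<^sup>+x. g (x + (x \<bullet> e') *\<^sub>R e) \<partial>lborel) =
      (\<integral>\<^sup>+f. \<integral>\<^sup>+y. g (F (f(e := y)) + (F (f(e := y)) \<bullet> e') *\<^sub>R e) \<partial>lborel \<partial>(\<Pi>\<^sub>M b\<in>?B. lborel))"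
    by (subst lb, measurable) (subst split, measurable)
  also have "\<dots> = (\<integral>\<^sup>+f. \<integral>\<^sup>+y. g (F (f(e := y))) \<partial>lborel \<partial>(\<Pi>\<^sub>M b\<in>?B. lborel))"
  proof (rule nn_integral_cong)
    fix f :: "'a \<Rightarrow> real"
    let ?h = "\<lambda>y. g (F (f(e := y)))"
    have [measurable]: "?h \<in> borel_measurable borel" unfolding F_upd by measurable
    have "(\<integral>\<^sup>+y. g (F (f(e := y)) + (F (f(e := y)) \<bullet> e') *\<^sub>R e) \<partial>lborel) = (\<integral>\<^sup>+y. ?h (f e' + 1 * y) \<partial>lborel)"
      using e unfolding F_e' by (simp add: F_upd algebra_simps)
    also have "\<dots> = (\<integral>\<^sup>+y. ?h y \<partial>lborel)"
      using nn_integral_real_affine[of ?h 1 "f e'"] by simp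
    finally show "(\<integral>\<^sup>+y. g (F (f(e := y)) + (F (f(e := y)) \<bullet> e') *\<^sub>R e) \<partial>lborel) = (\<integral>\<^sup>+y. ?h y \<partial>lborel)" .
  qed
  also have "\<dots> = (\<integral>\<^sup>+x. g x \<partial>lborel)"
    by (subst lb, measurable) (subst split, measurable)
  finally show ?thesis .
qed

lemma prod_Basis_vec:
  "(\<Prod>b\<in>Basis. f b) = (\<Prod>i\<in>UNIV. f (axis i 1 :: real^'n))"
proof -
  have "Basis = range (\<lambda>i. axis i 1 :: real^'n)" by (auto simp: Basis_vec_def)
  then show ?thesis
    using prod.reindex[of "\<lambda>i. axis i 1 :: real^'n" UNIV f]
    by (simp only: comp_def) (simp add: inj_on_def axis_eq_axis)
qed

text \<open>Exchanging coordinates maps boxes to boxes and permutes their side lengths; Lebesgue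
  measure is determined by its values on boxes.\<close>

lemma distr_lborel_swap:
  fixes m n :: "'n::finite"
  shows "distr lborel borel (\<lambda>x :: real^'n. \<chi> i. x $ Transposition.transpose m n i) = lborel"
proof -
  let ?T = "\<lambda>x :: real^'n. \<chi> i. x $ Transposition.transpose m n i"
  have T[measurable]: "?T \<in> borel_measurable borel"
    by (intro borel_measurable_continuous_onI continuous_intros)
  have "lborel = distr lborel borel ?T"
  proof (rule lborel_eqI)
    fix l u :: "real^'n" assume le: "\<And>b. b \<in> Basis \<Longrightarrow> l \<bullet> b \<le> u \<bullet> b"
    then have le': "l $ i \<le> u $ i" for i using le[of "axis i 1"] by (simp add: inner_axis)
    have eq: "?T -` box l u = box (?T l) (?T u)"
      by (auto simp: mem_box_cart) (metis transpose_involutory)+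
    have "emeasure (distr lborel borel ?T) (box l u) = emeasure lborel (box (?T l) (?T u))"
      by (simp add: emeasure_distr eq)
    also have "\<dots> = ennreal (\<Prod>i\<in>UNIV. (u - l) $ Transposition.transpose m n i)"
    proof -
      have "\<forall>b\<in>Basis. ?T l \<bullet> b \<le> ?T u \<bullet> b"
        by (auto simp: Basis_vec_def inner_axis le')
      then show ?thesis
        by (simp add: emeasure_lborel_box_eq prod_Basis_vec inner_axis)
    qed
    also have "(\<Prod>i\<in>UNIV. (u - l) $ Transposition.transpose m n i) = (\<Prod>i\<in>UNIV. (u - l) $ i)"
      by (rule prod.permute[OF permutes_swap_id, symmetric, unfolded comp_def]) auto
    also have "\<dots> = (\<Prod>b\<in>Basis. (u - l) \<bullet> b)" by (simp add: prod_Basis_vec inner_axis)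
    finally show "emeasure (distr lborel borel ?T) (box l u) = ennreal (\<Prod>b\<in>Basis. (u - l) \<bullet> b)" .
  qed simp
  then show ?thesis by simp
qed

text \<open>
  The change of variables theorems of the library require a well-ordered index type \<open>'n\<close>.
\<close>

lemma nn_integral_lborel_matrix:
  fixes A :: "real^'n^'n"
  assumes "det A \<noteq> 0" and "g \<in> borel_measurable borel"
  shows "ennreal \<bar>det A\<bar> * (\<integral>\<^sup>+x. g (A *v x) \<partial>lborel) = (\<integral>\<^sup>+x. g x \<partial>lborel)"
proof -
  have [measurable]: "(\<lambda>x. A *v x) \<in> borel_measurable borel" for A :: "real^'n^'n"
    by (intro borel_measurable_continuous_onI continuous_intros)
  define P where "P A \<longleftrightarrow> (det A \<noteq> 0 \<longrightarrow> (\<forall>g\<in>borel_measurable borel.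
    ennreal \<bar>det A\<bar> * (\<integral>\<^sup>+x. g (A *v x) \<partial>lborel) = (\<integral>\<^sup>+x. g x \<partial>lborel)))" for A :: "real^'n^'n"
  have "P A"
  \<comment> \<open>The formula is multiplicative in \<open>A\<close>, so elementary matrices
    suffice: diagonal ones scale, transpositions permute and shears preserve Lebesgue measure. A
    zero row contradicts the nonzero determinant.\<close>
  proof (induction A rule: induct_matrix_elementary_alt)
    case (1 A B)
    show ?case unfolding P_def
    proof (intro impI ballI)
      fix g :: "real^'n \<Rightarrow> ennreal" assume [measurable]: "g \<in> borel_measurable borel" and "det (A ** B) \<noteq> 0"
      then have d: "det A \<noteq> 0" "det B \<noteq> 0" by (auto simp: det_mul)
      have "ennreal \<bar>det (A ** B)\<bar> * (\<integral>\<^sup>+x. g ((A ** B) *v x) \<partial>lborel) =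
          ennreal \<bar>det A\<bar> * (ennreal \<bar>det B\<bar> * (\<integral>\<^sup>+x. g (A *v (B *v x)) \<partial>lborel))"
        by (simp add: det_mul abs_mult ennreal_mult' matrix_vector_mul_assoc mult.assoc)
      also have "ennreal \<bar>det B\<bar> * (\<integral>\<^sup>+x. g (A *v (B *v x)) \<partial>lborel) = (\<integral>\<^sup>+x. g (A *v x) \<partial>lborel)"
      proof -
        have "\<forall>g\<in>borel_measurable borel. ennreal \<bar>det B\<bar> * (\<integral>\<^sup>+x. g (B *v x) \<partial>lborel) = (\<integral>\<^sup>+x. g x \<partial>lborel)"
          using 1(2) d(2) unfolding P_def by simp
        from bspec[OF this, of "\<lambda>x. g (A *v x)"] show ?thesis by simp
      qed
      also have "ennreal \<bar>det A\<bar> * \<dots> = (\<integral>\<^sup>+x. g x \<partial>lborel)"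
        using 1(1) d(1) unfolding P_def by simp
      finally show "ennreal \<bar>det (A ** B)\<bar> * (\<integral>\<^sup>+x. g ((A ** B) *v x) \<partial>lborel) = (\<integral>\<^sup>+x. g x \<partial>lborel)" .
    qed
  next
    case (2 A i)
    then show ?case by (simp add: P_def det_zero_row)
  next
    case (3 A)
    show ?case unfolding P_def
    proof (intro impI ballI)
      fix g :: "real^'n \<Rightarrow> ennreal" assume [measurable]: "g \<in> borel_measurable borel" and d: "det A \<noteq> 0"
      have det: "det A = (\<Prod>i\<in>UNIV. A $ i $ i)" using 3 by (rule det_diagonal)
      then have nz: "A $ i $ i \<noteq> 0" for i using d by auto
      \<comment> \<open>The scaling theorem for Lebesgue measure indexes its factors by basis
        vectors; this recovers the diagonal entry from the basis vector.\<close>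
      define c where "c b = (A *v b) \<bullet> b" for b
      have c: "c (axis i 1) = A $ i $ i" for i
      proof -
        have "c (axis i 1) = (A *v axis i 1) $ i" by (simp add: c_def inner_axis)
        also have "\<dots> = A $ i $ i"
          by (simp add: matrix_vector_mult_def axis_def if_distrib cong: if_cong)
        finally show ?thesis .
      qed
      have T: "0 + (\<Sum>j\<in>Basis. (c j * (x \<bullet> j)) *\<^sub>R j) = A *v x" for x
      proof (rule vec_eq_iff[THEN iffD2], rule allI)
        fix i
        have "(\<Sum>j\<in>Basis. (c j * (x \<bullet> j)) *\<^sub>R j) $ i = (\<Sum>j\<in>Basis. (c j * (x \<bullet> j)) *\<^sub>R j) \<bullet> axis i 1"
          by (simp add: inner_axis)
        also have "\<dots> = A $ i $ i * x $ i"
          by (subst inner_sum_left_Basis) (auto simp: axis_in_Basis_iff c inner_axis)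
        also have "\<dots> = (\<Sum>j\<in>UNIV. A $ i $ j * x $ j)"
          using 3 by (subst sum.remove[of _ i]) (auto intro!: sum.neutral)
        finally show "(0 + (\<Sum>j\<in>Basis. (c j * (x \<bullet> j)) *\<^sub>R j)) $ i = (A *v x) $ i"
          by (simp add: matrix_vector_mult_def)
      qed
      have "(lborel :: (real^'n) measure) = density (distr lborel borel (\<lambda>x. 0 + (\<Sum>j\<in>Basis. (c j * (x \<bullet> j)) *\<^sub>R j))) (\<lambda>_. (\<Prod>j\<in>Basis. \<bar>c j\<bar>))"
        by (rule lborel_affine_euclidean) (auto simp: Basis_vec_def c nz)
      also have "(\<lambda>x. 0 + (\<Sum>j\<in>Basis. (c j * (x \<bullet> j)) *\<^sub>R j)) = (\<lambda>x. A *v x)" unfolding T ..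
      also have "(\<Prod>j\<in>Basis. \<bar>c j\<bar>) = \<bar>det A\<bar>" by (simp add: prod_Basis_vec c det abs_prod)
      finally have l: "(lborel :: (real^'n) measure) = density (distr lborel borel (\<lambda>x. A *v x)) (\<lambda>_. ennreal \<bar>det A\<bar>)" .
      show "ennreal \<bar>det A\<bar> * (\<integral>\<^sup>+x. g (A *v x) \<partial>lborel) = (\<integral>\<^sup>+x. g x \<partial>lborel)"
        by (subst (2) l) (simp add: nn_integral_density nn_integral_distr nn_integral_cmult)
    qed
  next
    case (4 m n)
    let ?A = "(\<chi> i j. mat 1 $ i $ Transposition.transpose m n j) :: real^'n^'n"
    have "\<bar>det ?A\<bar> = 1"
      using det_permute_columns[OF permutes_swap_id[of m UNIV n], of "mat 1 :: real^'n^'n"]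
      by (simp add: sign_swap_id abs_mult)
    moreover have "?A *v x = (\<chi> i. x $ Transposition.transpose m n i)" for x
    proof (rule vec_eq_iff[THEN iffD2], rule allI)
      fix i
      have "mat 1 $ i $ Transposition.transpose m n j = (if j = Transposition.transpose m n i then 1 else 0 :: real)" for j
        by (auto simp: mat_def)
      then show "(?A *v x) $ i = (\<chi> i. x $ Transposition.transpose m n i) $ i"
        by (simp add: matrix_vector_mult_def if_distrib[of "\<lambda>y. y * _"] cong: if_cong)
    qed
    moreover have [measurable]: "(\<lambda>x :: real^'n. \<chi> i. x $ Transposition.transpose m n i) \<in> borel_measurable borel"
      by (intro borel_measurable_continuous_onI continuous_intros)
    ultimately show ?case unfolding P_def
      by (subst (2) distr_lborel_swap[symmetric, of m n]) (simp add: nn_integral_distr)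
  next
    case (5 m n)
    let ?A = "(\<chi> i j. of_bool (i = m \<and> j = n \<or> i = j)) :: real^'n^'n"
    have "?A = (\<chi> k. if k = m then row m (mat 1) + 1 *s row n (mat 1) else row k (mat 1))"
      using 5 by (auto simp: vec_eq_iff row_def mat_def)
    then have "det ?A = det (mat 1 :: real^'n^'n)"
      using det_row_operation[OF 5, where A="mat 1 :: real^'n^'n" and c=1] by (simp only:)
    then have "det ?A = 1" by simp
    moreover have "?A *v x = x + (x \<bullet> axis n 1) *\<^sub>R axis m 1" for x
    proof (rule vec_eq_iff[THEN iffD2], rule allI)
      fix i
      have "of_bool (i = m \<and> j = n \<or> i = j) * x $ j = (if j = i then x $ i else 0) + (if j = n then of_bool (i = m) * x $ n else 0)" for j
        using 5 by auto
      then show "(?A *v x) $ i = (x + (x \<bullet> axis n 1) *\<^sub>R axis m 1) $ i"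
        by (simp only: inner_axis) (simp add: matrix_vector_mult_def sum.distrib axis_def)
    qed
    ultimately show ?case unfolding P_def
      using 5 by (auto intro!: nn_integral_lborel_shear simp: axis_eq_axis axis_in_Basis_iff)
  qed
  then show ?thesis using assms unfolding P_def by blast
qed

lemma nn_integral_lborel_affine_matrix:
  fixes A :: "real^'n^'n"
  assumes "det A \<noteq> 0" and [measurable]: "g \<in> borel_measurable borel"
  shows "ennreal \<bar>det A\<bar> * (\<integral>\<^sup>+x. g (A *v x + w) \<partial>lborel) = (\<integral>\<^sup>+x. g x \<partial>lborel)"
proof -
  have "ennreal \<bar>det A\<bar> * (\<integral>\<^sup>+x. g (A *v x + w) \<partial>lborel) = (\<integral>\<^sup>+x. g (x + w) \<partial>lborel)"
    by (rule nn_integral_lborel_matrix[OF assms(1), of "\<lambda>x. g (x + w)"]) measurable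
  also have "\<dots> = (\<integral>\<^sup>+x. g x \<partial>distr lborel borel ((+) w))"
    by (simp add: nn_integral_distr add.commute)
  finally show ?thesis by (simp add: lborel_distr_plus)
qed

section \<open>The Gaussian reference density and second moments\<close>

definition std_gauss :: "'a::euclidean_space \<Rightarrow> real" where
  "std_gauss x = (\<Prod>b\<in>Basis. std_normal_density (x \<bullet> b))"

lemma std_gauss_measurable[measurable]: "std_gauss \<in> borel_measurable borel"
  unfolding std_gauss_def by measurable

lemma std_gauss_pos: "0 < std_gauss x"
  unfolding std_gauss_def by (intro prod_pos normal_density_pos) simp

lemma nn_integral_std_gauss: "(\<integral>\<^sup>+x. ennreal (std_gauss x) \<partial>(lborel :: 'a::euclidean_space measure)) = 1"
proof -
  have "(\<integral>\<^sup>+x. ennreal (std_normal_density x) \<partial>lborel) = 1"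
    by (subst nn_integral_eq_integral) auto
  then show ?thesis
    unfolding std_gauss_def
    using nn_integral_lborel_prod[of "\<lambda>(_::'a) x. ennreal (std_normal_density x)"]
    by (simp add: prod_ennreal)
qed

lemma sum_inner_Basis_power2: "(\<Sum>b\<in>Basis. (x \<bullet> b)\<^sup>2) = (norm (x :: 'a::euclidean_space))\<^sup>2"
  unfolding power2_norm_eq_inner by (subst euclidean_inner) (simp add: power2_eq_square)

text \<open>The logarithm is affine in the squared norm. Hence finite second moments make it
  integrable, and a bound on the second moment becomes a bound on its expectation.\<close>

lemma log_std_gauss:
  "log 2 (std_gauss (x :: 'a::euclidean_space)) = real DIM('a) * log 2 (1 / sqrt (2 * pi)) - (norm x)\<^sup>2 / (2 * ln 2)"
proof -
  have "log 2 (std_gauss x) = (\<Sum>b\<in>Basis. log 2 (std_normal_density (x \<bullet> b)))"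
    unfolding std_gauss_def log_def by (subst ln_prod) (auto simp: sum_divide_distrib normal_density_pos
        normal_density_pos[THEN less_imp_neq, symmetric])
  also have "\<dots> = (\<Sum>b\<in>Basis. log 2 (1 / sqrt (2 * pi)) - (x \<bullet> b)\<^sup>2 / (2 * ln 2))"
    by (intro sum.cong refl, simp only: std_normal_density_def, subst log_mult) (auto simp: log_def)
  also have "\<dots> = real DIM('a) * log 2 (1 / sqrt (2 * pi)) - (\<Sum>b\<in>Basis. (x \<bullet> b)\<^sup>2) / (2 * ln 2)"
    by (simp add: sum_subtractf sum_divide_distrib)
  finally show ?thesis by (simp only: sum_inner_Basis_power2)
qed

text \<open>The squared norm is the sum of squares of the functionals along a basis; each is either
  a scalar Gaussian or almost surely 0.\<close>

lemma gaussian_vector_square_integrable: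
  fixes X :: "'w \<Rightarrow> real^'n"
  assumes "prob_space M" and X: "gaussian_vector M X K"
  shows "integrable M (\<lambda>\<omega>. (norm (X \<omega>))\<^sup>2)"
proof -
  have [measurable]: "X \<in> borel_measurable M" using X by (simp add: gaussian_vector_def)
  have "integrable M (\<lambda>\<omega>. (v \<bullet> X \<omega>)\<^sup>2)" for v
  proof (cases "v \<bullet> (K *v v) = 0")
    case True
    then have "AE \<omega> in M. v \<bullet> X \<omega> = 0" using X by (simp add: gaussian_vector_def)
    then have "AE \<omega> in M. (v \<bullet> X \<omega>)\<^sup>2 = 0" by eventually_elim simp
    then show ?thesis
      by (subst integrable_cong_AE[of _ _ "\<lambda>_. 0"]) auto
  next
    case False
    let ?s = "sqrt (v \<bullet> (K *v v))"
    have "0 \<le> v \<bullet> (K *v v)" using X by (auto simp: gaussian_vector_def)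
    with False have s: "0 < ?s" by simp
    have "distributed M lborel (\<lambda>\<omega>. v \<bullet> X \<omega>) (normal_density 0 ?s)"
      using X False by (auto simp: gaussian_vector_def)
    from distributed_integrable[OF this, of "\<lambda>x. x\<^sup>2"] show ?thesis
      using integrable_normal_moment[OF s, of 0 2] by simp
  qed
  then have "integrable M (\<lambda>\<omega>. \<Sum>b\<in>Basis. (b \<bullet> X \<omega>)\<^sup>2)"
    by (intro Bochner_Integration.integrable_sum)
  then show ?thesis
    by (simp only: inner_commute[of _ "X _"] sum_inner_Basis_power2)
qed

lemma square_integrable_affine:
  fixes X :: "'w \<Rightarrow> real^'n" and Y :: "'w \<Rightarrow> real^'m"
  assumes [measurable]: "X \<in> borel_measurable M" "Y \<in> borel_measurable M"
    and X: "integrable M (\<lambda>\<omega>. (norm (X \<omega>))\<^sup>2)" and Y: "integrable M (\<lambda>\<omega>. (norm (Y \<omega>))\<^sup>2)"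
  shows "integrable M (\<lambda>\<omega>. (norm (A *v X \<omega> + Y \<omega>))\<^sup>2)"
proof -
  have A[measurable]: "(\<lambda>x. A *v x) \<in> borel_measurable borel"
    by (intro borel_measurable_continuous_onI continuous_intros)
  obtain K where K: "\<And>x. norm (A *v x) \<le> norm x * K"
    using bounded_linear.bounded[OF matrix_vector_mul_bounded_linear[of A]] by blast
  have "integrable M (\<lambda>\<omega>. 2 * K\<^sup>2 * (norm (X \<omega>))\<^sup>2 + 2 * (norm (Y \<omega>))\<^sup>2)"
    using X Y by simp
  then show ?thesis
  proof (rule Bochner_Integration.integrable_bound)
    show "AE \<omega> in M. norm ((norm (A *v X \<omega> + Y \<omega>))\<^sup>2) \<le> norm (2 * K\<^sup>2 * (norm (X \<omega>))\<^sup>2 + 2 * (norm (Y \<omega>))\<^sup>2)"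
    proof (intro AE_I2)
      fix \<omega>
      have "(norm (A *v X \<omega> + Y \<omega>))\<^sup>2 \<le> (norm (A *v X \<omega>) + norm (Y \<omega>))\<^sup>2"
        by (intro power_mono norm_triangle_ineq) simp
      also have "\<dots> \<le> 2 * (norm (A *v X \<omega>))\<^sup>2 + 2 * (norm (Y \<omega>))\<^sup>2"
        using sum_squares_bound[of "norm (A *v X \<omega>)" "norm (Y \<omega>)"] by (simp add: power2_sum)
      also have "(norm (A *v X \<omega>))\<^sup>2 \<le> (norm (X \<omega>) * K)\<^sup>2" using K by (intro power_mono) auto
      finally show "norm ((norm (A *v X \<omega> + Y \<omega>))\<^sup>2) \<le> norm (2 * K\<^sup>2 * (norm (X \<omega>))\<^sup>2 + 2 * (norm (Y \<omega>))\<^sup>2)"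
        by (simp add: power_mult_distrib mult_ac)
    qed
  qed measurable
qed


section \<open>Independence\<close>

text \<open>Independence on preimages is the product formula on rectangles, and these determine the
  joint law. The product form is the one to which Fubini applies.\<close>

lemma (in prob_space) independent_rvs_iff_distr:
  "independent_rvs M P X Q Y \<longleftrightarrow> X \<in> measurable M P \<and> Y \<in> measurable M Q \<and>
     distr M (P \<Otimes>\<^sub>M Q) (\<lambda>\<omega>. (X \<omega>, Y \<omega>)) = distr M P X \<Otimes>\<^sub>M distr M Q Y"
    (is "_ \<longleftrightarrow> ?X \<and> ?Y \<and> ?D")
proof (cases "?X \<and> ?Y")
  case True
  then have [measurable]: ?X ?Y by auto
  interpret X: prob_space "distr M P X" by (rule prob_space_distr) fact
  interpret Y: prob_space "distr M Q Y" by (rule prob_space_distr) fact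
  have joint: "emeasure (distr M (P \<Otimes>\<^sub>M Q) (\<lambda>\<omega>. (X \<omega>, Y \<omega>))) (A \<times> B) =
      ennreal (prob ((X -` A \<inter> space M) \<inter> (Y -` B \<inter> space M)))"
    if [measurable]: "A \<in> sets P" "B \<in> sets Q" for A B
    by (subst emeasure_distr) (auto simp: emeasure_eq_measure intro!: arg_cong[where f=prob])
  have marg: "emeasure (distr M P X) A * emeasure (distr M Q Y) B =
      ennreal (prob (X -` A \<inter> space M) * prob (Y -` B \<inter> space M))"
    if [measurable]: "A \<in> sets P" "B \<in> sets Q" for A B
    by (simp add: emeasure_distr emeasure_eq_measure ennreal_mult)
  show ?thesis
  proof
    assume "independent_rvs M P X Q Y"
    then have ind: "indep_set {X -` S \<inter> space M |S. S \<in> sets P} {Y -` S \<inter> space M |S. S \<in> sets Q}"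
      by (simp add: independent_rvs_def)
    have "distr M P X \<Otimes>\<^sub>M distr M Q Y = distr M (P \<Otimes>\<^sub>M Q) (\<lambda>\<omega>. (X \<omega>, Y \<omega>))"
    proof (rule pair_measure_eqI)
      fix A B assume "A \<in> sets (distr M P X)" "B \<in> sets (distr M Q Y)"
      then have AB: "A \<in> sets P" "B \<in> sets Q" by auto
      have "prob ((X -` A \<inter> space M) \<inter> (Y -` B \<inter> space M)) = prob (X -` A \<inter> space M) * prob (Y -` B \<inter> space M)"
        using AB by (intro indep_setD[OF ind]) auto
      then show "emeasure (distr M P X) A * emeasure (distr M Q Y) B =
          emeasure (distr M (P \<Otimes>\<^sub>M Q) (\<lambda>\<omega>. (X \<omega>, Y \<omega>))) (A \<times> B)"
        by (simp add: joint[OF AB] marg[OF AB])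
    qed (auto intro: X.sigma_finite_measure_axioms Y.sigma_finite_measure_axioms)
    with True show "?X \<and> ?Y \<and> ?D" by simp
  next
    assume "?X \<and> ?Y \<and> ?D"
    then have D: ?D by simp
    have "indep_set {X -` S \<inter> space M |S. S \<in> sets P} {Y -` S \<inter> space M |S. S \<in> sets Q}"
    proof (rule indep_setI)
      fix a b assume "a \<in> {X -` S \<inter> space M |S. S \<in> sets P}" "b \<in> {Y -` S \<inter> space M |S. S \<in> sets Q}"
      then obtain A B where AB: "A \<in> sets P" "B \<in> sets Q" and ab: "a = X -` A \<inter> space M" "b = Y -` B \<inter> space M"
        by auto
      have "ennreal (prob (a \<inter> b)) = emeasure (distr M P X \<Otimes>\<^sub>M distr M Q Y) (A \<times> B)"
        using joint[OF AB] unfolding D ab by simp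
      also have "\<dots> = ennreal (prob a * prob b)"
        using AB by (subst Y.emeasure_pair_measure_Times) (simp_all add: marg[OF AB] ab)
      finally show "prob (a \<inter> b) = prob a * prob b" by simp
    qed (auto intro: measurable_sets[OF \<open>?X\<close>] measurable_sets[OF \<open>?Y\<close>])
    with True show "independent_rvs M P X Q Y" by (simp add: independent_rvs_def)
  qed
qed (auto simp: independent_rvs_def)

lemma (in prob_space) independent_rvs_sym:
  assumes "independent_rvs M P X Q Y"
  shows "independent_rvs M Q Y P X"
proof -
  from assms have ind: "indep_set {X -` S \<inter> space M |S. S \<in> sets P} {Y -` S \<inter> space M |S. S \<in> sets Q}"
    by (simp add: independent_rvs_def)
  have "indep_set {Y -` S \<inter> space M |S. S \<in> sets Q} {X -` S \<inter> space M |S. S \<in> sets P}"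
  proof (rule indep_setI[OF indep_setD_ev2[OF ind] indep_setD_ev1[OF ind]])
    fix a b assume "a \<in> {Y -` S \<inter> space M |S. S \<in> sets Q}" "b \<in> {X -` S \<inter> space M |S. S \<in> sets P}"
    then show "prob (a \<inter> b) = prob a * prob b"
      using indep_setD[OF ind, of b a] by (simp only: Int_commute mult.commute)
  qed
  then show ?thesis using assms by (simp add: independent_rvs_def)
qed

lemma (in prob_space) independent_rvs_compose:
  assumes "independent_rvs M P X Q Y" and f: "f \<in> measurable P P'" and g: "g \<in> measurable Q Q'"
  shows "independent_rvs M P' (\<lambda>\<omega>. f (X \<omega>)) Q' (\<lambda>\<omega>. g (Y \<omega>))"
proof -
  from assms(1) have X[measurable]: "X \<in> measurable M P" and Y[measurable]: "Y \<in> measurable M Q"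
    and ind: "indep_set {X -` S \<inter> space M |S. S \<in> sets P} {Y -` S \<inter> space M |S. S \<in> sets Q}"
    by (auto simp: independent_rvs_def)
  note f[measurable] g[measurable]
  have *: "(\<lambda>\<omega>. k (Z \<omega>)) -` S \<inter> space M \<in> {Z -` T \<inter> space M |T. T \<in> sets N}"
    if "Z \<in> measurable M N" "k \<in> measurable N N'" "S \<in> sets N'" for S Z k N N'
    using measurable_sets[OF that(2,3)] measurable_space[OF that(1)]
    by (intro CollectI exI[of _ "k -` S \<inter> space N"]) auto
  have "indep_set {(\<lambda>\<omega>. f (X \<omega>)) -` S \<inter> space M |S. S \<in> sets P'} {(\<lambda>\<omega>. g (Y \<omega>)) -` S \<inter> space M |S. S \<in> sets Q'}"
  proof (rule indep_setI)
    fix a b assume a: "a \<in> {(\<lambda>\<omega>. f (X \<omega>)) -` S \<inter> space M |S. S \<in> sets P'}"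
      and b: "b \<in> {(\<lambda>\<omega>. g (Y \<omega>)) -` S \<inter> space M |S. S \<in> sets Q'}"
    from a b obtain S T where S: "S \<in> sets P'" "a = (\<lambda>\<omega>. f (X \<omega>)) -` S \<inter> space M"
      and T: "T \<in> sets Q'" "b = (\<lambda>\<omega>. g (Y \<omega>)) -` T \<inter> space M" by auto
    have "a \<in> {X -` S \<inter> space M |S. S \<in> sets P}" unfolding S(2) by (rule *[OF X f S(1)])
    moreover have "b \<in> {Y -` S \<inter> space M |S. S \<in> sets Q}" unfolding T(2) by (rule *[OF Y g T(1)])
    ultimately show "prob (a \<inter> b) = prob a * prob b" by (rule indep_setD[OF ind])
  qed auto
  then show ?thesis unfolding independent_rvs_def by simp
qed

text \<open>Under both hypotheses the law of \<open>(a, b, c)\<close> is the product of the three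
  marginals, so it may be regrouped; integrating out \<open>c\<close> first yields the rectangle
  formula.\<close>

lemma (in prob_space) independent_rvs_assoc:
  assumes bc: "independent_rvs M PB b PC c"
    and abc: "independent_rvs M PA a (PB \<Otimes>\<^sub>M PC) (\<lambda>\<omega>. (b \<omega>, c \<omega>))"
  shows "independent_rvs M (PA \<Otimes>\<^sub>M PB) (\<lambda>\<omega>. (a \<omega>, b \<omega>)) PC c"
proof -
  have [measurable]: "a \<in> measurable M PA" "b \<in> measurable M PB" "c \<in> measurable M PC"
    using bc abc by (auto simp: independent_rvs_def)
  have ab: "independent_rvs M PA a PB b"
    using independent_rvs_compose[OF abc measurable_ident measurable_fst] by simp
  interpret A: prob_space "distr M PA a" by (rule prob_space_distr) measurable
  interpret B: prob_space "distr M PB b" by (rule prob_space_distr) measurable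
  interpret C: prob_space "distr M PC c" by (rule prob_space_distr) measurable
  let ?AB = "distr M (PA \<Otimes>\<^sub>M PB) (\<lambda>\<omega>. (a \<omega>, b \<omega>))"
  interpret AB: prob_space ?AB by (rule prob_space_distr) measurable
  interpret BC: pair_prob_space "distr M PB b" "distr M PC c" ..
  have Dbc: "distr M (PB \<Otimes>\<^sub>M PC) (\<lambda>\<omega>. (b \<omega>, c \<omega>)) = distr M PB b \<Otimes>\<^sub>M distr M PC c"
    using bc by (simp add: independent_rvs_iff_distr)
  have Dabc: "distr M (PA \<Otimes>\<^sub>M (PB \<Otimes>\<^sub>M PC)) (\<lambda>\<omega>. (a \<omega>, b \<omega>, c \<omega>)) = distr M PA a \<Otimes>\<^sub>M (distr M PB b \<Otimes>\<^sub>M distr M PC c)"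
    using abc by (simp add: independent_rvs_iff_distr Dbc)
  have Dab: "?AB = distr M PA a \<Otimes>\<^sub>M distr M PB b"
    using ab by (simp add: independent_rvs_iff_distr)
  have "?AB \<Otimes>\<^sub>M distr M PC c = distr M ((PA \<Otimes>\<^sub>M PB) \<Otimes>\<^sub>M PC) (\<lambda>\<omega>. ((a \<omega>, b \<omega>), c \<omega>))"
  proof (rule pair_measure_eqI)
    fix E F assume "E \<in> sets ?AB" "F \<in> sets (distr M PC c)"
    then have [measurable]: "E \<in> sets (PA \<Otimes>\<^sub>M PB)" "F \<in> sets PC" by auto
    have "emeasure (distr M ((PA \<Otimes>\<^sub>M PB) \<Otimes>\<^sub>M PC) (\<lambda>\<omega>. ((a \<omega>, b \<omega>), c \<omega>))) (E \<times> F) =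
        (\<integral>\<^sup>+\<omega>. indicator E (a \<omega>, b \<omega>) * indicator F (c \<omega>) \<partial>M)"
    proof -
      have "(\<lambda>\<omega>. ((a \<omega>, b \<omega>), c \<omega>)) -` (E \<times> F) \<inter> space M \<in> events" by measurable
      then have "emeasure (distr M ((PA \<Otimes>\<^sub>M PB) \<Otimes>\<^sub>M PC) (\<lambda>\<omega>. ((a \<omega>, b \<omega>), c \<omega>))) (E \<times> F) =
          (\<integral>\<^sup>+\<omega>. indicator ((\<lambda>\<omega>. ((a \<omega>, b \<omega>), c \<omega>)) -` (E \<times> F) \<inter> space M) \<omega> \<partial>M)"
        by (simp add: emeasure_distr)
      also have "\<dots> = (\<integral>\<^sup>+\<omega>. indicator E (a \<omega>, b \<omega>) * indicator F (c \<omega>) \<partial>M)"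
        by (intro nn_integral_cong) (auto simp: indicator_def)
      finally show ?thesis .
    qed
    also have "\<dots> = (\<integral>\<^sup>+z. indicator E (fst z, fst (snd z)) * indicator F (snd (snd z))
        \<partial>distr M (PA \<Otimes>\<^sub>M (PB \<Otimes>\<^sub>M PC)) (\<lambda>\<omega>. (a \<omega>, b \<omega>, c \<omega>)))"
      by (simp add: nn_integral_distr)
    also have "\<dots> = (\<integral>\<^sup>+x. \<integral>\<^sup>+z. indicator E (x, fst z) * indicator F (snd z) \<partial>(distr M PB b \<Otimes>\<^sub>M distr M PC c) \<partial>distr M PA a)"
      unfolding Dabc by (subst BC.P.nn_integral_fst[symmetric]) auto
    also have "\<dots> = (\<integral>\<^sup>+x. \<integral>\<^sup>+y. indicator E (x, y) * emeasure (distr M PC c) F \<partial>distr M PB b \<partial>distr M PA a)"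
    proof (rule nn_integral_cong)
      fix x assume x: "x \<in> space (distr M PA a)"
      then have [measurable]: "(\<lambda>z. indicator E (x, fst z) :: ennreal) \<in> borel_measurable (PB \<Otimes>\<^sub>M PC)"
        by simp
      have "(\<integral>\<^sup>+z. indicator E (x, fst z) * indicator F (snd z) \<partial>(distr M PB b \<Otimes>\<^sub>M distr M PC c)) =
          (\<integral>\<^sup>+y. \<integral>\<^sup>+z. indicator E (x, y) * indicator F z \<partial>distr M PC c \<partial>distr M PB b)"
        by (subst C.nn_integral_fst[symmetric]) auto
      also have "\<dots> = (\<integral>\<^sup>+y. indicator E (x, y) * emeasure (distr M PC c) F \<partial>distr M PB b)"
        by (simp add: nn_integral_cmult)
      finally show "(\<integral>\<^sup>+z. indicator E (x, fst z) * indicator F (snd z) \<partial>(distr M PB b \<Otimes>\<^sub>M distr M PC c)) =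
          (\<integral>\<^sup>+y. indicator E (x, y) * emeasure (distr M PC c) F \<partial>distr M PB b)" .
    qed
    also have "\<dots> = (\<integral>\<^sup>+z. indicator E z * emeasure (distr M PC c) F \<partial>?AB)"
      unfolding Dab by (subst B.nn_integral_fst) auto
    also have "\<dots> = emeasure ?AB E * emeasure (distr M PC c) F"
      by (simp add: nn_integral_multc)
    finally show "emeasure ?AB E * emeasure (distr M PC c) F =
        emeasure (distr M ((PA \<Otimes>\<^sub>M PB) \<Otimes>\<^sub>M PC) (\<lambda>\<omega>. ((a \<omega>, b \<omega>), c \<omega>))) (E \<times> F)" by simp
  qed (auto intro: AB.sigma_finite_measure_axioms C.sigma_finite_measure_axioms)
  then show ?thesis by (simp add: independent_rvs_iff_distr)
qed

text \<open>Events determined by \<open>V\<close> are events determined by \<open>H\<close>.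
  Measurability for the generated sigma-algebra thus replaces an explicit formula of
  \<open>V\<close> in terms of \<open>H\<close>.\<close>

lemma (in prob_space) independent_rvs_vimage_algebra:
  assumes ind: "independent_rvs M P X Q H"
    and V: "V \<in> measurable (vimage_algebra (space M) H Q) N"
  shows "independent_rvs M P X N V"
proof -
  have H[measurable]: "H \<in> measurable M Q" using ind by (simp add: independent_rvs_def)
  have H': "H \<in> space M \<rightarrow> space Q" using measurable_space[OF H] by auto
  have pre: "V -` S \<inter> space M \<in> {H -` T \<inter> space M |T. T \<in> sets Q}" if "S \<in> sets N" for S
    using measurable_sets[OF V that] by (auto simp: sets_vimage_algebra2[OF H'])
  have sub: "{H -` T \<inter> space M |T. T \<in> sets Q} \<subseteq> events" by auto
  have VM: "V \<in> measurable M N"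
  proof (rule measurableI)
    show "V x \<in> space N" if "x \<in> space M" for x using measurable_space[OF V] that by simp
    show "V -` S \<inter> space M \<in> events" if "S \<in> sets N" for S using pre[OF that] sub by auto
  qed
  from ind have i: "indep_set {X -` S \<inter> space M |S. S \<in> sets P} {H -` S \<inter> space M |S. S \<in> sets Q}"
    by (simp add: independent_rvs_def)
  have "indep_set {X -` S \<inter> space M |S. S \<in> sets P} {V -` S \<inter> space M |S. S \<in> sets N}"
  proof (rule indep_setI)
    fix x v assume x: "x \<in> {X -` S \<inter> space M |S. S \<in> sets P}" and v: "v \<in> {V -` S \<inter> space M |S. S \<in> sets N}"
    have "v \<in> {H -` S \<inter> space M |S. S \<in> sets Q}" using v pre by auto
    with x show "prob (x \<inter> v) = prob x * prob v" by (rule indep_setD[OF i])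
  qed (use VM indep_setD_ev1[OF i] in auto)
  then show ?thesis using VM ind by (simp add: independent_rvs_def)
qed

text \<open>Regroups the independence assumptions twice: first \<open>W t\<close> is separated from
  \<open>X0\<close> and the earlier plant noise, then the channel noises, abbreviated
  \<open>ZV\<close>, are added to that side.\<close>

lemma (in prob_space) independent_rvs_plant_noise:
  fixes W :: "nat \<Rightarrow> 'a \<Rightarrow> 'b::topological_space"
  assumes W: "indep_vars (\<lambda>_. borel) W UNIV"
    and X0_W: "independent_rvs M P X0 (seg_space UNIV) (seg UNIV W)"
    and ZV: "independent_rvs M (P \<Otimes>\<^sub>M seg_space UNIV) (\<lambda>\<omega>. (X0 \<omega>, seg UNIV W \<omega>)) Q ZV"
  shows "independent_rvs M borel (W t) (Q \<Otimes>\<^sub>M (P \<Otimes>\<^sub>M seg_space {..<t})) (\<lambda>\<omega>. (ZV \<omega>, X0 \<omega>, seg {..<t} W \<omega>))"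
proof -
  have r[measurable]: "(\<lambda>w. restrict w {..<t}) \<in> measurable (seg_space UNIV) (seg_space {..<t} :: (nat \<Rightarrow> 'b) measure)"
    by (rule measurable_restrict_subset) simp
  have seg: "restrict (seg UNIV W \<omega>) {..<t} = seg {..<t} W \<omega>" "seg UNIV W \<omega> t = W t \<omega>" for \<omega>
    by (auto simp: seg_def)
  have seg_restrict: "(\<lambda>\<omega>. restrict (\<lambda>i. W i \<omega>) I) = seg I W" for I
    by (simp add: seg_def fun_eq_iff)
  have "indep_var (PiM {..<t} (\<lambda>_. borel)) (\<lambda>\<omega>. restrict (\<lambda>i. W i \<omega>) {..<t})
      (PiM {t} (\<lambda>_. borel)) (\<lambda>\<omega>. restrict (\<lambda>i. W i \<omega>) {t})"
    by (rule indep_var_restrict[OF W]) auto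
  then have "independent_rvs M (seg_space {..<t}) (seg {..<t} W) (seg_space {t}) (seg {t} W)"
    unfolding indep_var_eq independent_rvs_def seg_restrict indep_set_def
    by (auto elim!: indep_sets_mono_sets intro: sigma_sets.Basic split: bool.split)
  from independent_rvs_compose[OF this measurable_ident measurable_component_singleton[of t]]
  have bc: "independent_rvs M (seg_space {..<t}) (seg {..<t} W) borel (W t)"
    by (simp add: seg_def[of "{t}"])
  have abc: "independent_rvs M P X0 (seg_space {..<t} \<Otimes>\<^sub>M borel) (\<lambda>\<omega>. (seg {..<t} W \<omega>, W t \<omega>))"
    using independent_rvs_compose[OF X0_W measurable_ident, of "\<lambda>w. (restrict w {..<t}, w t)" "seg_space {..<t} \<Otimes>\<^sub>M borel"]
    by (simp add: seg)
  have ab_c: "independent_rvs M (P \<Otimes>\<^sub>M seg_space {..<t}) (\<lambda>\<omega>. (X0 \<omega>, seg {..<t} W \<omega>)) borel (W t)"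
    by (rule independent_rvs_assoc[OF bc abc])
  have "independent_rvs M ((P \<Otimes>\<^sub>M seg_space {..<t}) \<Otimes>\<^sub>M borel) (\<lambda>\<omega>. ((X0 \<omega>, seg {..<t} W \<omega>), W t \<omega>)) Q ZV"
    using independent_rvs_compose[OF ZV, of "\<lambda>(x, w). ((x, restrict w {..<t}), w t)"
      "(P \<Otimes>\<^sub>M seg_space {..<t}) \<Otimes>\<^sub>M borel" "\<lambda>x. x" Q]
    by (simp add: seg)
  from independent_rvs_assoc[OF ab_c independent_rvs_sym[OF this]]
  show ?thesis by (rule independent_rvs_sym)
qed


section \<open>Relay networks\<close>

text \<open>The bound obtained is \<open>- h(X)\<close>, attained at the density itself; it is the
  starting value of the recursion.\<close>

lemma (in prob_space) finite_diff_entropy_rel_entropy_le: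
  assumes "finite_diff_entropy M X"
  obtains a where "rel_entropy_le M lborel X a"
proof -
  interpret information_space M 2 by unfold_locales simp
  obtain p where p: "finite_entropy lborel X p"
    using assms by (auto simp: finite_diff_entropy_def)
  then have D: "distributed M lborel X (\<lambda>x. ennreal (p x))" and p0: "\<And>x. 0 \<le> p x"
    and int: "integrable lborel (\<lambda>x. p x * log 2 (p x))"
    by (auto simp: finite_entropy_def)
  have X: "X \<in> measurable M lborel" using D by (rule distributed_measurable)
  have pm[measurable]: "p \<in> borel_measurable lborel"
    using D p0 by (intro distributed_real_measurable) auto
  have distr: "distr M lborel X = density lborel p"
    using D by (simp add: distributed_def)
  have int': "integrable M (\<lambda>\<omega>. log 2 (p (X \<omega>)))"
    using distributed_integrable[OF D, of "\<lambda>x. log 2 (p x)"] int p0 by simp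
  have "AE x in distr M lborel X. 0 < p x"
    unfolding distr by (subst AE_density) (auto simp: less_le p0)
  then have pos: "AE \<omega> in M. 0 < p (X \<omega>)"
    using X by (subst (asm) AE_distr_iff) auto
  show ?thesis
    by (rule that, rule rel_entropy_le_density[OF X pm distr int' pos])
qed

text \<open>Before time 0 nothing has been observed. The law of a constant is a point mass, so only
  the section of a test density at \<open>s\<close> counts.\<close>

lemma (in prob_space) rel_entropy_le_const_observation:
  assumes X[measurable]: "X \<in> measurable M N0" and N0: "sigma_finite_measure N0"
    and s: "s \<in> space P" "\<And>\<omega>. S \<omega> = s" and le: "rel_entropy_le M N0 X a"
  shows "rel_entropy_le M (N0 \<Otimes>\<^sub>M distr M P S) (\<lambda>\<omega>. (X \<omega>, S \<omega>)) a"
  unfolding rel_entropy_le_def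
proof (intro ballI impI)
  have S: "S = (\<lambda>_. s)" using s by auto
  then have [measurable]: "S \<in> measurable M P" using s by simp
  interpret D: prob_space "distr M P S" by (rule prob_space_distr) fact
  interpret A: pair_sigma_finite N0 "distr M P S"
    using N0 by (simp add: pair_sigma_finite_def D.sigma_finite_measure_axioms)
  fix r :: "_ \<Rightarrow> real"
  assume "r \<in> borel_measurable (N0 \<Otimes>\<^sub>M distr M P S)" and r0: "\<forall>z. 0 \<le> r z" 
    and r1: "(\<integral>\<^sup>+z. ennreal (r z) \<partial>(N0 \<Otimes>\<^sub>M distr M P S)) \<le> 1"
    and r_pos: "AE \<omega> in M. 0 < r (X \<omega>, S \<omega>)"
    and r_int: "integrable M (\<lambda>\<omega>. log 2 (r (X \<omega>, S \<omega>)))"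
  then have [measurable]: "r \<in> borel_measurable (N0 \<Otimes>\<^sub>M P)" by simp
  interpret N0: sigma_finite_measure N0 by fact
  have [measurable]: "(\<lambda>s. \<integral>\<^sup>+x. ennreal (r (x, s)) \<partial>N0) \<in> borel_measurable P" by measurable
  have "(\<integral>\<^sup>+z. ennreal (r z) \<partial>(N0 \<Otimes>\<^sub>M distr M P S)) = (\<integral>\<^sup>+s. \<integral>\<^sup>+x. ennreal (r (x, s)) \<partial>N0 \<partial>distr M P S)"
    by (subst A.nn_integral_snd) auto
  also have "\<dots> = (\<integral>\<^sup>+x. ennreal (r (x, s)) \<partial>N0)"
    by (subst nn_integral_distr) (simp_all add: S s emeasure_space_1)
  finally have 1: "(\<integral>\<^sup>+x. ennreal (r (x, s)) \<partial>N0) \<le> 1" using r1 by simp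
  have [measurable]: "(\<lambda>x. r (x, s)) \<in> borel_measurable N0" using s(1) by measurable
  show "(\<integral>\<omega>. log 2 (r (X \<omega>, S \<omega>)) \<partial>M) \<le> a"
    using rel_entropy_leD[OF le, of "\<lambda>x. r (x, s)"] 1 r0 r_pos r_int unfolding S by simp
qed

section \<open>The closed loop path by path, and its causality\<close>

lemma measurable_matrix_vector_mult[measurable]:
  fixes A :: "real^'n^'m"
  shows "(\<lambda>x. A *v x) \<in> borel_measurable borel"
  by (intro borel_measurable_continuous_onI continuous_intros)

lemma measurable_seg:
  "(\<And>s. s \<in> I \<Longrightarrow> X s \<in> borel_measurable G) \<Longrightarrow> seg I X \<in> measurable G (seg_space I)"
  unfolding seg_def[abs_def] by (rule measurable_restrict)

lemma uncontrolled_measurable: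
  "X0 \<in> borel_measurable G \<Longrightarrow> (\<And>s. s < t \<Longrightarrow> W s \<in> borel_measurable G) \<Longrightarrow>
    uncontrolled A X0 W t \<in> borel_measurable G"
  by (induction t) auto

text \<open>The part of the state that is caused by the controls, as a function of the channel outputs.\<close>

primrec forced ::
    "real^'n^'n \<Rightarrow> real^'m^'n \<Rightarrow> (nat \<Rightarrow> (nat \<Rightarrow> 'y) \<Rightarrow> real^'m) \<Rightarrow> nat \<Rightarrow> (nat \<Rightarrow> 'y) \<Rightarrow> real^'n" where
  "forced A B \<pi> 0 = (\<lambda>y. 0)"
| "forced A B \<pi> (Suc t) = (\<lambda>y. A *v forced A B \<pi> t (restrict y {..<t}) + B *v \<pi> t (restrict y {..t}))"

lemma forced_measurable[measurable]:
  fixes \<pi> :: "nat \<Rightarrow> (nat \<Rightarrow> 'y::topological_space) \<Rightarrow> real^'m"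
  assumes \<pi>: "\<And>t. \<pi> t \<in> borel_measurable (seg_space {..t})"
  shows "forced A B \<pi> t \<in> borel_measurable (seg_space {..<t})"
proof (induction t)
  case (Suc t)
  have "(\<lambda>y. restrict y {..<t}) \<in> measurable (seg_space {..<Suc t}) (seg_space {..<t} :: (nat \<Rightarrow> 'y) measure)"
    "(\<lambda>y. restrict y {..t}) \<in> measurable (seg_space {..<Suc t}) (seg_space {..t} :: (nat \<Rightarrow> 'y) measure)"
    by (auto intro!: measurable_restrict_subset)
  note [measurable] = measurable_compose[OF this(1) Suc] measurable_compose[OF this(2) \<pi>]
  show ?case by simp
qed simp

text \<open>Collects the equations of the loop and the measurability of the policies, apart from the
  laws of the noises. Its measurability lemmas range over arbitrary sigma-algebras \<open>G\<close>
  on the same space, so one argument yields both measurability and causality.\<close>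

locale relay_network = prob_space M for M :: "'w measure" +
  fixes A :: "real^'n^'n" and B :: "real^'m^'n"
    and X :: "nat \<Rightarrow> 'w \<Rightarrow> real^'n" and U :: "nat \<Rightarrow> 'w \<Rightarrow> real^'m" and W :: "nat \<Rightarrow> 'w \<Rightarrow> real^'n"
    and Se :: "nat \<Rightarrow> 'w \<Rightarrow> real" and Sr :: "'k::finite \<Rightarrow> nat \<Rightarrow> 'w \<Rightarrow> real"
    and Y :: "'k \<Rightarrow> nat \<Rightarrow> 'w \<Rightarrow> real^'q" and R :: "nat \<Rightarrow> 'w \<Rightarrow> real^'r"
    and Z :: "'k \<Rightarrow> nat \<Rightarrow> 'w \<Rightarrow> real^'q" and V :: "nat \<Rightarrow> 'w \<Rightarrow> real^'r"
    and f :: "nat \<Rightarrow> (nat \<Rightarrow> real^'n) \<times> (nat \<Rightarrow> real^'m) \<Rightarrow> real"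
    and \<phi> :: "'k \<Rightarrow> nat \<Rightarrow> (nat \<Rightarrow> real^'q) \<Rightarrow> real"
    and \<pi> :: "nat \<Rightarrow> (nat \<Rightarrow> real^'r) \<Rightarrow> real^'m"
    and D :: "nat \<Rightarrow> 'k set"
    and hs :: "nat \<Rightarrow> 'k \<Rightarrow> real^'q" and hr :: "nat \<Rightarrow> 'k \<Rightarrow> 'k \<Rightarrow> real^'q"
    and gs :: "nat \<Rightarrow> real^'r" and gr :: "nat \<Rightarrow> 'k \<Rightarrow> real^'r"
  assumes plant: "\<And>t \<omega>. \<omega> \<in> space M \<Longrightarrow> X (Suc t) \<omega> = A *v X t \<omega> + B *v U t \<omega> + W t \<omega>"
    and f_meas: "\<And>t. f t \<in> borel_measurable (seg_space {..t} \<Otimes>\<^sub>M seg_space {..<t})"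
    and encoder: "\<And>t \<omega>. \<omega> \<in> space M \<Longrightarrow> Se t \<omega> = f t (seg {..t} X \<omega>, seg {..<t} U \<omega>)"
    and \<phi>_meas: "\<And>i t. \<phi> i t \<in> borel_measurable (seg_space (relay_window D i t))"
    and relays: "\<And>i t \<omega>. \<omega> \<in> space M \<Longrightarrow> Sr i t \<omega> = \<phi> i t (seg (relay_window D i t) (Y i) \<omega>)"
    and relay_channels: "\<And>i t \<omega>. \<omega> \<in> space M \<Longrightarrow>
      Y i t \<omega> = Se t \<omega> *\<^sub>R hs t i + (\<Sum>j\<in>UNIV. Sr j t \<omega> *\<^sub>R hr t i j) + Z i t \<omega>"
    and controller_channel: "\<And>t \<omega>. \<omega> \<in> space M \<Longrightarrow>
      R t \<omega> = Se t \<omega> *\<^sub>R gs t + (\<Sum>j\<in>UNIV. Sr j t \<omega> *\<^sub>R gr t j) + V t \<omega>"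
    and loop_free: "no_algebraic_loop D hr"
    and \<pi>_meas: "\<And>t. \<pi> t \<in> borel_measurable (seg_space {..t})"
    and controller: "\<And>t \<omega>. \<omega> \<in> space M \<Longrightarrow> U t \<omega> = \<pi> t (seg {..t} R \<omega>)"
begin

text \<open>Superposition in a linear system: the difference from the uncontrolled state is driven
  by the controls alone, hence known from the outputs before time \<open>t\<close>.\<close>

lemma X_eq_uncontrolled_plus_forced:
  assumes "\<omega> \<in> space M"
  shows "X t \<omega> = uncontrolled A (X 0) W t \<omega> + forced A B \<pi> t (seg {..<t} R \<omega>)"
proof (induction t)
  case (Suc t)
  have "restrict (seg {..<Suc t} R \<omega>) {..<t} = seg {..<t} R \<omega>"
    "restrict (seg {..<Suc t} R \<omega>) {..t} = seg {..t} R \<omega>"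
    by (auto simp: seg_def)
  then show ?case
    using assms Suc by (simp add: plant controller matrix_vector_right_distrib)
qed simp

text \<open>Resolves the simultaneous equations of one time step in causal order: the sensor and the
  delayed relays use available data, then the delay-free relays follow along the graph of nonzero
  gains, then the controller.\<close>

lemma measurable_step:
  assumes G: "space G = space M"
    and X_G: "\<And>s. s \<le> t \<Longrightarrow> X s \<in> borel_measurable G" and U_G: "\<And>s. s < t \<Longrightarrow> U s \<in> borel_measurable G"
    and R_G: "\<And>s. s < t \<Longrightarrow> R s \<in> borel_measurable G" and Y_G: "\<And>i s. s < t \<Longrightarrow> Y i s \<in> borel_measurable G"
    and Z_G[measurable]: "\<And>i. Z i t \<in> borel_measurable G" and V_G[measurable]: "V t \<in> borel_measurable G"
  shows "Y i t \<in> borel_measurable G" "R t \<in> borel_measurable G" "U t \<in> borel_measurable G"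
proof -
  have cong: "g \<in> borel_measurable G" if "g' \<in> borel_measurable G" "\<And>\<omega>. \<omega> \<in> space M \<Longrightarrow> g \<omega> = g' \<omega>" for g g' :: "'w \<Rightarrow> 'z::topological_space"
    using that G by (subst measurable_cong[of G g g']) auto
  have Se[measurable]: "Se t \<in> borel_measurable G"
  proof (rule cong[OF _ encoder])
    have [measurable]: "seg {..t} X \<in> measurable G (seg_space {..t})" "seg {..<t} U \<in> measurable G (seg_space {..<t})"
      using X_G U_G by (auto intro!: measurable_seg)
    show "(\<lambda>\<omega>. f t (seg {..t} X \<omega>, seg {..<t} U \<omega>)) \<in> borel_measurable G"
      by (rule measurable_compose[OF _ f_meas]) measurable
  qed
  have Y_from_Sr: "Y i t \<in> borel_measurable G"
    if "\<And>j. hr t i j \<noteq> 0 \<Longrightarrow> Sr j t \<in> borel_measurable G" for i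
  proof (rule cong[OF _ relay_channels])
    \<comment> \<open>With zero gain the summand is constantly 0, whatever is known so far about
      relay \<open>j\<close>.\<close>
    have [measurable]: "(\<lambda>\<omega>. Sr j t \<omega> *\<^sub>R hr t i j) \<in> borel_measurable G" for j
      using that[of j] by (cases "hr t i j = 0") auto
    show "(\<lambda>\<omega>. Se t \<omega> *\<^sub>R hs t i + (\<Sum>j\<in>UNIV. Sr j t \<omega> *\<^sub>R hr t i j) + Z i t \<omega>) \<in> borel_measurable G"
      by measurable
  qed
  have delayed: "Sr j t \<in> borel_measurable G" if "j \<notin> D t" for j
    using that Y_G by (intro cong[OF _ relays] measurable_compose[OF _ \<phi>_meas] measurable_seg)
      (auto simp: relay_window_def)
  have Sr_Y: "Sr j t \<in> borel_measurable G" if "Y j t \<in> borel_measurable G" for j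
    using that Y_G by (intro cong[OF _ relays] measurable_compose[OF _ \<phi>_meas] measurable_seg)
      (auto simp: relay_window_def le_less split: if_splits)
  let ?r = "{(j, i). j \<in> D t \<and> i \<in> D t \<and> hr t i j \<noteq> 0}"
  \<comment> \<open>Finite and acyclic, hence well-founded: a delay-free relay is treated after all
    delay-free relays that it hears.\<close>
  have "wf ?r"
    using loop_free by (intro finite_acyclic_wf) (auto simp: no_algebraic_loop_def)
  then have immediate: "i \<in> D t \<longrightarrow> Sr i t \<in> borel_measurable G" for i
  proof (induction i rule: wf_induct_rule)
    case (less i)
    show ?case
    proof
      assume i: "i \<in> D t"
      show "Sr i t \<in> borel_measurable G"
      proof (rule Sr_Y, rule Y_from_Sr)
        fix j assume "hr t i j \<noteq> 0"
        then show "Sr j t \<in> borel_measurable G"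
          using less[of j] i delayed[of j] by (cases "j \<in> D t") auto
      qed
    qed
  qed
  then have Sr[measurable]: "Sr j t \<in> borel_measurable G" for j
    using delayed[of j] by blast
  then show "Y i t \<in> borel_measurable G" by (intro Y_from_Sr)
  have "(\<lambda>\<omega>. Se t \<omega> *\<^sub>R gs t + (\<Sum>j\<in>UNIV. Sr j t \<omega> *\<^sub>R gr t j) + V t \<omega>) \<in> borel_measurable G"
    by measurable
  then show Rt: "R t \<in> borel_measurable G" by (rule cong[OF _ controller_channel])
  have "seg {..t} R \<in> measurable G (seg_space {..t})"
    using R_G Rt by (intro measurable_seg) (auto simp: le_less)
  then show "U t \<in> borel_measurable G"
    by (intro cong[OF _ controller] measurable_compose[OF _ \<pi>_meas])
qed

text \<open>Plant noise before time \<open>t\<close> determines even \<open>R t\<close>, because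
  \<open>W t\<close> first acts on \<open>X (Suc t)\<close>. This strict inequality is what makes
  the noise step of the recursion possible.\<close>

lemma measurable_upto:
  assumes G: "space G = space M" and X0: "X 0 \<in> borel_measurable G"
    and Z: "\<And>i s. Z i s \<in> borel_measurable G" and V: "\<And>s. V s \<in> borel_measurable G"
    and W: "\<And>s. s < t \<Longrightarrow> W s \<in> borel_measurable G"
  shows "s \<le> t \<Longrightarrow> X s \<in> borel_measurable G" "s \<le> t \<Longrightarrow> R s \<in> borel_measurable G"
proof -
  \<comment> \<open>The state is known one step ahead of the signals, hence the ranges
    \<open>s' \<le> s\<close> and \<open>s' < s\<close>.\<close>
  have main: "(\<forall>s'\<le>s. X s' \<in> borel_measurable G) \<and>
      (\<forall>s'<s. U s' \<in> borel_measurable G \<and> R s' \<in> borel_measurable G \<and> (\<forall>i. Y i s' \<in> borel_measurable G))"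
    if "s \<le> t" for s
    using that
  proof (induction s)
    case 0
    then show ?case using X0 by simp
  next
    case (Suc s)
    then have IH: "\<And>s'. s' \<le> s \<Longrightarrow> X s' \<in> borel_measurable G"
      "\<And>s'. s' < s \<Longrightarrow> U s' \<in> borel_measurable G" "\<And>s'. s' < s \<Longrightarrow> R s' \<in> borel_measurable G"
      "\<And>i s'. s' < s \<Longrightarrow> Y i s' \<in> borel_measurable G" by auto
    note new = measurable_step[OF G IH Z V]
    have "s < t" using Suc by simp
    note [measurable] = IH(1)[OF order_refl] new(3) W[OF this]
    have "(\<lambda>\<omega>. A *v X s \<omega> + B *v U s \<omega> + W s \<omega>) \<in> borel_measurable G"
      by measurable
    then have "X (Suc s) \<in> borel_measurable G"
      using G by (subst measurable_cong[of G _ "\<lambda>\<omega>. A *v X s \<omega> + B *v U s \<omega> + W s \<omega>"]) (auto simp: plant)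
    then show ?case using IH new by (auto simp: le_Suc_eq less_Suc_eq)
  qed
  show "X s \<in> borel_measurable G" if "s \<le> t" using main[OF that] by simp
  show "R s \<in> borel_measurable G" if "s \<le> t"
    by (rule measurable_step(2)[OF G _ _ _ _ Z V]) (use main[OF that] in auto)
qed

end

section \<open>The entropy recursion and the information rate\<close>

lemma log_std_gauss_integrable:
  fixes X :: "'w \<Rightarrow> 'a::euclidean_space"
  assumes "prob_space M" "integrable M (\<lambda>\<omega>. (norm (X \<omega>))\<^sup>2)"
  shows "integrable M (\<lambda>\<omega>. log 2 (std_gauss (X \<omega>)))"
  unfolding log_std_gauss using assms
  by (auto intro!: Bochner_Integration.integrable_diff simp: prob_space_def finite_measure.integrable_const)

lemma conditional_mutual_information_le_cond_mutual_info:
  fixes f :: "'x \<Rightarrow> nat" and g :: "'y \<Rightarrow> nat"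
  assumes "simple_function MX f" "simple_function MY g" "cond_mutual_info b M MX MY MZ X Y Z \<le> ereal \<iota>"
  shows "prob_space.conditional_mutual_information M b (count_space UNIV) (count_space UNIV) MZ
    (\<lambda>\<omega>. f (X \<omega>)) (\<lambda>\<omega>. g (Y \<omega>)) Z \<le> \<iota>"
proof -
  have "ereal (prob_space.conditional_mutual_information M b (count_space UNIV) (count_space UNIV) MZ
      (\<lambda>\<omega>. f (X \<omega>)) (\<lambda>\<omega>. g (Y \<omega>)) Z) \<le> cond_mutual_info b M MX MY MZ X Y Z"
    unfolding cond_mutual_info_def by (rule SUP_upper2[of "(f, g)"]) (use assms in auto)
  also note assms(3)
  finally show ?thesis by simp
qed

text \<open>Constant quantizers already contribute a real number to the supremum; a term other than
  \<infinity> is therefore real.\<close>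

lemma cond_mutual_info_neq_MInf: "cond_mutual_info b M MX MY MZ X Y Z \<noteq> -\<infinity>"
proof -
  have "ereal (prob_space.conditional_mutual_information M b (count_space UNIV) (count_space UNIV) MZ
      (\<lambda>\<omega>. 0 :: nat) (\<lambda>\<omega>. 0 :: nat) Z) \<le> cond_mutual_info b M MX MY MZ X Y Z"
    unfolding cond_mutual_info_def by (rule SUP_upper2[of "(\<lambda>_. 0, \<lambda>_. 0)"]) auto
  then show ?thesis by auto
qed

text \<open>A singular \<open>A\<close> has a real kernel vector, which read as a complex vector is
  an eigenvector for 0.\<close>

lemma det_neq_0_if_eigenvalues:
  fixes A :: "real^'n^'n"
  assumes "\<And>\<mu>. eigenvalue A \<mu> \<Longrightarrow> 1 \<le> cmod \<mu>"
  shows "det A \<noteq> 0"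
proof
  assume "det A = 0"
  then have "\<not> inj ((*v) A)" by (simp add: det_nz_iff_inj[symmetric])
  then obtain v where v: "A *v v = 0" "v \<noteq> 0"
    using linear_injective_0[OF matrix_vector_mul_linear[of A]] by auto
  define u :: "complex^'n" where "u = (\<chi> i. complex_of_real (v $ i))"
  have "u \<noteq> 0" using v(2) by (auto simp: u_def vec_eq_iff)
  moreover have "map_matrix complex_of_real A *v u = 0 *s u"
  proof (rule vec_eq_iff[THEN iffD2], rule allI)
    fix i
    have "(map_matrix complex_of_real A *v u) $ i = complex_of_real ((A *v v) $ i)"
      by (simp add: matrix_vector_mult_def u_def map_matrix_def)
    then show "(map_matrix complex_of_real A *v u) $ i = (0 *s u) $ i"
      by (simp add: v(1))
  qed
  ultimately have "eigenvalue A 0" unfolding eigenvalue_def by blast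
  from assms[OF this] show False by simp
qed

locale noisy_relay_network = relay_network M A B X U W Se Sr Y R Z V f \<phi> \<pi> D hs hr gs gr
  for M :: "'w measure" and A :: "real^'n^'n" and B :: "real^'m^'n"
    and X :: "nat \<Rightarrow> 'w \<Rightarrow> real^'n" and U W Se and Sr :: "'k::finite \<Rightarrow> nat \<Rightarrow> 'w \<Rightarrow> real"
    and Y :: "'k \<Rightarrow> nat \<Rightarrow> 'w \<Rightarrow> real^'q" and R :: "nat \<Rightarrow> 'w \<Rightarrow> real^'r"
    and Z V f \<phi> \<pi> D hs hr gs gr +
  fixes K_W :: "real^'n^'n"
  assumes X0_meas: "X 0 \<in> borel_measurable M"
    and X0_square: "integrable M (\<lambda>\<omega>. (norm (X 0 \<omega>))\<^sup>2)"
    and W_white: "white_gaussian M W K_W"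
    and Z_meas: "\<And>i t. Z i t \<in> borel_measurable M"
    and V_meas: "\<And>t. V t \<in> borel_measurable M"
    and W_indep: "independent_rvs M borel (X 0) (seg_space UNIV) (seg UNIV W)"
    and channel_indep: "independent_rvs M
      (borel \<Otimes>\<^sub>M seg_space UNIV) (\<lambda>\<omega>. (X 0 \<omega>, seg UNIV W \<omega>))
      (PiM UNIV (\<lambda>_. seg_space UNIV) \<Otimes>\<^sub>M seg_space UNIV) (\<lambda>\<omega>. (\<lambda>i. seg UNIV (Z i) \<omega>, seg UNIV V \<omega>))"
    and det: "det A \<noteq> 0"
begin

abbreviation "Xb \<equiv> uncontrolled A (X 0) W"

lemma W_meas: "W t \<in> borel_measurable M"
  using W_white by (simp add: white_gaussian_def gaussian_vector_def)

lemma X_meas: "X t \<in> borel_measurable M" and R_meas: "R t \<in> borel_measurable M"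
  using measurable_upto[of M t t] X0_meas Z_meas V_meas W_meas by auto

lemma Xb_meas: "Xb t \<in> borel_measurable M"
  using X0_meas W_meas by (rule uncontrolled_measurable)

text \<open>Makes the standard Gaussian an admissible reference density at every time. The moment
  may grow with \<open>t\<close>, since the reference leaves no trace in the bound.\<close>

lemma Xb_square: "integrable M (\<lambda>\<omega>. (norm (Xb t \<omega>))\<^sup>2)"
proof (induction t)
  case (Suc t)
  have "integrable M (\<lambda>\<omega>. (norm (W t \<omega>))\<^sup>2)"
    using W_white by (intro gaussian_vector_square_integrable[where K=K_W] prob_space_axioms) (simp add: white_gaussian_def)
  from square_integrable_affine[OF Xb_meas W_meas Suc this, of A] show ?case by simp
qed (simp add: X0_square)

text \<open>The sigma-algebra \<open>G\<close> is generated by \<open>X 0\<close>, all channel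
  noises and the plant noise before time \<open>t\<close>. By causality it contains the outputs up
  to time \<open>t\<close> and the uncontrolled state at \<open>t\<close>, and \<open>W t\<close> is
  independent of it.\<close>

lemma plant_noise_indep:
  "independent_rvs M borel (W t) (borel \<Otimes>\<^sub>M seg_space {..<Suc t}) (\<lambda>\<omega>. (A *v Xb t \<omega>, seg {..<Suc t} R \<omega>))"
proof -
  let ?Q = "(PiM UNIV (\<lambda>_::'k. seg_space UNIV) \<Otimes>\<^sub>M seg_space UNIV) \<Otimes>\<^sub>M (borel \<Otimes>\<^sub>M seg_space {..<t})"
  let ?H = "\<lambda>\<omega>. ((\<lambda>i. seg UNIV (Z i) \<omega>, seg UNIV V \<omega>), X 0 \<omega>, seg {..<t} W \<omega>)"
  define G where "G = vimage_algebra (space M) ?H ?Q"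
  have ind: "independent_rvs M borel (W t) ?Q ?H"
    using W_white W_indep channel_indep by (intro independent_rvs_plant_noise) (auto simp: white_gaussian_def)
  then have "?H \<in> measurable M ?Q" by (simp add: independent_rvs_def)
  then have H[measurable]: "?H \<in> measurable G ?Q"
    unfolding G_def by (intro measurable_vimage_algebra1) (auto dest: measurable_space)
  have G: "space G = space M" by (simp add: G_def)
  have HZ: "(\<lambda>z. fst (fst z) i s) \<in> borel_measurable ?Q" for i s
  proof -
    have 1: "(\<lambda>z. fst (fst z)) \<in> measurable ?Q (PiM UNIV (\<lambda>_::'k. seg_space UNIV))" by measurable
    have 2: "(\<lambda>z. fst (fst z) i) \<in> measurable ?Q (seg_space UNIV)"
      by (rule measurable_compose[OF 1 measurable_component_singleton]) simp
    show ?thesis by (rule measurable_compose[OF 2 measurable_component_singleton]) simp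
  qed
  have HV: "(\<lambda>z. snd (fst z) s) \<in> borel_measurable ?Q" for s
  proof -
    have 1: "(\<lambda>z. snd (fst z)) \<in> measurable ?Q (seg_space UNIV)" by measurable
    show ?thesis by (rule measurable_compose[OF 1 measurable_component_singleton]) simp
  qed
  have HW: "(\<lambda>z. snd (snd z) s) \<in> borel_measurable ?Q" if "s < t" for s
  proof -
    have 1: "(\<lambda>z. snd (snd z)) \<in> measurable ?Q (seg_space {..<t})" by measurable
    show ?thesis by (rule measurable_compose[OF 1 measurable_component_singleton]) (use that in simp)
  qed
  have X0_G: "X 0 \<in> borel_measurable G"
    using measurable_compose[OF H, of "\<lambda>z. fst (snd z)" borel] by simp
  have Z_G: "Z i s \<in> borel_measurable G" for i s
    using measurable_compose[OF H HZ[of i s]] by (simp add: seg_def)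
  have V_G: "V s \<in> borel_measurable G" for s
    using measurable_compose[OF H HV[of s]] by (simp add: seg_def)
  have W_G: "W s \<in> borel_measurable G" if "s < t" for s
    using measurable_compose[OF H HW[OF that]] that by (simp add: seg_def)
  have [measurable]: "seg {..<Suc t} R \<in> measurable G (seg_space {..<Suc t})"
    by (intro measurable_seg measurable_upto(2)[OF G X0_G Z_G V_G W_G, of t]) auto
  have [measurable]: "Xb t \<in> borel_measurable G"
    by (rule uncontrolled_measurable[OF X0_G W_G])
  have "(\<lambda>\<omega>. (A *v Xb t \<omega>, seg {..<Suc t} R \<omega>)) \<in> measurable G (borel \<Otimes>\<^sub>M seg_space {..<Suc t})"
    by measurable
  then show ?thesis
    unfolding G_def by (rule independent_rvs_vimage_algebra[OF ind])
qed

text \<open>Three moves: observing \<open>R t\<close> costs \<iota>, the affine map with a frozen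
  noise value gains \<open>log 2 \<bar>det A\<bar>\<close>, and averaging over the independent noise
  is free.\<close>

lemma rel_entropy_le_uncontrolled_step:
  assumes cmi: "cond_mutual_info 2 M (seg_space {..t}) borel (seg_space {..<t})
      (seg {..t} Xb) (R t) (seg {..<t} R) \<le> ereal \<iota>"
    and le: "rel_entropy_le M (lborel \<Otimes>\<^sub>M distr M (seg_space {..<t}) (seg {..<t} R))
      (\<lambda>\<omega>. (Xb t \<omega>, seg {..<t} R \<omega>)) \<alpha>"
  shows "rel_entropy_le M (lborel \<Otimes>\<^sub>M distr M (seg_space {..<Suc t}) (seg {..<Suc t} R))
      (\<lambda>\<omega>. (Xb (Suc t) \<omega>, seg {..<Suc t} R \<omega>)) (\<alpha> + \<iota> - log 2 \<bar>det A\<bar>)"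
proof -
  note [measurable] = Xb_meas R_meas W_meas
  have seg_R[measurable]: "seg {..<s} R \<in> measurable M (seg_space {..<s})" for s
    by (intro measurable_seg R_meas)
  have Xb_lb[measurable]: "Xb t \<in> measurable M lborel" by simp
  have obs: "rel_entropy_le M (lborel \<Otimes>\<^sub>M distr M (borel \<Otimes>\<^sub>M seg_space {..<t}) (\<lambda>\<omega>. (R t \<omega>, seg {..<t} R \<omega>)))
      (\<lambda>\<omega>. (Xb t \<omega>, R t \<omega>, seg {..<t} R \<omega>)) (\<alpha> + \<iota>)"
  proof (rule rel_entropy_le_observe[OF Xb_lb R_meas seg_R sigma_finite_lborel _ std_gauss_pos _ _ le])
    show "integrable M (\<lambda>\<omega>. log 2 (std_gauss (Xb t \<omega>)))"
      by (rule log_std_gauss_integrable[OF prob_space_axioms Xb_square])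
    fix f :: "real^'n \<Rightarrow> nat" and g :: "real^'r \<Rightarrow> nat"
    assume f: "simple_function lborel f" and g: "simple_function borel g"
    \<comment> \<open>A quantizer of the current state is also one of the whole path up to
      \<open>t\<close>, so the information of the path bounds that of its last value.\<close>
    have "simple_function (seg_space {..t}) (\<lambda>x. f (x t))"
      by (rule simple_function_comp[OF _ f]) simp
    from conditional_mutual_information_le_cond_mutual_info[OF this g cmi]
    show "conditional_mutual_information 2 (count_space UNIV) (count_space UNIV) (seg_space {..<t})
        (\<lambda>\<omega>. f (Xb t \<omega>)) (\<lambda>\<omega>. g (R t \<omega>)) (seg {..<t} R) \<le> \<iota>"
      by (simp add: seg_def[of "{..t}"])
  qed (simp_all add: nn_integral_std_gauss)
  let ?N = "lborel \<Otimes>\<^sub>M distr M (seg_space {..<Suc t}) (seg {..<Suc t} R)"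
  \<comment> \<open>Appends the new output to the past: the pair \<open>(R t, R before t)\<close>
    becomes the segment up to time \<open>t\<close>.\<close>
  define h where "h = (\<lambda>(y :: real^'r, s :: nat \<Rightarrow> real^'r). s(t := y))"
  have h_m[measurable]: "h \<in> measurable (borel \<Otimes>\<^sub>M seg_space {..<t}) (seg_space {..<Suc t})"
    unfolding h_def split_beta' by (rule measurable_fun_upd[where J="{..<t}"]) auto
  have h: "h (R t \<omega>, seg {..<t} R \<omega>) = seg {..<Suc t} R \<omega>" for \<omega>
    by (auto simp: h_def seg_def fun_eq_iff)
  have shift: "rel_entropy_le M ?N (\<lambda>\<omega>. (A *v Xb t \<omega> + w, seg {..<Suc t} R \<omega>)) (\<alpha> + \<iota> - log 2 \<bar>det A\<bar>)" for w
  proof -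
    have "rel_entropy_le M (lborel \<Otimes>\<^sub>M distr M (seg_space {..<Suc t}) (\<lambda>\<omega>. h (R t \<omega>, seg {..<t} R \<omega>)))
        (\<lambda>\<omega>. ((\<lambda>(x, _). A *v x + w) (Xb t \<omega>, R t \<omega>, seg {..<t} R \<omega>), h (R t \<omega>, seg {..<t} R \<omega>)))
        (\<alpha> + \<iota> - log 2 \<bar>det A\<bar>)"
    proof (rule rel_entropy_le_transform[OF Xb_lb _ _ h_m sigma_finite_lborel sigma_finite_lborel _ _ obs])
      show "(\<lambda>(x, _). A *v x + w) \<in> measurable (lborel \<Otimes>\<^sub>M ((borel :: (real^'r) measure) \<Otimes>\<^sub>M (seg_space {..<t} :: (nat \<Rightarrow> real^'r) measure))) lborel"
        unfolding split_beta' by simp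
      show "0 < \<bar>det A\<bar>" using det by simp
      fix s and g :: "real^'n \<Rightarrow> ennreal" assume "g \<in> borel_measurable lborel"
      then show "ennreal \<bar>det A\<bar> * (\<integral>\<^sup>+x. g (case (x, s) of (x, _) \<Rightarrow> A *v x + w) \<partial>lborel) = (\<integral>\<^sup>+y. g y \<partial>lborel)"
        using nn_integral_lborel_affine_matrix[OF det, of g w] by simp
    qed simp
    then show ?thesis unfolding h by simp
  qed
  have "rel_entropy_le M ?N (\<lambda>\<omega>. (\<lambda>(w, v, s). (v + w, s)) (W t \<omega>, (A *v Xb t \<omega>, seg {..<Suc t} R \<omega>)))
      (\<alpha> + \<iota> - log 2 \<bar>det A\<bar>)"
  proof (rule rel_entropy_le_mixture[where V="\<lambda>\<omega>. (A *v Xb t \<omega>, seg {..<Suc t} R \<omega>)"])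
    show "distr M (borel \<Otimes>\<^sub>M (borel \<Otimes>\<^sub>M seg_space {..<Suc t})) (\<lambda>\<omega>. (W t \<omega>, A *v Xb t \<omega>, seg {..<Suc t} R \<omega>)) =
        distr M borel (W t) \<Otimes>\<^sub>M distr M (borel \<Otimes>\<^sub>M seg_space {..<Suc t}) (\<lambda>\<omega>. (A *v Xb t \<omega>, seg {..<Suc t} R \<omega>))"
      using plant_noise_indep by (simp add: independent_rvs_iff_distr)
    show "rel_entropy_le M ?N (\<lambda>\<omega>. (\<lambda>(w, v, s). (v + w, s)) (w, (A *v Xb t \<omega>, seg {..<Suc t} R \<omega>)))
        (\<alpha> + \<iota> - log 2 \<bar>det A\<bar>)" for w
      using shift by simp
  qed measurable
  then show ?thesis by simp
qed

lemma rel_entropy_le_uncontrolled: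
  assumes cmi: "\<And>t. cond_mutual_info 2 M (seg_space {..t}) borel (seg_space {..<t})
      (seg {..t} Xb) (R t) (seg {..<t} R) \<le> ereal (\<iota> t)"
    and X0: "rel_entropy_le M lborel (X 0) \<alpha>"
  shows "rel_entropy_le M (lborel \<Otimes>\<^sub>M distr M (seg_space {..<T}) (seg {..<T} R))
      (\<lambda>\<omega>. (Xb T \<omega>, seg {..<T} R \<omega>)) (\<alpha> + (\<Sum>t<T. \<iota> t) - real T * log 2 \<bar>det A\<bar>)"
proof (induction T)
  case 0
  \<comment> \<open>The empty segment is the function that is \<open>undefined\<close> everywhere,
    the only point of its space.\<close>
  have "rel_entropy_le M (lborel \<Otimes>\<^sub>M distr M (seg_space {..<0}) (seg {..<0} R)) (\<lambda>\<omega>. (X 0 \<omega>, seg {..<0} R \<omega>)) \<alpha>"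
    by (rule rel_entropy_le_const_observation[OF _ sigma_finite_lborel _ _ X0, of "\<lambda>_. undefined"])
      (auto simp: X0_meas space_PiM seg_def)
  then show ?case by simp
next
  case (Suc T)
  from rel_entropy_le_uncontrolled_step[OF cmi Suc] show ?case by (simp add: algebra_simps)
qed

text \<open>The recursion is tested against one density at time \<open>T\<close>. Its expected
  logarithm is bounded below through the second moment of the controlled state, so the accumulated
  information must pay for \<open>T\<close> expansions by \<open>A\<close>.\<close>

lemma sum_information_ge:
  assumes cmi: "\<And>t. cond_mutual_info 2 M (seg_space {..t}) borel (seg_space {..<t})
      (seg {..t} Xb) (R t) (seg {..<t} R) \<le> ereal (\<iota> t)"
    and X0: "rel_entropy_le M lborel (X 0) \<alpha>"
    and C: "(\<integral>\<^sup>+\<omega>. ennreal ((norm (X T \<omega>))\<^sup>2) \<partial>M) < ennreal C"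
  shows "real T * log 2 \<bar>det A\<bar> + (real CARD('n) * log 2 (1 / sqrt (2 * pi)) - C / (2 * ln 2) - \<alpha>) \<le> (\<Sum>t<T. \<iota> t)"
proof -
  note [measurable] = Xb_meas R_meas X_meas
  let ?D = "distr M (seg_space {..<T}) (seg {..<T} R)"
  have seg_R[measurable]: "seg {..<T} R \<in> measurable M (seg_space {..<T})"
    by (intro measurable_seg R_meas)
  interpret D: prob_space ?D by (rule prob_space_distr) fact
  interpret P: pair_sigma_finite lborel ?D
    by (simp add: pair_sigma_finite_def D.sigma_finite_measure_axioms sigma_finite_lborel)
  note [measurable] = forced_measurable[OF \<pi>_meas, of A B T]
  \<comment> \<open>A Gaussian recentred by a function of \<open>s\<close>: every section keeps mass
    1, while along the trajectory the argument is the controlled state \<open>X T\<close>.\<close>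
  define r where "r = (\<lambda>(x, s). std_gauss (x + forced A B \<pi> T s))"
  have r_m[measurable]: "r \<in> borel_measurable (lborel \<Otimes>\<^sub>M seg_space {..<T})"
    unfolding r_def by measurable
  have "(\<integral>\<^sup>+x. ennreal (r (x, s)) \<partial>lborel) = 1" for s
  proof -
    have "(\<integral>\<^sup>+x. ennreal (r (x, s)) \<partial>lborel) = (\<integral>\<^sup>+x. ennreal (std_gauss x) \<partial>distr lborel borel ((+) (forced A B \<pi> T s)))"
      by (subst nn_integral_distr) (auto simp: r_def add.commute)
    then show ?thesis by (simp add: lborel_distr_plus nn_integral_std_gauss)
  qed
  moreover have "(\<integral>\<^sup>+z. ennreal (r z) \<partial>(lborel \<Otimes>\<^sub>M ?D)) = (\<integral>\<^sup>+s. \<integral>\<^sup>+x. ennreal (r (x, s)) \<partial>lborel \<partial>?D)"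
    by (subst P.nn_integral_snd) auto
  ultimately have r1: "(\<integral>\<^sup>+z. ennreal (r z) \<partial>(lborel \<Otimes>\<^sub>M ?D)) \<le> 1"
    using D.emeasure_space_1 by simp
  have X_int: "integrable M (\<lambda>\<omega>. (norm (X T \<omega>))\<^sup>2)"
    using C by (intro integrableI_bounded) (auto intro: order_less_trans)
  have r_X: "log 2 (r (Xb T \<omega>, seg {..<T} R \<omega>)) = log 2 (std_gauss (X T \<omega>))" if "\<omega> \<in> space M" for \<omega>
    using X_eq_uncontrolled_plus_forced[OF that, of T] by (simp add: r_def)
  have gauss_int: "integrable M (\<lambda>\<omega>. log 2 (std_gauss (X T \<omega>)))"
    by (rule log_std_gauss_integrable[OF prob_space_axioms X_int])
  have "(\<integral>\<omega>. log 2 (r (Xb T \<omega>, seg {..<T} R \<omega>)) \<partial>M) \<le> \<alpha> + (\<Sum>t<T. \<iota> t) - real T * log 2 \<bar>det A\<bar>"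
  proof (rule rel_entropy_leD[OF rel_entropy_le_uncontrolled[OF cmi X0, of T] _ _ r1])
    show "integrable M (\<lambda>\<omega>. log 2 (r (Xb T \<omega>, seg {..<T} R \<omega>)))"
      using gauss_int by (subst Bochner_Integration.integrable_cong[OF refl r_X]) auto
  qed (auto simp: r_def less_imp_le[OF std_gauss_pos] std_gauss_pos split: prod.split)
  also have "(\<integral>\<omega>. log 2 (r (Xb T \<omega>, seg {..<T} R \<omega>)) \<partial>M) = (\<integral>\<omega>. log 2 (std_gauss (X T \<omega>)) \<partial>M)"
    by (rule Bochner_Integration.integral_cong[OF refl r_X])
  also have "\<dots> = real CARD('n) * log 2 (1 / sqrt (2 * pi)) - (\<integral>\<omega>. (norm (X T \<omega>))\<^sup>2 \<partial>M) / (2 * ln 2)"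
    unfolding log_std_gauss using X_int by (simp add: prob_space)
  finally have le: "real CARD('n) * log 2 (1 / sqrt (2 * pi)) - (\<integral>\<omega>. (norm (X T \<omega>))\<^sup>2 \<partial>M) / (2 * ln 2) \<le>
      \<alpha> + (\<Sum>t<T. \<iota> t) - real T * log 2 \<bar>det A\<bar>" .
  have "ennreal (\<integral>\<omega>. (norm (X T \<omega>))\<^sup>2 \<partial>M) < ennreal C"
    using C by (subst nn_integral_eq_integral[OF X_int, symmetric]) auto
  then have "(\<integral>\<omega>. (norm (X T \<omega>))\<^sup>2 \<partial>M) \<le> C"
    using ennreal_less_iff integral_nonneg_AE[of "\<lambda>\<omega>. (norm (X T \<omega>))\<^sup>2" M] by force
  then have "(\<integral>\<omega>. (norm (X T \<omega>))\<^sup>2 \<partial>M) / (2 * ln 2) \<le> C / (2 * ln 2)"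
    by (intro divide_right_mono) auto
  then show ?thesis using le by linarith
qed

text \<open>An infinite term makes the directed information infinite from then on. Otherwise all
  terms are real, and the constant left by the recursion vanishes after division by
  \<open>T\<close>.\<close>

lemma log_det_le_directed_info_rate:
  assumes X0: "finite_diff_entropy M (X 0)" and stable: "mean_square_stable M X"
  shows "ereal (log 2 \<bar>det A\<bar>) \<le> liminf (\<lambda>T. ereal (1 / real T) * directed_info M Xb R T)"
proof -
  let ?I = "\<lambda>t. cond_mutual_info 2 M (seg_space {..t}) borel (seg_space {..<t}) (seg {..t} Xb) (R t) (seg {..<t} R)"
  show ?thesis
  proof (cases "\<exists>t. ?I t = \<infinity>")
    case True
    then obtain t where t: "?I t = \<infinity>" ..
    have "\<forall>\<^sub>F T in sequentially. ereal (1 / real T) * directed_info M Xb R T = \<infinity>"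
    proof (rule eventually_sequentiallyI)
      fix T assume T: "Suc t \<le> T"
      then have "directed_info M Xb R T = \<infinity>"
        unfolding directed_info_def sum_Pinfty using t by (auto intro!: bexI[of _ t])
      then show "ereal (1 / real T) * directed_info M Xb R T = \<infinity>" using T by simp
    qed
    then have "liminf (\<lambda>T. ereal (1 / real T) * directed_info M Xb R T) = \<infinity>"
      by (subst Liminf_eq[of _ "\<lambda>_. \<infinity>"]) (simp_all add: Liminf_const)
    then show ?thesis by simp
  next
    case False
    define \<iota> where "\<iota> t = real_of_ereal (?I t)" for t
    have \<iota>: "?I t = ereal (\<iota> t)" for t
      using False unfolding \<iota>_def by (intro ereal_real'[symmetric]) (auto simp: cond_mutual_info_neq_MInf)
    obtain \<alpha> where \<alpha>: "rel_entropy_le M lborel (X 0) \<alpha>"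
      by (rule finite_diff_entropy_rel_entropy_le[OF X0])
    obtain C where C: "\<And>t. (\<integral>\<^sup>+\<omega>. ennreal ((norm (X t \<omega>))\<^sup>2) \<partial>M) < ennreal C"
      using stable by (auto simp: mean_square_stable_def)
    \<comment> \<open>Independent of \<open>T\<close>, because stability provides one
      \<open>C\<close> for all times.\<close>
    define K where "K = real CARD('n) * log 2 (1 / sqrt (2 * pi)) - C / (2 * ln 2) - \<alpha>"
    have sum: "real T * log 2 \<bar>det A\<bar> + K \<le> (\<Sum>t<T. \<iota> t)" for T
      unfolding K_def by (rule sum_information_ge[OF eq_refl[OF \<iota>] \<alpha> C])
    have "(\<lambda>T. log 2 \<bar>det A\<bar> + K / real T) \<longlonglongrightarrow> log 2 \<bar>det A\<bar> + 0"
      by (intro tendsto_intros tendsto_divide_0[OF tendsto_const] filterlim_compose[OF filterlim_at_top_imp_at_infinity filterlim_real_sequentially] filterlim_real_sequentially)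
    then have "(\<lambda>T. ereal (log 2 \<bar>det A\<bar> + K / real T)) \<longlonglongrightarrow> ereal (log 2 \<bar>det A\<bar>)" by simp
    then have "ereal (log 2 \<bar>det A\<bar>) = liminf (\<lambda>T. ereal (log 2 \<bar>det A\<bar> + K / real T))"
      by (intro lim_imp_Liminf[symmetric]) auto
    also have "\<dots> \<le> liminf (\<lambda>T. ereal (1 / real T) * directed_info M Xb R T)"
    proof (intro Liminf_mono eventually_sequentiallyI)
      fix T :: nat assume T: "1 \<le> T"
      have "log 2 \<bar>det A\<bar> + K / real T = (real T * log 2 \<bar>det A\<bar> + K) / real T"
        using T by (simp add: add_divide_distrib)
      also have "\<dots> \<le> (\<Sum>t<T. \<iota> t) / real T" by (intro divide_right_mono sum) simp
      finally show "ereal (log 2 \<bar>det A\<bar> + K / real T) \<le> ereal (1 / real T) * directed_info M Xb R T"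
        by (simp add: directed_info_def \<iota>)
    qed
    finally show ?thesis .
  qed
qed

end


theorem theorem2p1:
  fixes M :: "'w measure"
    and A :: "real^'n^'n" and B :: "real^'m^'n"
    and X :: "nat \<Rightarrow> 'w \<Rightarrow> real^'n"                   \<comment> \<open>state\<close>
    and U :: "nat \<Rightarrow> 'w \<Rightarrow> real^'m"                   \<comment> \<open>control\<close>
    and W :: "nat \<Rightarrow> 'w \<Rightarrow> real^'n"                   \<comment> \<open>plant noise\<close>
    and Se :: "nat \<Rightarrow> 'w \<Rightarrow> real"                     \<comment> \<open>sensor's transmitted signal\<close>
    and Sr :: "'k::finite \<Rightarrow> nat \<Rightarrow> 'w \<Rightarrow> real"        \<comment> \<open>relays' transmitted signals\<close>
    and Y :: "'k \<Rightarrow> nat \<Rightarrow> 'w \<Rightarrow> real^'q"              \<comment> \<open>relays' received signals\<close>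
    and R :: "nat \<Rightarrow> 'w \<Rightarrow> real^'r"                   \<comment> \<open>controller's received signals\<close>
    and Z :: "'k \<Rightarrow> nat \<Rightarrow> 'w \<Rightarrow> real^'q"              \<comment> \<open>channel noise at the relays\<close>
    and V :: "nat \<Rightarrow> 'w \<Rightarrow> real^'r"                   \<comment> \<open>channel noise at the controller\<close>
    and \<Lambda>0 K_W :: "real^'n^'n" and K_Z :: "'k \<Rightarrow> real^'q^'q" and K_V :: "real^'r^'r"
    and f :: "nat \<Rightarrow> (nat \<Rightarrow> real^'n) \<times> (nat \<Rightarrow> real^'m) \<Rightarrow> real"   \<comment> \<open>encoder policy\<close>
    and \<phi> :: "'k \<Rightarrow> nat \<Rightarrow> (nat \<Rightarrow> real^'q) \<Rightarrow> real"   \<comment> \<open>relay policies\<close>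
    and \<pi> :: "nat \<Rightarrow> (nat \<Rightarrow> real^'r) \<Rightarrow> real^'m"      \<comment> \<open>controller policy\<close>
    and D :: "nat \<Rightarrow> 'k set"
    and hs :: "nat \<Rightarrow> 'k \<Rightarrow> real^'q" and hr :: "nat \<Rightarrow> 'k \<Rightarrow> 'k \<Rightarrow> real^'q"
    and gs :: "nat \<Rightarrow> real^'r" and gr :: "nat \<Rightarrow> 'k \<Rightarrow> real^'r"
    and P_S :: real and P :: "'k \<Rightarrow> real"
  assumes prob: "prob_space M"
    \<comment> \<open>plant\<close>
    and plant: "\<And>t \<omega>. \<omega> \<in> space M \<Longrightarrow> X (Suc t) \<omega> = A *v X t \<omega> + B *v U t \<omega> + W t \<omega>"
    and X0_entropy: "finite_diff_entropy M (X 0)"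
    and X0_cov: "has_covariance M (X 0) \<Lambda>0"
    and W_white: "white_gaussian M W K_W"
    and W_indep: "independent_rvs M borel (X 0) (seg_space UNIV) (seg UNIV W)"
    and contr: "controllable A B"
    and eigen: "\<And>\<mu>. eigenvalue A \<mu> \<Longrightarrow> 1 \<le> cmod \<mu>"
    \<comment> \<open>sensor/encoder\<close>
    and f_meas: "\<And>t. f t \<in> borel_measurable (seg_space {..t} \<Otimes>\<^sub>M seg_space {..<t})"
    and encoder: "\<And>t \<omega>. \<omega> \<in> space M \<Longrightarrow> Se t \<omega> = f t (seg {..t} X \<omega>, seg {..<t} U \<omega>)"
    and Se_power: "avg_power_le M Se P_S"
    \<comment> \<open>relays\<close>
    and \<phi>_meas: "\<And>i t. \<phi> i t \<in> borel_measurable (seg_space (relay_window D i t))"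
    and relays: "\<And>i t \<omega>. \<omega> \<in> space M \<Longrightarrow> Sr i t \<omega> = \<phi> i t (seg (relay_window D i t) (Y i) \<omega>)"
    and Sr_power: "\<And>i. avg_power_le M (Sr i) (P i)"
    \<comment> \<open>Gaussian channels\<close>
    and relay_channels: "\<And>i t \<omega>. \<omega> \<in> space M \<Longrightarrow>
      Y i t \<omega> = Se t \<omega> *\<^sub>R hs t i + (\<Sum>j\<in>UNIV. Sr j t \<omega> *\<^sub>R hr t i j) + Z i t \<omega>"
    and controller_channel: "\<And>t \<omega>. \<omega> \<in> space M \<Longrightarrow>
      R t \<omega> = Se t \<omega> *\<^sub>R gs t + (\<Sum>j\<in>UNIV. Sr j t \<omega> *\<^sub>R gr t j) + V t \<omega>"
    and loop_free: "no_algebraic_loop D hr"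
    and Z_white: "\<And>i. white_gaussian M (Z i) (K_Z i)"
    and V_white: "white_gaussian M V K_V"
    and channel_indep: "independent_rvs M
      (borel \<Otimes>\<^sub>M seg_space UNIV) (\<lambda>\<omega>. (X 0 \<omega>, seg UNIV W \<omega>))
      (PiM UNIV (\<lambda>_. seg_space UNIV) \<Otimes>\<^sub>M seg_space UNIV) (\<lambda>\<omega>. (\<lambda>i. seg UNIV (Z i) \<omega>, seg UNIV V \<omega>))"
    \<comment> \<open>controller\<close>
    and \<pi>_meas: "\<And>t. \<pi> t \<in> borel_measurable (seg_space {..t})"
    and controller: "\<And>t \<omega>. \<omega> \<in> space M \<Longrightarrow> U t \<omega> = \<pi> t (seg {..t} R \<omega>)"
    \<comment> \<open>stability under these policies\<close>
    and stable: "mean_square_stable M X"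
  shows "ereal (log 2 \<bar>det A\<bar>)
    \<le> liminf (\<lambda>T. ereal (1 / real T) * directed_info M (uncontrolled A (X 0) W) R T)"
proof -
  interpret prob_space M by fact
  have "noisy_relay_network M A B X U W Se Sr Y R Z V f \<phi> \<pi> D hs hr gs gr K_W"
  proof (intro noisy_relay_network.intro relay_network.intro relay_network_axioms.intro
      noisy_relay_network_axioms.intro)
    show "X 0 \<in> borel_measurable M" "integrable M (\<lambda>\<omega>. (norm (X 0 \<omega>))\<^sup>2)"
      using X0_cov by (simp_all add: has_covariance_def)
    show "Z i t \<in> borel_measurable M" "V t \<in> borel_measurable M" for i t
      using Z_white V_white by (simp_all add: white_gaussian_def gaussian_vector_def)
    show "det A \<noteq> 0" by (rule det_neq_0_if_eigenvalues[OF eigen])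
  qed fact+
  then show ?thesis
    by (rule noisy_relay_network.log_det_le_directed_info_rate[OF _ X0_entropy stable])
qed

end
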